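(* Let $\ell,n,r$ be positive integers. There is a surjective homomorphism of $\mathcal A_\ell$-algebras $Q_r\colon S_{\mathcal A_\ell}(n,\ell r)\to S^*_{\mathcal A_\ell}(n,r)$.
   Context: Let $v$ be an indeterminate, $\mathcal A=\mathbb Z[v,v^{-1}]$, and $\mathcal A_\ell=\mathcal A/(\Phi_{2\ell}(v))$, where $\Phi_k$ is the $k$-th cyclotomic polynomial. For a finite field $\mathbf k$ and an $m$-dimensional $\mathbf k$-vector space $V$, let $\mathcal F^n$ be the set of $n$-step partial flags $(0=F_0\subseteq F_1\subseteq\dots\subseteq F_n=V)$ of subspaces. The $GL(V)$-orbits on $\mathcal F^n\times\mathcal F^n$ are indexed by the set $\Theta_m$ of $n\times n$ matrices $(a_{ij})$ of nonnegative integers with $\sum_{i,j}a_{ij}=m$, the orbit of $(F,F')$ corresponding to $a_{ij}=\dim\left(\frac{F_i\cap F'_j}{(F_{i-1}\cap F'_j)+(F_i\cap F'_{j-1})}\right)$. Let $S_{\mathbf k}(n,m)$ be the ring of $\mathbb Z$-valued $GL(V)$-invariant functions on $\mathcal F^n\times\mathcal F^n$ under convolution $(f\cdot g)(F,F'')=\sum_{F'}f(F,F')g(F',F'')$; it has $\mathbb Z$-basis the indicator functions $\mathbf 1_A$ of the orbits, $A\in\Theta_m$. It is known that the structure constants in this basis are given by polynomials in $|\mathbf k|$ with integer coefficients independent of $\mathbf k$. The $q$-Schur algebra $S_q(n,m)$ is the $\mathbb Z[q]$-algebra ($q$ an indeterminate) with basis $\{1_A:A\in\Theta_m\}$ and these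 polynomials in $q$ as structure constants, so that specializing $q=|\mathbf k|$ gives $S_{\mathbf k}(n,m)$ for every finite field $\mathbf k$. Let $S_v(n,m)=\mathcal A\otimes_{\mathbb Z[q]}S_q(n,m)$ via $q\mapsto v^2$. For an $\mathcal A$-algebra $\phi\colon\mathcal A\to R$, $S_R(n,m)=R\otimes_{\mathcal A}S_v(n,m)$ (via $\phi$), and $S_R^*(n,m)=R\otimes_{\phi'}S_v(n,m)$, where $\phi'\colon\mathcal A\to R$ is the homomorphism with $\phi'(v)=\phi(v)^\ell$. *)

theory Defs
  imports
    "Jordan_Normal_Form.VS_Connect"
    "HOL-Algebra.QuotRing"
    "HOL-Library.Poly_Mapping"
    Complex_Main
begin

section \<open>Partial flags and their relative position\<close>

text \<open>An \<open>n\<close>-step flag is a function on \<open>{0..n}\<close>, \<open>undefined\<close> elsewhere.\<close>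

definition flags :: "('k, 'c) ring_scheme \<Rightarrow> ('k, 'v, 'd) module_scheme \<Rightarrow> nat \<Rightarrow> (nat \<Rightarrow> 'v set) set"
  where "flags K V n =
    {F \<in> extensional {0..n}.
       (\<forall>i\<le>n. subspace K (F i) V) \<and> F 0 = {\<zero>\<^bsub>V\<^esub>} \<and> F n = carrier V \<and>
       (\<forall>i<n. F i \<subseteq> F (Suc i))}"

abbreviation flag_pairs ::
    "('k, 'c) ring_scheme \<Rightarrow> ('k, 'v, 'd) module_scheme \<Rightarrow> nat \<Rightarrow>
     ((nat \<Rightarrow> 'v set) \<times> (nat \<Rightarrow> 'v set)) set"
  where "flag_pairs K V n \<equiv> flags K V n \<times> flags K V n"

text \<open>The quotient \<open>V / W\<close> of a module by a submodule. The ring multiplication and unit of the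
  module record play no role.\<close>

definition quotient_module ::
    "('k, 'v, 'd) module_scheme \<Rightarrow> 'v set \<Rightarrow> ('k, 'v set) module"
  where "quotient_module V W =
    \<lparr>carrier = a_rcosets\<^bsub>V\<^esub> W,
     monoid.mult = undefined,
     one = undefined,
     zero = W,
     add = (\<lambda>X Y. X <+>\<^bsub>V\<^esub> Y),
     smult = (\<lambda>a X. \<Union>x\<in>X. W +>\<^bsub>V\<^esub> (a \<odot>\<^bsub>V\<^esub> x))\<rparr>"

text \<open>Matrices with rows and columns indexed by \<open>{1..n}\<close> are functions vanishing outside
  \<open>{1..n} \<times> {1..n}\<close>.\<close>

type_synonym nmat = "nat \<Rightarrow> nat \<Rightarrow> nat"

definition rel_pos ::
    "('k, 'c) ring_scheme \<Rightarrow> ('k, 'v, 'd) module_scheme \<Rightarrow> nat \<Rightarrow>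
     (nat \<Rightarrow> 'v set) \<times> (nat \<Rightarrow> 'v set) \<Rightarrow> nmat"
  where "rel_pos K V n = (\<lambda>(F, F') i j.
    if i \<in> {1..n} \<and> j \<in> {1..n} then
      vectorspace.dim K
        (quotient_module (V\<lparr>carrier := F i \<inter> F' j\<rparr>)
           ((F (i - 1) \<inter> F' j) <+>\<^bsub>V\<^esub> (F i \<inter> F' (j - 1))))
    else 0)"

definition Theta :: "nat \<Rightarrow> nat \<Rightarrow> nmat set"
  where "Theta n m =
    {a. (\<forall>i j. \<not> (i \<in> {1..n} \<and> j \<in> {1..n}) \<longrightarrow> a i j = 0) \<and>
        (\<Sum>i=1..n. \<Sum>j=1..n. a i j) = m}"

definition GL :: "('k, 'c) ring_scheme \<Rightarrow> ('k, 'v, 'd) module_scheme \<Rightarrow> ('v \<Rightarrow> 'v) set"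
  where "GL K V = {g \<in> LinearCombinations.module_hom K V V. bij_betw g (carrier V) (carrier V)}"

definition act_flag :: "nat \<Rightarrow> ('v \<Rightarrow> 'v) \<Rightarrow> (nat \<Rightarrow> 'v set) \<Rightarrow> (nat \<Rightarrow> 'v set)"
  where "act_flag n g F = (\<lambda>i\<in>{0..n}. g ` F i)"

definition flag_orbits ::
    "('k, 'c) ring_scheme \<Rightarrow> ('k, 'v, 'd) module_scheme \<Rightarrow> nat \<Rightarrow>
     ((nat \<Rightarrow> 'v set) \<times> (nat \<Rightarrow> 'v set)) set set"
  where "flag_orbits K V n =
    (\<lambda>(F, F'). (\<lambda>g. (act_flag n g F, act_flag n g F')) ` GL K V) ` flag_pairs K V n"

text \<open>For \<open>A \<in> Theta n (dim V)\<close> exactly one orbit consists of pairs with matrix \<open>A\<close>, and the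
  union below selects it.\<close>

definition flag_orbit ::
    "('k, 'c) ring_scheme \<Rightarrow> ('k, 'v, 'd) module_scheme \<Rightarrow> nat \<Rightarrow> nmat \<Rightarrow>
     ((nat \<Rightarrow> 'v set) \<times> (nat \<Rightarrow> 'v set)) set"
  where "flag_orbit K V n A = \<Union> {X \<in> flag_orbits K V n. \<exists>p\<in>X. rel_pos K V n p = A}"

section \<open>The convolution ring over a finite field\<close>

definition schur_ring ::
    "('k, 'c) ring_scheme \<Rightarrow> ('k, 'v, 'd) module_scheme \<Rightarrow> nat \<Rightarrow>
     ((nat \<Rightarrow> 'v set) \<times> (nat \<Rightarrow> 'v set) \<Rightarrow> int) ring"
  where "schur_ring K V n =
    \<lparr>carrier = {f \<in> extensional (flag_pairs K V n).
       \<forall>g\<in>GL K V. \<forall>(F, F')\<in>flag_pairs K V n. f (act_flag n g F, act_flag n g F') = f (F, F')},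
     monoid.mult = (\<lambda>f g. \<lambda>(F, F'')\<in>flag_pairs K V n. \<Sum>F'\<in>flags K V n. f (F, F') * g (F', F'')),
     one = (\<lambda>(F, F')\<in>flag_pairs K V n. if F = F' then 1 else 0),
     zero = (\<lambda>p\<in>flag_pairs K V n. 0),
     add = (\<lambda>f g. \<lambda>p\<in>flag_pairs K V n. f p + g p)\<rparr>"

definition orbit_fun ::
    "('k, 'c) ring_scheme \<Rightarrow> ('k, 'v, 'd) module_scheme \<Rightarrow> nat \<Rightarrow> nmat \<Rightarrow>
     (nat \<Rightarrow> 'v set) \<times> (nat \<Rightarrow> 'v set) \<Rightarrow> int"
  where "orbit_fun K V n A = (\<lambda>p\<in>flag_pairs K V n. if p \<in> flag_orbit K V n A then 1 else 0)"

text \<open>All finite fields and finite-dimensional vector spaces over them occur, up to isomorphism,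
  with a carrier contained in the type \<open>nat\<close>; this is what the quantification over \<open>K\<close> and \<open>V\<close>
  in \<open>structure_polys\<close> relies on.\<close>

definition finite_vectorspace :: "nat \<Rightarrow> nat ring \<Rightarrow> (nat, nat) module \<Rightarrow> bool"
  where "finite_vectorspace m K V \<longleftrightarrow>
    vectorspace K V \<and> finite (carrier K) \<and> vectorspace.fin_dim K V \<and> vectorspace.dim K V = m"

definition structure_polys :: "nat \<Rightarrow> nat \<Rightarrow> (nmat \<Rightarrow> nmat \<Rightarrow> nmat \<Rightarrow> int poly) \<Rightarrow> bool"
  where "structure_polys n m c \<longleftrightarrow>
    (\<forall>K V. finite_vectorspace m K V \<longrightarrow>
      (\<forall>A\<in>Theta n m. \<forall>B\<in>Theta n m.
         orbit_fun K V n A \<otimes>\<^bsub>schur_ring K V n\<^esub> orbit_fun K V n B =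
         (\<lambda>p\<in>flag_pairs K V n.
            \<Sum>C\<in>Theta n m. poly (c A B C) (int (card (carrier K))) * orbit_fun K V n C p)))"

text \<open>Such a family exists, and its members with indices in \<open>Theta n m\<close> are unique, since an
  integer polynomial is determined by its values at the prime powers. Other members are never
  used.\<close>

definition schur_poly :: "nat \<Rightarrow> nat \<Rightarrow> nmat \<Rightarrow> nmat \<Rightarrow> nmat \<Rightarrow> int poly"
  where "schur_poly n m = (SOME c. structure_polys n m c)"

section \<open>Algebras with a finite basis and extension of scalars\<close>

text \<open>The free \<open>R\<close>-module on a finite set \<open>I\<close>, with structure constants \<open>\<gamma>\<close> (the coefficient
  of \<open>C\<close> in \<open>A \<cdot> B\<close> is \<open>\<gamma> A B C\<close>) and unit \<open>u\<close>.\<close>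

definition based_algebra ::
    "('r, 'c) ring_scheme \<Rightarrow> 'i set \<Rightarrow> ('i \<Rightarrow> 'r) \<Rightarrow> ('i \<Rightarrow> 'i \<Rightarrow> 'i \<Rightarrow> 'r) \<Rightarrow> ('r, 'i \<Rightarrow> 'r) module"
  where "based_algebra R I u \<gamma> =
    \<lparr>carrier = I \<rightarrow>\<^sub>E carrier R,
     monoid.mult = (\<lambda>x y. \<lambda>C\<in>I. \<Oplus>\<^bsub>R\<^esub>p\<in>I \<times> I.
        (x (fst p) \<otimes>\<^bsub>R\<^esub> y (snd p)) \<otimes>\<^bsub>R\<^esub> \<gamma> (fst p) (snd p) C),
     one = (\<lambda>A\<in>I. u A),
     zero = (\<lambda>A\<in>I. \<zero>\<^bsub>R\<^esub>),
     add = (\<lambda>x y. \<lambda>A\<in>I. x A \<oplus>\<^bsub>R\<^esub> y A),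
     smult = (\<lambda>a x. \<lambda>A\<in>I. a \<otimes>\<^bsub>R\<^esub> x A)\<rparr>"

definition basis_elt :: "('r, 'c) ring_scheme \<Rightarrow> 'i set \<Rightarrow> 'i \<Rightarrow> 'i \<Rightarrow> 'r"
  where "basis_elt R I A = (\<lambda>B\<in>I. if B = A then \<one>\<^bsub>R\<^esub> else \<zero>\<^bsub>R\<^esub>)"

text \<open>The tensor product \<open>R' \<otimes>\<^sub>R S\<close> along \<open>\<phi>\<close>, for an \<open>R\<close>-algebra \<open>S\<close> whose underlying module is
  free on \<open>I\<close>: it is free over \<open>R'\<close> on the elements \<open>1 \<otimes> A\<close>, and its structure constants and unit
  are the images of those of \<open>S\<close>.\<close>

definition extend_scalars ::
    "('r, 'c) ring_scheme \<Rightarrow> ('r \<Rightarrow> 's) \<Rightarrow> ('s, 'd) ring_scheme \<Rightarrow> 'i set \<Rightarrow> ('r, 'i \<Rightarrow> 'r) module \<Rightarrow>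
     ('s, 'i \<Rightarrow> 's) module"
  where "extend_scalars R \<phi> R' I S =
    based_algebra R' I
      (\<lambda>A. \<phi> (\<one>\<^bsub>S\<^esub> A))
      (\<lambda>A B C. \<phi> ((basis_elt R I A \<otimes>\<^bsub>S\<^esub> basis_elt R I B) C))"

definition algebra_hom ::
    "('r, 'c) ring_scheme \<Rightarrow> ('r, 'a, 'd) module_scheme \<Rightarrow> ('r, 'b, 'e) module_scheme \<Rightarrow> ('a \<Rightarrow> 'b) set"
  where "algebra_hom R M N = Ring.ring_hom M N \<inter> LinearCombinations.module_hom R M N"

section \<open>Laurent polynomials and cyclotomic quotients\<close>

text \<open>The group ring of the additive group of integers: \<open>Poly_Mapping.single i a\<close> is the Laurent
  monomial with exponent \<open>i\<close> and coefficient \<open>a\<close>.\<close>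

type_synonym laurent = "int \<Rightarrow>\<^sub>0 int"

definition lv :: laurent
  where "lv = Poly_Mapping.single 1 1"

text \<open>The evaluation of an integer polynomial at a Laurent polynomial.\<close>

definition eval_laurent :: "laurent \<Rightarrow> int poly \<Rightarrow> laurent"
  where "eval_laurent x p = poly (map_poly of_int p) x"

text \<open>The endomorphism \<open>v \<mapsto> v\<^sup>l\<close> of the ring of Laurent polynomials.\<close>

definition laurent_power :: "nat \<Rightarrow> laurent \<Rightarrow> laurent"
  where "laurent_power l f =
    (\<Sum>i\<in>Poly_Mapping.keys f. Poly_Mapping.single (int l * i) (Poly_Mapping.lookup f i))"

definition cyclotomic :: "nat \<Rightarrow> int poly"
  where "cyclotomic k =
    (THE p. map_poly of_int p =
       (\<Prod>z\<in>{z::complex. z ^ k = 1 \<and> (\<forall>j. 0 < j \<and> j < k \<longrightarrow> z ^ j \<noteq> 1)}. [:- z, 1:]))"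

definition cyc_ideal :: "nat \<Rightarrow> laurent set"
  where "cyc_ideal l = PIdl\<^bsub>class_ring\<^esub> (eval_laurent lv (cyclotomic (2 * l)))"

definition cyc_ring :: "nat \<Rightarrow> laurent set ring"
  where "cyc_ring l = class_ring Quot cyc_ideal l"

definition cyc_proj :: "nat \<Rightarrow> laurent \<Rightarrow> laurent set"
  where "cyc_proj l a = cyc_ideal l +>\<^bsub>class_ring\<^esub> a"

section \<open>The q-Schur algebra and its specialisations\<close>

text \<open>The unit is the sum of the basis elements indexed by diagonal matrices: a pair of flags has
  a diagonal matrix if and only if the two flags coincide.\<close>

definition S_q :: "nat \<Rightarrow> nat \<Rightarrow> (int poly, nmat \<Rightarrow> int poly) module"
  where "S_q n m =
    based_algebra class_ring (Theta n m)
      (\<lambda>A. if \<forall>i j. i \<noteq> j \<longrightarrow> A i j = 0 then 1 else 0)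
      (schur_poly n m)"

definition S_v :: "nat \<Rightarrow> nat \<Rightarrow> (laurent, nmat \<Rightarrow> laurent) module"
  where "S_v n m =
    extend_scalars class_ring (eval_laurent (lv ^ 2)) class_ring (Theta n m) (S_q n m)"

definition S_at ::
    "('r, 'c) ring_scheme \<Rightarrow> (laurent \<Rightarrow> 'r) \<Rightarrow> nat \<Rightarrow> nat \<Rightarrow> ('r, nmat \<Rightarrow> 'r) module"
  where "S_at R \<phi> n m = extend_scalars class_ring \<phi> R (Theta n m) (S_v n m)"

text \<open>The homomorphism sending \<open>v\<close> to \<open>\<phi>(v)\<^sup>l\<close> is \<open>\<phi>\<close> precomposed with \<open>v \<mapsto> v\<^sup>l\<close>.\<close>

definition S_star ::
    "nat \<Rightarrow> ('r, 'c) ring_scheme \<Rightarrow> (laurent \<Rightarrow> 'r) \<Rightarrow> nat \<Rightarrow> nat \<Rightarrow> ('r, nmat \<Rightarrow> 'r) module"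
  where "S_star l R \<phi> n m = S_at R (\<phi> \<circ> laurent_power l) n m"

end

(*
  Let E/D be an extension of finite fields of degree l, q = |D|, and let V be an r-dimensional
  E-vector space. The group of units of E acts on the D-flags of V and fixes exactly the E-flags.
  The stabiliser of a D-flag together with 0 is a field between D and E, so all other orbits have
  (q^l - 1) / (q^d - 1) elements for a proper divisor d of l, a multiple of the value of the
  cyclotomic polynomial of order 2l at t if q = t^2. If two E-flags have relative position C over
  E, they have relative position l C over D. Counting the flags in given positions to both of them
  shows that, modulo this value, the structure constants of S(n, lr) at (A, B, l C) are the
  structure constants of S(n, r) with parameter q^l at (A / l, B / l, C), and 0 if A or B is not
  divisible by l. As this holds for infinitely many t, the congruence holds for polynomials, and
  the map which sends 1_A to 1_(A / l) or to 0 is a homomorphism.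

  The polynomiality of the structure constants is obtained by replacing the first flag by a
  complete flag G: moving G inside a panel (the flags which differ from G in one step) changes the
  relative position of G and a flag by an adjacent transposition of a word, which gives the
  recursion of the action of the Hecke algebra on tensor space. The argument uses only that the
  subspaces form a ranked modular lattice with q + 1 flags in each panel.
*)

theory Submission
  imports Defs "HOL-Algebra.Algebraic_Closure_Type" "HOL-Library.Z2"
begin

hide_const (open) up_ring.monom up_ring.coeff Real_Vector_Spaces.subspace Multiset.mult
  Polynomial.smult Modules.module Polynomials.degree Polynomials.lead_coeff
hide_fact (open) Real_Vector_Spaces.subspace_def

section \<open>Words and the Hecke recursion\<close>

text \<open>\<open>schur_poly\<close> is a choice by \<open>SOME\<close>, so nothing is known about
  it until some family satisfying \<open>structure_polys\<close> has been exhibited; hence the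
  polynomiality of the counts is part of the proof. Counting yields divisibility of integers, one
  value t of v at a time, whereas the quotient ring asks for divisibility by a polynomial. The
  passage works because the cyclotomic polynomial is monic: the remainder of a division by it is
  eventually smaller in absolute value than the divisor, so divisibility at large integers makes the
  remainder vanish there. The values must be integers t for which a field with t^2 elements exists;
  the powers of 2 serve. The order 2l appears because, as a polynomial in t, (t^(2l) - 1) / (t^(2d)
  - 1) keeps all primitive 2l-th roots of unity as zeros. The map restricts an invariant function
  from pairs of D-flags to pairs of E-flags: the coordinate at l C becomes the coordinate at C.
  Restriction fails to respect convolution exactly by the sum over intermediate flags that are not
  defined over E, and this sum is what the orbit argument kills.\<close>

definition words :: "nat \<Rightarrow> nat \<Rightarrow> (nat \<Rightarrow> nat) set"
  where "words n m = {w. (\<forall>a\<in>{1..m}. w a \<in> {1..n}) \<and> (\<forall>a. a \<notin> {1..m} \<longrightarrow> w a = 0)}"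

definition pair_count :: "nat \<Rightarrow> (nat \<Rightarrow> nat) \<Rightarrow> (nat \<Rightarrow> nat) \<Rightarrow> nmat"
  where "pair_count m w x = (\<lambda>i j. card {a\<in>{1..m}. w a = i \<and> x a = j})"

definition sorted_word :: "nat \<Rightarrow> (nat \<Rightarrow> nat) \<Rightarrow> bool"
  where "sorted_word m w \<longleftrightarrow> (\<forall>a\<in>{1..<m}. w a \<le> w (a + 1))"

definition swap_at :: "nat \<Rightarrow> (nat \<Rightarrow> nat) \<Rightarrow> nat \<Rightarrow> nat"
  where "swap_at i w = w(i := w (i + 1), i + 1 := w i)"

text \<open>For sorted \<open>w\<close> the letters at most \<open>j\<close> fill the first
  \<open>rank_in m w j\<close> places, so this is the index of the member of a complete flag that
  serves as step \<open>j\<close> of a coarser flag.\<close>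

definition rank_in :: "nat \<Rightarrow> (nat \<Rightarrow> nat) \<Rightarrow> nat \<Rightarrow> nat"
  where "rank_in m w j = card {a\<in>{1..m}. w a \<le> j}"

lemma finite_words: "finite (words n m)"
  unfolding words_def using finite_set_of_finite_funs[of "{1..m}" "{1..n}" 0]
  by (rule rev_finite_subset) auto

lemma words_in: "w \<in> words n m \<Longrightarrow> 1 \<le> a \<Longrightarrow> a \<le> m \<Longrightarrow> 1 \<le> w a \<and> w a \<le> n"
  by (auto simp: words_def)

lemma swap_at_simps [simp]:
  "swap_at i w i = w (Suc i)" "swap_at i w (Suc i) = w i"
  "swap_at i (swap_at i w) = w"
  "a \<noteq> i \<Longrightarrow> a \<noteq> Suc i \<Longrightarrow> swap_at i w a = w a"
  by (auto simp: swap_at_def fun_eq_iff)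

lemma swap_at_words: "w \<in> words n m \<Longrightarrow> 1 \<le> i \<Longrightarrow> i < m \<Longrightarrow> swap_at i w \<in> words n m"
  by (auto simp: words_def swap_at_def)

lemma sorted_wordD:
  assumes "sorted_word m w" "1 \<le> a" "a \<le> b" "b \<le> m"
  shows "w a \<le> w b"
  using assms(3,4)
proof (induction b rule: dec_induct)
  case (step k)
  then have "w k \<le> w (k + 1)"
    using assms(1,2) by (auto simp: sorted_word_def)
  with step show ?case by simp
qed simp

lemma rank_in_le: "rank_in m w j \<le> m"
proof -
  have "card {a\<in>{1..m}. w a \<le> j} \<le> card {1..m}" by (intro card_mono) auto
  then show ?thesis by (simp add: rank_in_def)
qed

lemma sorted_rank_in:
  assumes "sorted_word m w" "1 \<le> a" "a \<le> m"
  shows "w a \<le> j \<longleftrightarrow> a \<le> rank_in m w j"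
proof
  assume "w a \<le> j"
  then have "{1..a} \<subseteq> {a\<in>{1..m}. w a \<le> j}"
    using assms(2,3) sorted_wordD[OF assms(1)] by (auto intro: order_trans[of _ "w a"])
  then have "card {1..a} \<le> rank_in m w j"
    unfolding rank_in_def by (intro card_mono) auto
  then show "a \<le> rank_in m w j" by simp
next
  assume a: "a \<le> rank_in m w j"
  show "w a \<le> j"
  proof (rule ccontr)
    assume "\<not> w a \<le> j"
    then have "{a\<in>{1..m}. w a \<le> j} \<subseteq> {1..<a}"
      using sorted_wordD[OF assms(1,2)] by (auto simp: not_le) (meson leD le_less_trans not_less)
    then have "rank_in m w j \<le> card {1..<a}"
      unfolding rank_in_def by (intro card_mono) auto
    then show False using a assms by simp
  qed
qed

text \<open>The two changed terms are added on opposite sides, which avoids subtraction of natural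
  numbers.\<close>

lemma sum_swap_at:
  assumes "1 \<le> i" "i < m"
  shows "(\<Sum>a=1..m. a * swap_at i w a) + (i * w i + (i + 1) * w (i + 1)) =
         (\<Sum>a=1..m. a * w a) + (i * w (i + 1) + (i + 1) * w i)"
proof -
  have s: "sum f {1..m} = sum f ({1..m} - {i, i + 1}) + (f i + f (i + 1))" for f :: "nat \<Rightarrow> nat"
    using assms sum.subset_diff[of "{i, i + 1}" "{1..m}" f] by auto
  have e: "(\<Sum>a\<in>{1..m} - {i, i + 1}. a * swap_at i w a) = (\<Sum>a\<in>{1..m} - {i, i + 1}. a * w a)"
    by (intro sum.cong) auto
  show ?thesis
    unfolding s[of "\<lambda>a. a * swap_at i w a"] s[of "\<lambda>a. a * w a"] e by simp
qed

text \<open>Carrying the larger letter to the right raises the weight. The weight is the potential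
  that drives both the sorting induction and the choice of an adapted complete flag.\<close>

lemma sum_swap_at_less:
  assumes "1 \<le> i" "i < m" "w (i + 1) < w i"
  shows "(\<Sum>a=1..m. a * w a) < (\<Sum>a=1..m. a * swap_at i w a)"
proof -
  have "i * w i + (i + 1) * w (i + 1) < i * w (i + 1) + (i + 1) * w i"
    using assms(3) by (simp add: algebra_simps)
  then show ?thesis
    using sum_swap_at[OF assms(1,2), of w] by linarith
qed

lemma sum_word_le:
  fixes w :: "nat \<Rightarrow> nat"
  assumes "\<And>a. 1 \<le> a \<Longrightarrow> a \<le> m \<Longrightarrow> w a \<le> N"
  shows "(\<Sum>a=1..m. a * w a) \<le> m * (m * N)"
proof -
  have "(\<Sum>a=1..m. a * w a) \<le> (\<Sum>a=1..m. m * N)"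
    by (rule sum_mono, rule mult_mono) (use assms in auto)
  then show ?thesis by simp
qed

text \<open>Removing one descent at a time terminates: the weight grows at each step and is bounded
  by \<open>m * (m * n)\<close>.\<close>

lemma word_sort_induct [consumes 1, case_names sorted swap]:
  assumes "w \<in> words n m"
    and "\<And>w. w \<in> words n m \<Longrightarrow> sorted_word m w \<Longrightarrow> P w"
    and "\<And>w i. w \<in> words n m \<Longrightarrow> 1 \<le> i \<Longrightarrow> i < m \<Longrightarrow> w (i + 1) < w i \<Longrightarrow> P (swap_at i w) \<Longrightarrow> P w"
  shows "P w"
  using assms(1)
proof (induction "m * (m * n) - (\<Sum>a=1..m. a * w a)" arbitrary: w rule: less_induct)
  case less
  show ?case
  proof (cases "sorted_word m w")
    case True
    then show ?thesis using assms(2) less by blast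
  next
    case False
    then obtain i where i: "1 \<le> i" "i < m" "w (i + 1) < w i"
      by (auto simp: sorted_word_def not_le)
    have sw: "swap_at i w \<in> words n m"
      using less i swap_at_words by blast
    have "(\<Sum>a=1..m. a * swap_at i w a) \<le> m * (m * n)"
      using words_in[OF sw] by (intro sum_word_le) auto
    then have "P (swap_at i w)"
      using sum_swap_at_less[OF i] sw by (intro less.hyps) linarith+
    then show ?thesis using assms(3) less i by blast
  qed
qed

text \<open>The recursion of the right action of the Hecke algebra on tensor space: \<open>p\<close> is the number of
  flags in position \<open>w\<close> to a fixed complete flag \<open>G\<close> and in position \<open>B\<close> to a fixed flag which is
  in position \<open>x\<close> to \<open>G\<close>.\<close>

inductive hecke :: "nat \<Rightarrow> nmat \<Rightarrow> (nat \<Rightarrow> nat) \<Rightarrow> (nat \<Rightarrow> nat) \<Rightarrow> int poly \<Rightarrow> bool"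
  for m B where
  sorted: "sorted_word m w \<Longrightarrow> hecke m B w x (if pair_count m w x = B then 1 else 0)"
| equal: "1 \<le> i \<Longrightarrow> i < m \<Longrightarrow> w (i + 1) < w i \<Longrightarrow> x i = x (i + 1) \<Longrightarrow>
    hecke m B (swap_at i w) x p \<Longrightarrow> hecke m B w x ([:0, 1:] * p)"
| ascent: "1 \<le> i \<Longrightarrow> i < m \<Longrightarrow> w (i + 1) < w i \<Longrightarrow> x i < x (i + 1) \<Longrightarrow>
    hecke m B (swap_at i w) (swap_at i x) p \<Longrightarrow> hecke m B w x ([:0, 1:] * p)"
| descent: "1 \<le> i \<Longrightarrow> i < m \<Longrightarrow> w (i + 1) < w i \<Longrightarrow> x (i + 1) < x i \<Longrightarrow>
    hecke m B (swap_at i w) (swap_at i x) p \<Longrightarrow> hecke m B (swap_at i w) x p' \<Longrightarrow>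
    hecke m B w x (p + [:- 1, 1:] * p')"

text \<open>A word may have several descents, so \<open>hecke\<close> is a relation and not a
  function. Every polynomial it derives takes the values of the same count by
  \<open>hecke_word_count\<close>, so that choosing one by \<open>SOME\<close> is harmless.\<close>

lemma hecke_exists:
  assumes "w \<in> words n m"
  shows "\<exists>p. hecke m B w x p"
  using assms
proof (induction w arbitrary: x rule: word_sort_induct)
  case (sorted w)
  then show ?case using hecke.sorted by blast
next
  case (swap w i)
  consider "x i = x (i + 1)" | "x i < x (i + 1)" | "x (i + 1) < x i" by linarith
  then show ?case
    using swap by cases (meson hecke.intros)+
qed

text \<open>Any two flags have a common complete refinement of the first one for which the pair of words
  is sorted lexicographically, so a count which is computed with this refinement depends on the
  relative position \<open>C\<close> of the two flags only.\<close>

definition lex_sorted :: "nat \<Rightarrow> nat \<Rightarrow> nmat \<Rightarrow> (nat \<Rightarrow> nat) \<times> (nat \<Rightarrow> nat) \<Rightarrow> bool"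
  where "lex_sorted n m C = (\<lambda>(s, x). s \<in> words n m \<and> x \<in> words n m \<and> pair_count m s x = C \<and>
    sorted_word m (\<lambda>a. s a * (n + 1) + x a))"

text \<open>The letters in the second place are at most \<open>n\<close>, so
  \<open>s * (n + 1) + x\<close> writes the pair in base \<open>n + 1\<close>, and lexicographic
  sortedness of two words becomes sortedness of one word of keys.\<close>

lemma lex_key_less:
  assumes "x < n + 1" "x' < n + (1::nat)"
  shows "s * (n + 1) + x \<le> s' * (n + 1) + x' \<longleftrightarrow> s < s' \<or> s = s' \<and> x \<le> x'"
proof -
  consider "s < s'" | "s = s'" | "s' < s" by linarith
  then show ?thesis
  proof cases
    case 1
    then have "(s + 1) * (n + 1) \<le> s' * (n + 1)" by (intro mult_right_mono) auto
    then show ?thesis using 1 assms by simp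
  next
    case 3
    then have "(s' + 1) * (n + 1) \<le> s * (n + 1)" by (intro mult_right_mono) auto
    then show ?thesis using 3 assms by simp
  qed simp
qed

lemma lex_key_inject:
  assumes "x < n + 1" "x' < n + (1::nat)" "s * (n + 1) + x = s' * (n + 1) + x'"
  shows "s = s'" "x = x'"
  using lex_key_less[OF assms(1,2), of s s'] lex_key_less[OF assms(2,1), of s' s] assms(3) by auto

lemma sorted_word_list:
  "sorted_word m f \<Longrightarrow> sorted (map f [1..<m + 1])"
  by (auto simp: sorted_iff_nth_mono simp del: upt_Suc intro!: sorted_wordD[of m f])

lemma count_map_upt: "count (mset (map f [1..<m + 1])) k = card {a\<in>{1..m}. f a = k}"
proof (induction m)
  case (Suc m)
  have "{a\<in>{1..Suc m}. f a = k} = {a\<in>{1..m}. f a = k} \<union> (if f (Suc m) = k then {Suc m} else {})"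
    by (auto simp: le_Suc_eq)
  then show ?case using Suc by (auto simp: card_insert_if)
qed simp

text \<open>The matrix \<open>C\<close> prescribes how often each key occurs, hence the multiset of
  keys, and a sorted list is determined by its multiset. Decoding the keys returns the two
  words.\<close>

lemma lex_sorted_unique:
  assumes "lex_sorted n m C (s, x)" "lex_sorted n m C (s', x')"
  shows "s = s'" "x = x'"
proof -
  define key where "key s x = (\<lambda>a. s a * (n + 1) + x a)" for s x :: "nat \<Rightarrow> nat"
  have cnt: "count (mset (map (key s x) [1..<m + 1])) k =
      (\<Sum>(i, j) \<in> {1..n} \<times> {1..n}. if i * (n + 1) + j = k then C i j else 0)"
    if "lex_sorted n m C (s, x)" for s x k
  proof -
    have w: "s \<in> words n m" "x \<in> words n m" and C: "C = pair_count m s x"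
      using that by (auto simp: lex_sorted_def)
    have "count (mset (map (key s x) [1..<m + 1])) k = card {a\<in>{1..m}. key s x a = k}"
      by (rule count_map_upt)
    also have "{a\<in>{1..m}. key s x a = k} =
        (\<Union>(i, j)\<in>{1..n} \<times> {1..n}. {a\<in>{1..m}. i * (n + 1) + j = k \<and> s a = i \<and> x a = j})"
      using words_in[OF w(1)] words_in[OF w(2)] by (auto simp: key_def)
    also have "card \<dots> = (\<Sum>(i, j) \<in> {1..n} \<times> {1..n}.
        card {a\<in>{1..m}. i * (n + 1) + j = k \<and> s a = i \<and> x a = j})"
      by (subst card_UN_disjoint) (auto simp: case_prod_beta)
    also have "\<dots> = (\<Sum>(i, j) \<in> {1..n} \<times> {1..n}. if i * (n + 1) + j = k then C i j else 0)"
      by (intro sum.cong) (auto simp: C pair_count_def)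
    finally show ?thesis .
  qed
  have "map (key s x) [1..<m + 1] = map (key s' x') [1..<m + 1]"
  proof -
    have "mset (map (key s x) [1..<m + 1]) = mset (map (key s' x') [1..<m + 1])"
      by (intro multiset_eqI) (simp only: cnt[OF assms(1)] cnt[OF assms(2)])
    moreover have "sorted (map (key s x) [1..<m + 1])" "sorted (map (key s' x') [1..<m + 1])"
      using assms unfolding lex_sorted_def key_def by (simp_all only: sorted_word_list prod.case)
    ultimately show ?thesis by (metis properties_for_sort)
  qed
  then have eq: "key s x a = key s' x' a" if "1 \<le> a" "a \<le> m" for a
    using that by auto
  have w: "s \<in> words n m" "x \<in> words n m" "s' \<in> words n m" "x' \<in> words n m"
    using assms by (auto simp: lex_sorted_def)
  have "s a = s' a \<and> x a = x' a" for a
  proof (cases "1 \<le> a \<and> a \<le> m")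
    case True
    then have "x a < n + 1" "x' a < n + 1"
      using words_in[OF w(2)] words_in[OF w(4)] by (simp_all add: le_imp_less_Suc)
    from lex_key_inject[OF this, of "s a" "s' a"] eq[of a] True show ?thesis
      by (simp add: key_def)
  next
    case False
    then have "a \<notin> {1..m}" by auto
    then show ?thesis using w by (auto simp: words_def dest!: spec[of _ a])
  qed
  then show "s = s'" "x = x'" by auto
qed

lemma pair_count_Theta:
  assumes "w \<in> words n m" "x \<in> words n m"
  shows "pair_count m w x \<in> Theta n m"
proof -
  have "pair_count m w x i j = 0" if "\<not> (i \<in> {1..n} \<and> j \<in> {1..n})" for i j
    using that words_in[OF assms(1)] words_in[OF assms(2)] by (auto simp: pair_count_def)
  moreover have "(\<Sum>i=1..n. \<Sum>j=1..n. pair_count m w x i j) = m"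
  proof -
    have "(\<Sum>i=1..n. \<Sum>j=1..n. pair_count m w x i j) =
        (\<Sum>(i, j) \<in> {1..n} \<times> {1..n}. card {a\<in>{1..m}. w a = i \<and> x a = j})"
      by (simp add: sum.cartesian_product pair_count_def)
    also have "\<dots> = card (\<Union>(i, j)\<in>{1..n} \<times> {1..n}. {a\<in>{1..m}. w a = i \<and> x a = j})"
      by (subst card_UN_disjoint) (auto simp: case_prod_beta)
    also have "(\<Union>(i, j)\<in>{1..n} \<times> {1..n}. {a\<in>{1..m}. w a = i \<and> x a = j}) = {1..m}"
      using words_in[OF assms(1)] words_in[OF assms(2)] by auto
    finally show ?thesis by simp
  qed
  ultimately show ?thesis by (simp add: Theta_def)
qed

text \<open>The key of \<open>(i, j)\<close> is listed \<open>C i j\<close> times, the list is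
  sorted, and \<open>div\<close> and \<open>mod\<close> by \<open>n + 1\<close> decode it into two
  words.\<close>

lemma lex_sorted_exists:
  assumes "C \<in> Theta n m"
  shows "\<exists>s x. lex_sorted n m C (s, x)"
proof -
  define I where "I = {1..n} \<times> {1..n}"
  define key where "key = (\<lambda>p::nat \<times> nat. fst p * (n + 1) + snd p)"
  define M where "M = (\<Sum>p\<in>I. replicate_mset (C (fst p) (snd p)) (key p))"
  define xs where "xs = sorted_list_of_multiset M"
  define s where "s a = (if a \<in> {1..m} then xs ! (a - 1) div (n + 1) else 0)" for a
  define x where "x a = (if a \<in> {1..m} then xs ! (a - 1) mod (n + 1) else 0)" for a
  have inj: "inj_on key I"
  proof (rule inj_onI)
    fix p p' assume "p \<in> I" "p' \<in> I" "key p = key p'"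
    then show "p = p'"
      using lex_key_inject[of "snd p" n "snd p'" "fst p" "fst p'"]
      by (auto simp: key_def I_def prod_eq_iff)
  qed
  have len: "length xs = m"
  proof -
    have "size M = (\<Sum>p\<in>I. C (fst p) (snd p))"
      by (simp add: M_def size_multiset_sum)
    also have "\<dots> = m"
      using assms by (simp add: Theta_def I_def sum.cartesian_product case_prod_beta)
    finally show ?thesis by (metis mset_sorted_list_of_multiset size_mset xs_def)
  qed
  have setM: "k \<in> key ` I" if "k \<in># M" for k
    using that by (auto simp: M_def I_def set_mset_sum split: if_splits)
  have xs_key: "\<exists>i\<in>{1..n}. \<exists>j\<in>{1..n}. xs ! (a - 1) = i * (n + 1) + j" if "1 \<le> a" "a \<le> m" for a
  proof -
    have "xs ! (a - 1) \<in> set xs" using that len by (intro nth_mem) auto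
    then have "xs ! (a - 1) \<in># M" by (simp add: xs_def)
    from setM[OF this] obtain i j where "(i, j) \<in> I" "xs ! (a - 1) = key (i, j)"
      by (metis image_iff surj_pair)
    then show ?thesis unfolding key_def I_def by (metis SigmaD1 SigmaD2 fst_conv snd_conv)
  qed
  have sx: "s a \<in> {1..n}" "x a \<in> {1..n}" "s a * (n + 1) + x a = xs ! (a - 1)" if "1 \<le> a" "a \<le> m" for a
  proof -
    note a = that
    obtain i j where "i \<in> {1..n}" "j \<in> {1..n}" and ij: "xs ! (a - 1) = i * (n + 1) + j"
      using xs_key[OF a] by blast
    moreover have "(i * (n + 1) + j) div (n + 1) = i" "(i * (n + 1) + j) mod (n + 1) = j"
      using \<open>j \<in> {1..n}\<close> by (simp_all add: div_mult_self3 mod_mult_self3 del: mult_Suc_right add_Suc_right)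
    ultimately show "s a \<in> {1..n}" "x a \<in> {1..n}" "s a * (n + 1) + x a = xs ! (a - 1)"
      using a by (simp_all add: s_def x_def del: mult_Suc_right add_Suc_right)
  qed
  have "s \<in> words n m" "x \<in> words n m"
    using sx by (auto simp: words_def s_def x_def)
  moreover have "pair_count m s x = C"
  proof (intro ext)
    fix i j
    show "pair_count m s x i j = C i j"
    proof (cases "(i, j) \<in> I")
      case True
      have "pair_count m s x i j = card {a\<in>{1..m}. xs ! (a - 1) = key (i, j)}"
        unfolding pair_count_def
      proof (intro arg_cong[where f = card] Collect_cong conj_cong refl)
        fix a assume a: "a \<in> {1..m}"
        then have "x a < n + 1" "j < n + 1" using sx(2)[of a] True by (auto simp: I_def)
        then show "(s a = i \<and> x a = j) = (xs ! (a - 1) = key (i, j))"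
          using sx(3)[of a] a lex_key_inject[of "x a" n j "s a" i] by (auto simp: key_def)
      qed
      \<comment> \<open>Places of a word start at 1, positions in a list at 0.\<close>
      also have "{a\<in>{1..m}. xs ! (a - 1) = key (i, j)} = Suc ` {a. a < length xs \<and> xs ! a = key (i, j)}"
        by (auto simp: len image_iff Suc_le_eq gr0_conv_Suc)
      also have "card \<dots> = card {a. a < length xs \<and> xs ! a = key (i, j)}"
        by (rule card_image) simp
      also have "\<dots> = count (mset xs) (key (i, j))"
        by (simp add: count_mset count_list_eq_length_filter length_filter_conv_card)
           (metis (mono_tags, lifting))
      also have "\<dots> = count M (key (i, j))" by (simp add: xs_def)
      also have "\<dots> = (\<Sum>p\<in>I. if key p = key (i, j) then C (fst p) (snd p) else 0)"
        by (auto simp: M_def count_sum intro!: sum.cong)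
      also have "\<dots> = (\<Sum>p\<in>I. if p = (i, j) then C (fst p) (snd p) else 0)"
        using inj True by (intro sum.cong) (auto dest: inj_onD)
      also have "\<dots> = C i j" using True by (simp add: I_def)
      finally show ?thesis .
    next
      case False
      then have "{a\<in>{1..m}. s a = i \<and> x a = j} = {}"
        using sx by (auto simp: I_def)
      then have "pair_count m s x i j = 0" by (simp only: pair_count_def card.empty)
      moreover have "C i j = 0" using False assms by (auto simp: Theta_def I_def)
      ultimately show ?thesis by simp
    qed
  qed
  moreover have "sorted_word m (\<lambda>a. s a * (n + 1) + x a)"
    unfolding sorted_word_def
  proof
    fix a assume "a \<in> {1..<m}"
    then show "s a * (n + 1) + x a \<le> s (a + 1) * (n + 1) + x (a + 1)"
      using sx(3)[of a] sx(3)[of "a + 1"] len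
      by (simp add: xs_def sorted_nth_mono del: mult_Suc_right add_Suc_right)
  qed
  ultimately show ?thesis by (auto simp: lex_sorted_def)
qed

text \<open>Here \<open>s\<close> and \<open>x\<close> are the words of the outer flags F and F''
  with respect to a complete flag adapted to both, and \<open>w\<close> is the word of the
  intermediate flag F'. As \<open>s\<close> is sorted, F' is in position \<open>A\<close> to F
  exactly if \<open>pair_count m s w = A\<close>. By \<open>lex_sorted_unique\<close> the choice of
  \<open>(s, x)\<close> depends on \<open>C\<close> only.\<close>

definition position_poly :: "nat \<Rightarrow> nat \<Rightarrow> nmat \<Rightarrow> nmat \<Rightarrow> nmat \<Rightarrow> int poly"
  where "position_poly n m A B C = (case SOME sx. lex_sorted n m C sx of (s, x) \<Rightarrow>
    \<Sum>w\<in>{w \<in> words n m. pair_count m s w = A}. SOME p. hecke m B w x p)"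

section \<open>Flags in ranked modular lattices\<close>

text \<open>The locale is instantiated twice on the same set of vectors, with the subspaces over a
  field and with those over a subfield. The join is a parameter because for subspaces it is the sum,
  while the meet is always the intersection.\<close>

locale ranked_lattice =
  fixes L :: "'v set set" and Z T :: "'v set" and J :: "'v set \<Rightarrow> 'v set \<Rightarrow> 'v set"
    and d :: "'v set \<Rightarrow> nat" and q m :: nat
  assumes finite_L: "finite L"
    and Z_in: "Z \<in> L" and T_in: "T \<in> L"
    and Z_le: "A \<in> L \<Longrightarrow> Z \<subseteq> A" and le_T: "A \<in> L \<Longrightarrow> A \<subseteq> T"
    and Int_in: "A \<in> L \<Longrightarrow> B \<in> L \<Longrightarrow> A \<inter> B \<in> L"
    and join_in: "A \<in> L \<Longrightarrow> B \<in> L \<Longrightarrow> J A B \<in> L"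
    and join_upper1: "A \<in> L \<Longrightarrow> B \<in> L \<Longrightarrow> A \<subseteq> J A B"
    and join_upper2: "A \<in> L \<Longrightarrow> B \<in> L \<Longrightarrow> B \<subseteq> J A B"
    and join_least: "A \<in> L \<Longrightarrow> B \<in> L \<Longrightarrow> C \<in> L \<Longrightarrow> A \<subseteq> C \<Longrightarrow> B \<subseteq> C \<Longrightarrow> J A B \<subseteq> C"
    and rank_modular: "A \<in> L \<Longrightarrow> B \<in> L \<Longrightarrow> d (J A B) + d (A \<inter> B) = d A + d B"
    and rank_strict: "A \<in> L \<Longrightarrow> B \<in> L \<Longrightarrow> A \<subset> B \<Longrightarrow> d A < d B"
    and rank_Z: "d Z = 0" and rank_T: "d T = m"
    and cover_exists: "A \<in> L \<Longrightarrow> A \<noteq> T \<Longrightarrow> \<exists>B\<in>L. A \<subset> B \<and> d B = d A + 1"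
    and card_panel: "A \<in> L \<Longrightarrow> B \<in> L \<Longrightarrow> A \<subseteq> B \<Longrightarrow> d B = d A + 2 \<Longrightarrow>
      card {M\<in>L. A \<subseteq> M \<and> M \<subseteq> B \<and> d M = d A + 1} = q + 1"
    and q_pos: "q > 0"
begin

lemma rank_mono: "A \<in> L \<Longrightarrow> B \<in> L \<Longrightarrow> A \<subseteq> B \<Longrightarrow> d A \<le> d B"
  using rank_strict[of A B] by (cases "A = B") (auto simp: psubset_eq intro: less_imp_le)

lemma rank_eqD: "A \<in> L \<Longrightarrow> B \<in> L \<Longrightarrow> A \<subseteq> B \<Longrightarrow> d B \<le> d A \<Longrightarrow> A = B"
  using rank_strict[of A B] by (cases "A = B") auto

lemma rank_0D: "A \<in> L \<Longrightarrow> d A = 0 \<Longrightarrow> A = Z"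
  using rank_eqD[of Z A] Z_in Z_le rank_Z by auto

lemma rank_topD: "A \<in> L \<Longrightarrow> d A = m \<Longrightarrow> A = T"
  using rank_eqD[of A T] T_in le_T rank_T by auto

definition lflags :: "nat \<Rightarrow> (nat \<Rightarrow> 'v set) set"
  where "lflags n = {F \<in> extensional {0..n}. (\<forall>i\<le>n. F i \<in> L) \<and> F 0 = Z \<and> F n = T \<and>
    (\<forall>i<n. F i \<subseteq> F (Suc i))}"

definition complete :: "(nat \<Rightarrow> 'v set) \<Rightarrow> bool"
  where "complete G \<longleftrightarrow> (\<forall>a\<le>m. G a \<in> L \<and> d (G a) = a) \<and> (\<forall>a<m. G a \<subseteq> G (Suc a))"

text \<open>The lattice form of \<open>rel_pos\<close>: the dimension of a quotient becomes a
  difference of ranks.\<close>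

definition pos :: "nat \<Rightarrow> (nat \<Rightarrow> 'v set) \<Rightarrow> (nat \<Rightarrow> 'v set) \<Rightarrow> nmat"
  where "pos n F F' = (\<lambda>i j. if i \<in> {1..n} \<and> j \<in> {1..n}
    then d (F i \<inter> F' j) - d (J (F (i - 1) \<inter> F' j) (F i \<inter> F' (j - 1))) else 0)"

text \<open>The letter \<open>a\<close> is the step of \<open>F\<close> at which the one-dimensional quotient \<open>G a / G (a - 1)\<close>
  is reached; the word determines the relative position of \<open>G\<close> and \<open>F\<close>.\<close>

definition word :: "(nat \<Rightarrow> 'v set) \<Rightarrow> (nat \<Rightarrow> 'v set) \<Rightarrow> nat \<Rightarrow> nat"
  where "word G F a = (if a \<in> {1..m} then LEAST j. \<not> G a \<inter> F j \<subseteq> G (a - 1) else 0)"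

text \<open>For sorted \<open>w\<close> this is the one flag whose word with respect to
  \<open>G\<close> is \<open>w\<close>, by \<open>word_sorted_iff\<close>.\<close>

definition coarsen :: "nat \<Rightarrow> (nat \<Rightarrow> 'v set) \<Rightarrow> (nat \<Rightarrow> nat) \<Rightarrow> nat \<Rightarrow> 'v set"
  where "coarsen n G w = (\<lambda>j\<in>{0..n}. G (rank_in m w j))"

definition panel :: "(nat \<Rightarrow> 'v set) \<Rightarrow> nat \<Rightarrow> 'v set set"
  where "panel G i = {M\<in>L. G (i - 1) \<subseteq> M \<and> M \<subseteq> G (i + 1) \<and> d M = i}"

section \<open>Flags, complete flags and the word of a flag\<close>

lemma lflagsD:
  assumes "F \<in> lflags n"
  shows "i \<le> n \<Longrightarrow> F i \<in> L" "F 0 = Z" "F n = T" "i \<le> j \<Longrightarrow> j \<le> n \<Longrightarrow> F i \<subseteq> F j"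
proof -
  show "i \<le> j \<Longrightarrow> j \<le> n \<Longrightarrow> F i \<subseteq> F j"
  proof (induction j rule: dec_induct)
    case (step k)
    then have "F k \<subseteq> F (Suc k)" using assms by (auto simp: lflags_def)
    with step show ?case by simp
  qed simp
qed (use assms in \<open>auto simp: lflags_def\<close>)

lemma finite_lflags: "finite (lflags n)"
proof (rule finite_subset)
  show "lflags n \<subseteq> {0..n} \<rightarrow>\<^sub>E L" by (auto simp: lflags_def PiE_def)
qed (simp add: finite_PiE finite_L)

lemma completeD:
  assumes "complete G"
  shows "a \<le> m \<Longrightarrow> G a \<in> L" "a \<le> m \<Longrightarrow> d (G a) = a" "G 0 = Z" "G m = T"
    "a \<le> b \<Longrightarrow> b \<le> m \<Longrightarrow> G a \<subseteq> G b"
proof -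
  show "a \<le> b \<Longrightarrow> b \<le> m \<Longrightarrow> G a \<subseteq> G b"
  proof (induction b rule: dec_induct)
    case (step k)
    then have "G k \<subseteq> G (Suc k)" using assms by (auto simp: complete_def)
    with step show ?case by simp
  qed simp
  show "a \<le> m \<Longrightarrow> G a \<in> L" "a \<le> m \<Longrightarrow> d (G a) = a" using assms by (auto simp: complete_def)
  show "G 0 = Z" "G m = T"
    using rank_0D[of "G 0"] rank_topD[of "G m"] assms by (auto simp: complete_def)
qed

lemma complete_exists: "\<exists>G. complete G"
proof -
  have "\<exists>G. (\<forall>a\<le>k. G a \<in> L \<and> d (G a) = a) \<and> (\<forall>a<k. G a \<subseteq> G (Suc a))" if "k \<le> m" for k
    using that
  proof (induction k)
    case 0
    show ?case using Z_in rank_Z by (intro exI[of _ "\<lambda>_. Z"]) auto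
  next
    case (Suc k)
    then obtain G where G: "\<And>a. a \<le> k \<Longrightarrow> G a \<in> L \<and> d (G a) = a" "\<And>a. a < k \<Longrightarrow> G a \<subseteq> G (Suc a)"
      by auto
    then have "G k \<noteq> T" using Suc.prems rank_T G(1)[of k] by auto
    then obtain B where "B \<in> L" "G k \<subset> B" "d B = k + 1"
      using cover_exists[of "G k"] G(1)[of k] by auto
    then have "(\<forall>a\<le>Suc k. (G(Suc k := B)) a \<in> L \<and> d ((G(Suc k := B)) a) = a) \<and>
        (\<forall>a<Suc k. (G(Suc k := B)) a \<subseteq> (G(Suc k := B)) (Suc a))"
      using G by (auto simp: le_Suc_eq less_Suc_eq)
    then show ?case by blast
  qed
  from this[of m] show ?thesis by (auto simp: complete_def)
qed

text \<open>The condition is monotone in \<open>j\<close>, fails for \<open>F 0 = Z\<close>, and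
  holds for \<open>F n = T\<close> because \<open>G a\<close> has larger rank than
  \<open>G (a - 1)\<close>. The \<open>LEAST\<close> is therefore a threshold lying in
  \<open>{1..n}\<close>.\<close>

lemma word_le_iff:
  assumes G: "complete G" and F: "F \<in> lflags n" and a: "1 \<le> a" "a \<le> m"
  shows "j \<le> n \<Longrightarrow> word G F a \<le> j \<longleftrightarrow> \<not> G a \<inter> F j \<subseteq> G (a - 1)" (is "_ \<Longrightarrow> ?A j")
    and "word G F a \<in> {1..n}"
proof -
  let ?P = "\<lambda>j. \<not> G a \<inter> F j \<subseteq> G (a - 1)"
  have w: "word G F a = (LEAST j. ?P j)" using a by (simp add: word_def)
  have "\<not> G a \<subseteq> G (a - 1)"
    using rank_mono[of "G a" "G (a - 1)"] completeD(1,2)[OF G] a by fastforce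
  then have n: "?P n"
    using lflagsD(3)[OF F] le_T[OF completeD(1)[OF G, of a]] a by (auto simp: Int_absorb2)
  have 0: "\<not> ?P 0"
    using lflagsD(2)[OF F] Z_le[OF completeD(1)[OF G, of "a - 1"]] a by (simp add: le_infI2)
  show A: "?A j" if "j \<le> n" for j
  proof
    assume le: "word G F a \<le> j"
    have "?P (word G F a)" unfolding w using n by (rule LeastI)
    moreover have "F (word G F a) \<subseteq> F j" using lflagsD(4)[OF F] le that by blast
    ultimately show "?P j" by blast
  qed (simp add: w Least_le)
  show "word G F a \<in> {1..n}"
    using A[of 0] A[of n] n 0 by (auto simp: Suc_le_eq)
qed

lemma word_in_words: "complete G \<Longrightarrow> F \<in> lflags n \<Longrightarrow> word G F \<in> words n m"
  using word_le_iff(2)[of G F n] by (auto simp: words_def word_def)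

lemma word_eqI:
  assumes G: "complete G" and F: "F \<in> lflags n" and w: "w \<in> words n m"
    and eq: "\<And>a j. 1 \<le> a \<Longrightarrow> a \<le> m \<Longrightarrow> j \<le> n \<Longrightarrow> w a \<le> j \<longleftrightarrow> \<not> G a \<inter> F j \<subseteq> G (a - 1)"
  shows "word G F = w"
proof
  fix a
  show "word G F a = w a"
  proof (cases "1 \<le> a \<and> a \<le> m")
    case True
    then have "word G F a \<le> j \<longleftrightarrow> w a \<le> j" if "j \<le> n" for j
      using word_le_iff(1)[OF G F, of a j] eq[of a j] that by blast
    then show ?thesis
      using words_in[OF w, of a] word_le_iff(2)[OF G F, of a] True
      by (metis atLeastAtMost_iff le_antisym order_refl)
  next
    case False
    then show ?thesis using w by (auto simp: word_def words_def)
  qed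
qed

text \<open>The join of \<open>G a \<inter> F j\<close> and \<open>G (a - 1)\<close> stays inside
  \<open>G a\<close>, so by modularity the rank of the intersection with \<open>F j\<close> rises by
  at most 1 at each step of \<open>G\<close>. The letter says from which \<open>j\<close> on it does
  rise.\<close>

lemma rank_step:
  assumes G: "complete G" and F: "F \<in> lflags n" and a: "1 \<le> a" "a \<le> m" and j: "j \<le> n"
  shows "d (G a \<inter> F j) = d (G (a - 1) \<inter> F j) + (if word G F a \<le> j then 1 else 0)"
proof -
  have in_L: "G a \<in> L" "G (a - 1) \<in> L" "F j \<in> L" "G a \<inter> F j \<in> L" "G (a - 1) \<inter> F j \<in> L"
    using completeD(1)[OF G] lflagsD(1)[OF F] a j Int_in by auto
  have sub: "G (a - 1) \<subseteq> G a" using completeD(5)[OF G] a by simp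
  then have Int_eq: "(G a \<inter> F j) \<inter> G (a - 1) = G (a - 1) \<inter> F j" by auto
  have "J (G a \<inter> F j) (G (a - 1)) \<subseteq> G a" using in_L sub by (intro join_least) auto
  then have "d (J (G a \<inter> F j) (G (a - 1))) \<le> a"
    using rank_mono[OF join_in] in_L completeD(2)[OF G] a by metis
  then have le: "d (G a \<inter> F j) \<le> d (G (a - 1) \<inter> F j) + 1"
    using rank_modular[OF in_L(4,2)] completeD(2)[OF G, of "a - 1"] a unfolding Int_eq by simp
  show ?thesis
  proof (cases "word G F a \<le> j")
    case True
    then have "G (a - 1) \<inter> F j \<subset> G a \<inter> F j"
      using word_le_iff(1)[OF G F a j] sub by blast
    then have "d (G (a - 1) \<inter> F j) < d (G a \<inter> F j)" using in_L rank_strict by blast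
    then show ?thesis using le True by simp
  next
    case False
    then have "G (a - 1) \<inter> F j = G a \<inter> F j"
      using word_le_iff(1)[OF G F a j] sub by blast
    then show ?thesis using False by simp
  qed
qed

lemma rank_Int:
  assumes G: "complete G" and F: "F \<in> lflags n" and "a \<le> m" and j: "j \<le> n"
  shows "d (G a \<inter> F j) = card {b\<in>{1..a}. word G F b \<le> j}"
  using assms(3)
proof (induction a)
  case 0
  have "G 0 \<inter> F j = Z" using completeD(3)[OF G] Z_le lflagsD(1)[OF F j] by auto
  then show ?case by (simp add: rank_Z)
next
  case (Suc a)
  have "{b\<in>{1..Suc a}. word G F b \<le> j} =
      {b\<in>{1..a}. word G F b \<le> j} \<union> (if word G F (Suc a) \<le> j then {Suc a} else {})"
    by (auto simp: le_Suc_eq)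
  then show ?case using Suc rank_step[OF G F _ Suc.prems j] by (auto simp: card_insert_if)
qed

text \<open>Modularity eliminates the rank of the join and leaves an inclusion-exclusion formula in
  ranks of intersections. In this additive form, free of truncated subtraction, positions can be
  compared under linear bijections and under field extension.\<close>

lemma pos_eq:
  assumes F: "F \<in> lflags n" and F': "F' \<in> lflags n" and i: "i \<in> {1..n}" and j: "j \<in> {1..n}"
  shows "pos n F F' i j + (d (F (i - 1) \<inter> F' j) + d (F i \<inter> F' (j - 1))) =
    d (F i \<inter> F' j) + d (F (i - 1) \<inter> F' (j - 1))"
proof -
  define A where "A = F (i - 1) \<inter> F' j"
  define B where "B = F i \<inter> F' (j - 1)"
  have mono: "F (i - 1) \<subseteq> F i" "F' (j - 1) \<subseteq> F' j"
    using lflagsD(4)[OF F] lflagsD(4)[OF F'] i j by auto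
  have in_L: "A \<in> L" "B \<in> L" "F i \<inter> F' j \<in> L"
    using lflagsD(1)[OF F] lflagsD(1)[OF F'] i j Int_in by (auto simp: A_def B_def)
  have AB: "A \<inter> B = F (i - 1) \<inter> F' (j - 1)" using mono by (auto simp: A_def B_def)
  have "J A B \<subseteq> F i \<inter> F' j"
    by (rule join_least[OF in_L]) (use mono in \<open>auto simp: A_def B_def\<close>)
  then have "d (J A B) \<le> d (F i \<inter> F' j)" using rank_mono[OF join_in[OF in_L(1,2)] in_L(3)] by blast
  then show ?thesis
    using rank_modular[OF in_L(1,2)] i j unfolding AB
    by (simp add: pos_def A_def[symmetric] B_def[symmetric] del: One_nat_def)
qed

lemma coarsen_lflags:
  assumes G: "complete G" and w: "w \<in> words n m"
  shows "coarsen n G w \<in> lflags n"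
proof -
  have "rank_in m w 0 = 0" "rank_in m w n = m"
  proof -
    have "{a\<in>{1..m}. w a \<le> 0} = {}" "{a\<in>{1..m}. w a \<le> n} = {1..m}"
      using words_in[OF w] by fastforce+
    then show "rank_in m w 0 = 0" "rank_in m w n = m" by (simp_all only: rank_in_def) auto
  qed
  moreover have "rank_in m w j \<le> rank_in m w (Suc j)" for j
    unfolding rank_in_def by (intro card_mono) auto
  ultimately show ?thesis
    using completeD[OF G] rank_in_le[of m w] by (auto simp: lflags_def coarsen_def)
qed

text \<open>For a sorted word the first \<open>rank_in m w j\<close> letters are exactly those at
  most \<open>j\<close>. Hence \<open>F j\<close>, \<open>G (rank_in m w j)\<close> and their
  intersection all have the same rank and coincide.\<close>

lemma word_sorted_iff:
  assumes G: "complete G" and F: "F \<in> lflags n" and w: "w \<in> words n m" and sorted: "sorted_word m w"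
  shows "word G F = w \<longleftrightarrow> F = coarsen n G w"
proof
  assume eq: "word G F = w"
  show "F = coarsen n G w"
  proof
    fix j
    show "F j = coarsen n G w j"
    proof (cases "j \<le> n")
      case True
      let ?r = "rank_in m w j"
      have in_L: "F j \<in> L" "G ?r \<in> L" "G ?r \<inter> F j \<in> L"
        using lflagsD(1)[OF F True] completeD(1)[OF G rank_in_le] Int_in by auto
      have "d (F j) = ?r"
        using rank_Int[OF G F order_refl True] completeD(4)[OF G] le_T[OF in_L(1)] eq
        by (simp add: rank_in_def Int_absorb1)
      moreover have "d (G ?r \<inter> F j) = ?r"
      proof -
        have "{b\<in>{1..?r}. w b \<le> j} = {1..?r}"
          using sorted_rank_in[OF sorted] rank_in_le[of m w j] by fastforce
        then show ?thesis using rank_Int[OF G F rank_in_le True] eq by simp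
      qed
      ultimately have "G ?r \<inter> F j = F j" "G ?r \<inter> F j = G ?r"
        using completeD(2)[OF G rank_in_le] rank_eqD[OF in_L(3,1)] rank_eqD[OF in_L(3,2)] by auto
      then show ?thesis using True by (simp add: coarsen_def)
    next
      case False
      then show ?thesis using F by (auto simp: coarsen_def lflags_def extensional_def)
    qed
  qed
next
  assume F_eq: "F = coarsen n G w"
  show "word G F = w"
  proof (rule word_eqI[OF G F w])
    fix a j assume a: "1 \<le> a" "a \<le> m" and j: "j \<le> n"
    let ?r = "rank_in m w j"
    have "G a \<inter> G ?r \<subseteq> G (a - 1) \<longleftrightarrow> ?r < a"
    proof
      assume "?r < a"
      then have "G ?r \<subseteq> G (a - 1)" using completeD(5)[OF G, of ?r "a - 1"] a by auto
      then show "G a \<inter> G ?r \<subseteq> G (a - 1)" by auto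
    next
      assume sub: "G a \<inter> G ?r \<subseteq> G (a - 1)"
      show "?r < a"
      proof (rule ccontr)
        assume "\<not> ?r < a"
        then have "G a \<subseteq> G ?r" using completeD(5)[OF G _ rank_in_le] by auto
        then have "d (G a) \<le> d (G (a - 1))"
          using sub completeD(1)[OF G] a by (intro rank_mono) auto
        then show False using completeD(2)[OF G] a by simp
      qed
    qed
    then show "w a \<le> j \<longleftrightarrow> \<not> G a \<inter> F j \<subseteq> G (a - 1)"
      using sorted_rank_in[OF sorted a, of j] j by (simp add: F_eq coarsen_def not_less)
  qed
qed

text \<open>By sortedness every step of \<open>F\<close> is a member of \<open>G\<close>, so the
  ranks of its intersections with the steps of \<open>F'\<close> count places with bounded letters.
  The inclusion-exclusion of \<open>pos_eq\<close> then singles out the places with letters exactly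
  \<open>i\<close> and \<open>j\<close>.\<close>

lemma pos_coarsen:
  assumes G: "complete G" and F: "F \<in> lflags n" and F': "F' \<in> lflags n"
    and sorted: "sorted_word m (word G F)"
  shows "pos n F F' = pair_count m (word G F) (word G F')"
proof (intro ext)
  fix i j
  let ?w = "word G F" let ?x = "word G F'"
  have ww: "?w \<in> words n m" "?x \<in> words n m" using word_in_words G F F' by auto
  show "pos n F F' i j = pair_count m ?w ?x i j"
  proof (cases "i \<in> {1..n} \<and> j \<in> {1..n}")
    case True
    define D where "D i j = card {a\<in>{1..m}. ?w a \<le> i \<and> ?x a \<le> j}" for i j
    have D: "d (F i \<inter> F' j) = D i j" if "i \<le> n" "j \<le> n" for i j
    proof -
      have "F i = G (rank_in m ?w i)"
        using word_sorted_iff[OF G F ww(1) sorted] that(1) by (simp add: coarsen_def fun_eq_iff)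
      then have "d (F i \<inter> F' j) = card {a\<in>{1..rank_in m ?w i}. ?x a \<le> j}"
        using rank_Int[OF G F' rank_in_le that(2)] by simp
      also have "{a\<in>{1..rank_in m ?w i}. ?x a \<le> j} = {a\<in>{1..m}. ?w a \<le> i \<and> ?x a \<le> j}"
        using sorted_rank_in[OF sorted] rank_in_le[of m ?w i] by fastforce
      finally show ?thesis by (simp add: D_def)
    qed
    have "D i j + D (i - 1) (j - 1) = pair_count m ?w ?x i j + (D (i - 1) j + D i (j - 1))"
    proof -
      define P where "P i j = {a\<in>{1..m}. ?w a \<le> i \<and> ?x a \<le> j}" for i j
      have fin: "finite (P i j)" for i j by (simp add: P_def)
      have "card (P (i - 1) j \<union> P i (j - 1)) + card (P (i - 1) j \<inter> P i (j - 1)) =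
          card (P (i - 1) j) + card (P i (j - 1))"
        using card_Un_Int[OF fin fin] by simp
      moreover have "P (i - 1) j \<inter> P i (j - 1) = P (i - 1) (j - 1)" by (auto simp: P_def)
      moreover have "P i j = {a\<in>{1..m}. ?w a = i \<and> ?x a = j} \<union> (P (i - 1) j \<union> P i (j - 1))"
        using True by (auto simp: P_def)
      moreover have "card ({a\<in>{1..m}. ?w a = i \<and> ?x a = j} \<union> (P (i - 1) j \<union> P i (j - 1))) =
          pair_count m ?w ?x i j + card (P (i - 1) j \<union> P i (j - 1))"
        unfolding pair_count_def using True fin by (intro card_Un_disjoint) (auto simp: P_def)
      ultimately show ?thesis by (simp only: D_def P_def[symmetric])
    qed
    then show ?thesis
      using pos_eq[OF F F', of i j] True D[of i j] D[of "i - 1" j] D[of i "j - 1"] D[of "i - 1" "j - 1"]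
      by auto
  next
    case False
    then show ?thesis
      using pair_count_Theta[OF ww] by (auto simp: pos_def Theta_def)
  qed
qed

section \<open>Moving a complete flag inside a panel\<close>

lemma panel_complete:
  assumes G: "complete G" and i: "1 \<le> i" "i < m" and M: "M \<in> panel G i"
  shows "complete (G(i := M))"
proof -
  have "(G(i := M)) a \<subseteq> (G(i := M)) (Suc a)" if "a < m" for a
  proof -
    consider "a = i" | "Suc a = i" | "a \<noteq> i" "Suc a \<noteq> i" by blast
    then show ?thesis
    proof cases
      case 2
      then have "a = i - 1" by simp
      with 2 M show ?thesis by (simp add: panel_def)
    qed (use M that completeD(5)[OF G, of a "Suc a"] in \<open>auto simp: panel_def\<close>)
  qed
  then show ?thesis using completeD(1,2)[OF G] M by (auto simp: complete_def panel_def)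
qed

lemma card_panel_eq: "complete G \<Longrightarrow> 1 \<le> i \<Longrightarrow> i < m \<Longrightarrow> card (panel G i) = q + 1"
  using card_panel[of "G (i - 1)" "G (i + 1)"] completeD[of G] by (simp add: panel_def)

lemma finite_panel: "finite (panel G i)"
  using finite_L by (simp add: panel_def)

lemma in_panel: "complete G \<Longrightarrow> 1 \<le> i \<Longrightarrow> i < m \<Longrightarrow> G i \<in> panel G i"
  using completeD(1,2)[of G i] completeD(5)[of G "i - 1" i] completeD(5)[of G i "i + 1"]
  by (simp add: panel_def)

lemma panel_upd [simp]: "1 \<le> i \<Longrightarrow> panel (G(i := M)) i = panel G i"
proof -
  assume "1 \<le> i"
  then have "i - 1 \<noteq> i" by simp
  then show ?thesis by (simp add: panel_def)
qed

text \<open>Only \<open>G i\<close> changes, so the rank of the intersection with \<open>F j\<close>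
  rises by the same total between \<open>G (i - 1)\<close> and \<open>G (i + 1)\<close>. This total,
  for all \<open>j\<close>, determines the two letters at \<open>i\<close> and \<open>i + 1\<close>
  up to their order.\<close>

lemma word_panel:
  assumes G: "complete G" and i: "1 \<le> i" "i < m" and M: "M \<in> panel G i" and F: "F \<in> lflags n"
  shows "word (G(i := M)) F = word G F \<or> word (G(i := M)) F = swap_at i (word G F)"
proof -
  let ?G = "G(i := M)" let ?x = "word G F" let ?y = "word (G(i := M)) F"
  have G': "complete ?G" using panel_complete[OF G i M] .
  have other: "?y a = ?x a" if "a \<noteq> i" "a \<noteq> Suc i" for a
    using that by (auto simp: word_def)
  have ne: "i - 1 \<noteq> i" using i by simp
  define e where "e x j = (if x \<le> j then 1 else 0::nat)" for x j :: nat
  have e: "e (?x i) j + e (?x (Suc i)) j = e (?y i) j + e (?y (Suc i)) j" if j: "j \<le> n" for j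
    using rank_step[OF G F _ _ j, of i] rank_step[OF G' F _ _ j, of i]
      rank_step[OF G F _ _ j, of "Suc i"] rank_step[OF G' F _ _ j, of "Suc i"] i
      ne
    by (simp add: e_def[symmetric])
  have in_n: "?x i \<in> {1..n}" "?x (Suc i) \<in> {1..n}" "?y i \<in> {1..n}" "?y (Suc i) \<in> {1..n}"
    using word_le_iff(2)[OF G F] word_le_iff(2)[OF G' F] i by auto
  have "?y i = ?x i \<and> ?y (Suc i) = ?x (Suc i) \<or> ?y i = ?x (Suc i) \<and> ?y (Suc i) = ?x i"
  proof -
    \<comment> \<open>The sum of the two indicators is positive iff the smaller letter is at most
      \<open>j\<close>, and it is 2 iff the larger one is.\<close>
    have "min (?x i) (?x (Suc i)) \<le> j \<longleftrightarrow> min (?y i) (?y (Suc i)) \<le> j"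
      "max (?x i) (?x (Suc i)) \<le> j \<longleftrightarrow> max (?y i) (?y (Suc i)) \<le> j" if "j \<le> n" for j
      using e[OF that] by (auto simp: e_def min_le_iff_disj split: if_splits)
    moreover have "min (?x i) (?x (Suc i)) \<le> n" "min (?y i) (?y (Suc i)) \<le> n"
      "max (?x i) (?x (Suc i)) \<le> n" "max (?y i) (?y (Suc i)) \<le> n"
      using in_n by auto
    ultimately have "min (?x i) (?x (Suc i)) = min (?y i) (?y (Suc i))"
      "max (?x i) (?x (Suc i)) = max (?y i) (?y (Suc i))"
      by (meson le_antisym order_refl)+
    then show ?thesis by (auto simp: min_def max_def split: if_splits)
  qed
  then show ?thesis
  proof
    assume *: "?y i = ?x i \<and> ?y (Suc i) = ?x (Suc i)"
    have "?y a = ?x a" for a using * other[of a] by (cases "a = i"; cases "a = Suc i") auto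
    then show ?thesis by auto
  next
    assume *: "?y i = ?x (Suc i) \<and> ?y (Suc i) = ?x i"
    have "?y a = swap_at i ?x a" for a using * other[of a] by (cases "a = i"; cases "a = Suc i") auto
    then show ?thesis by auto
  qed
qed

text \<open>Let \<open>j\<close> be the smaller of the two letters. The join of
  \<open>G (i - 1)\<close> and \<open>G (i + 1) \<inter> F j\<close> has rank \<open>i\<close> and
  is the only member of the panel at which the letter in place \<open>i\<close> is at most
  \<open>j\<close>. At an ascent \<open>G i\<close> is this member, so every other member shows the
  letters swapped.\<close>

lemma word_panel_ascent:
  assumes G: "complete G" and i: "1 \<le> i" "i < m" and M: "M \<in> panel G i" and F: "F \<in> lflags n"
    and less: "word G F i < word G F (i + 1)" and ne: "M \<noteq> G i"
  shows "word (G(i := M)) F = swap_at i (word G F)"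
proof (rule ccontr)
  let ?G = "G(i := M)" let ?j = "word G F i"
  have G': "complete ?G" using panel_complete[OF G i M] .
  assume "\<not> ?thesis"
  then have eq: "word ?G F = word G F" using word_panel[OF G i M F] by blast
  have j: "?j \<le> n" using word_le_iff(2)[OF G F, of i] i by auto
  define A where "A = G (i - 1)"
  define C where "C = G (i + 1) \<inter> F ?j"
  have in_L: "A \<in> L" "C \<in> L" "G (i + 1) \<in> L" "G i \<in> L" "F ?j \<in> L"
    using completeD(1)[OF G] lflagsD(1)[OF F j] i by (auto simp: A_def C_def intro!: Int_in)
  have A_le: "A \<subseteq> G (i + 1)" using completeD(5)[OF G] i by (auto simp: A_def)
  have "d C = d (A \<inter> F ?j) + 1"
    using rank_step[OF G F _ _ j, of "i + 1"] rank_step[OF G F _ _ j, of i] i less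
    by (simp add: A_def C_def)
  moreover have "A \<inter> C = A \<inter> F ?j" using A_le by (auto simp: C_def)
  ultimately have rank: "d (J A C) = i"
    using rank_modular[OF in_L(1,2)] completeD(2)[OF G, of "i - 1"] i by (simp add: A_def)
  have H_eq: "H i = J A C" if H: "complete H" "word H F i \<le> ?j" "H (i - 1) = A" "H (i + 1) = G (i + 1)" for H
  proof (rule rank_eqD)
    show HL: "H i \<in> L" "J A C \<in> L" using completeD(1)[OF H(1)] i in_L join_in by auto
    show "d (J A C) \<le> d (H i)" using completeD(2)[OF H(1)] i rank by simp
    let ?E = "H i \<inter> F ?j"
    have E: "?E \<in> L" using HL(1) in_L(5) Int_in by blast
    have sub: "A \<subseteq> H i" using completeD(5)[OF H(1), of "i - 1" i] H(3) i by simp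
    have "\<not> ?E \<subseteq> A" using word_le_iff(1)[OF H(1) F _ _ j, of i] H(2,3) i by simp
    then have "A \<subset> J A ?E" using join_upper1[OF in_L(1) E] join_upper2[OF in_L(1) E] by blast
    then have "d A < d (J A ?E)" by (rule rank_strict[OF in_L(1) join_in[OF in_L(1) E]])
    then have dH: "d (H i) \<le> d (J A ?E)"
      using completeD(2)[OF H(1), of i] completeD(2)[OF G, of "i - 1"] i by (simp add: A_def)
    have "J A ?E = H i"
      by (rule rank_eqD[OF join_in[OF in_L(1) E] HL(1) join_least[OF in_L(1) E HL(1) sub] dH]) blast
    then have "H i = J A ?E" ..
    also have "\<dots> \<subseteq> J A C"
    proof (rule join_least[OF in_L(1) E HL(2) join_upper1[OF in_L(1,2)]])
      have "H i \<subseteq> G (i + 1)" using completeD(5)[OF H(1), of i "i + 1"] H(4) i by simp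
      then have "?E \<subseteq> C" by (auto simp: C_def)
      then show "?E \<subseteq> J A C" using join_upper2[OF in_L(1,2)] by blast
    qed
    finally show "H i \<subseteq> J A C" .
  qed
  have ne': "i - 1 \<noteq> i" using i by simp
  have "G i = J A C" by (rule H_eq[OF G]) (simp_all add: A_def)
  moreover have "?G i = J A C" by (rule H_eq[OF G']) (use ne' in \<open>simp_all add: A_def eq\<close>)
  ultimately show False using ne by simp
qed

text \<open>The distinguished member \<open>M0\<close> is the join from
  \<open>word_panel_ascent\<close>, formed with the smaller letter, which now stands in place
  \<open>i + 1\<close>. At \<open>M0\<close> the word has an ascent, and the ascent case leads from
  there to all other members.\<close>

lemma word_panel_descent:
  assumes G: "complete G" and i: "1 \<le> i" "i < m" and F: "F \<in> lflags n"
    and less: "word G F (i + 1) < word G F i"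
  obtains M0 where "M0 \<in> panel G i" "M0 \<noteq> G i" "word (G(i := M0)) F = swap_at i (word G F)"
    "\<And>M. M \<in> panel G i \<Longrightarrow> M \<noteq> M0 \<Longrightarrow> word (G(i := M)) F = word G F"
proof -
  let ?j = "word G F (i + 1)"
  have j: "?j \<le> n" using word_le_iff(2)[OF G F, of "i + 1"] i by auto
  define A where "A = G (i - 1)"
  define C where "C = G (i + 1) \<inter> F ?j"
  have in_L: "A \<in> L" "C \<in> L" "G (i + 1) \<in> L" "G i \<in> L" "F ?j \<in> L"
    using completeD(1)[OF G] lflagsD(1)[OF F j] i by (auto simp: A_def C_def intro!: Int_in)
  have A_le: "A \<subseteq> G (i + 1)" using completeD(5)[OF G] i by (auto simp: A_def)
  have dC: "d C = d (A \<inter> F ?j) + 1"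
    using rank_step[OF G F _ _ j, of "i + 1"] rank_step[OF G F _ _ j, of i] i less
    by (simp add: A_def C_def)
  moreover have AC: "A \<inter> C = A \<inter> F ?j" using A_le by (auto simp: C_def)
  ultimately have rank: "d (J A C) = i"
    using rank_modular[OF in_L(1,2)] completeD(2)[OF G, of "i - 1"] i by (simp add: A_def)
  define M0 where "M0 = J A C"
  have M0: "M0 \<in> panel G i"
    using rank join_in[OF in_L(1,2)] join_upper1[OF in_L(1,2)] join_least[OF in_L(1,2,3) A_le]
    by (auto simp: panel_def M0_def A_def C_def)
  have G0: "complete (G(i := M0))" using panel_complete[OF G i M0] .
  have C_le: "C \<subseteq> M0" using join_upper2[OF in_L(1,2)] by (simp add: M0_def)
  have "\<not> C \<subseteq> A"
  proof
    assume "C \<subseteq> A"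
    then have "A \<inter> F ?j = C" using AC by auto
    then show False using dC by simp
  qed
  moreover have "C \<subseteq> M0 \<inter> F ?j" using C_le by (auto simp: C_def)
  ultimately have "word (G(i := M0)) F i \<le> ?j"
    using word_le_iff(1)[OF G0 F _ _ j, of i] i by (auto simp: A_def)
  then have sw: "word (G(i := M0)) F = swap_at i (word G F)"
    using word_panel[OF G i M0 F] less by auto
  have "word (G(i := M)) F = word G F" if M: "M \<in> panel G i" "M \<noteq> M0" for M
  proof -
    have "word ((G(i := M0))(i := M)) F = swap_at i (word (G(i := M0)) F)"
      using word_panel_ascent[OF G0 i _ F, of M] M i less sw by simp
    then show ?thesis by (simp add: sw)
  qed
  moreover have "M0 \<noteq> G i"
  proof
    assume "M0 = G i"
    then have "word G F i = swap_at i (word G F) i" using sw by simp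
    then show False using less by simp
  qed
  ultimately show ?thesis using that[OF M0 _ sw] by blast
qed

section \<open>Counting flags with a given word\<close>

definition word_count :: "nat \<Rightarrow> (nat \<Rightarrow> 'v set) \<Rightarrow> (nat \<Rightarrow> nat) \<Rightarrow> ((nat \<Rightarrow> 'v set) \<Rightarrow> bool) \<Rightarrow> nat"
  where "word_count n G w Q = card {F \<in> lflags n. word G F = w \<and> Q F}"

text \<open>A flag with a descent at \<open>i\<close> has an ascent at exactly one member of the
  panel, which is not \<open>G i\<close>; counting the flags according to this member splits the
  count into disjoint classes.\<close>

lemma word_count_rec:
  assumes G: "complete G" and i: "1 \<le> i" "i < m" and less: "w (i + 1) < w i"
  shows "word_count n G w Q = (\<Sum>M\<in>panel G i - {G i}. word_count n (G(i := M)) (swap_at i w) Q)"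
proof -
  have "{F \<in> lflags n. word G F = w \<and> Q F} =
      (\<Union>M\<in>panel G i - {G i}. {F \<in> lflags n. word (G(i := M)) F = swap_at i w \<and> Q F})" (is "?L = ?R")
  proof
    show "?L \<subseteq> ?R"
    proof
      fix F assume "F \<in> ?L"
      then have F: "F \<in> lflags n" "word G F = w" "Q F" by auto
      then obtain M0 where "M0 \<in> panel G i" "M0 \<noteq> G i" "word (G(i := M0)) F = swap_at i (word G F)"
        using word_panel_descent[OF G i F(1)] less by metis
      then show "F \<in> ?R" using F by auto
    qed
    show "?R \<subseteq> ?L"
    proof
      fix F assume "F \<in> ?R"
      then obtain M where M: "M \<in> panel G i" "M \<noteq> G i" and F: "F \<in> lflags n" "Q F"
        and sw: "word (G(i := M)) F = swap_at i w" by auto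
      have "word ((G(i := M))(i := G i)) F = swap_at i (word (G(i := M)) F)"
        using word_panel_ascent[OF panel_complete[OF G i M(1)] i _ F(1), of "G i"] in_panel[OF G i] M i
          less sw by simp
      then show "F \<in> ?L" using F by (simp add: sw)
    qed
  qed
  moreover have "card ?R = (\<Sum>M\<in>panel G i - {G i}. word_count n (G(i := M)) (swap_at i w) Q)"
    unfolding word_count_def
  proof (rule card_UN_disjoint)
    show "\<forall>M\<in>panel G i - {G i}. \<forall>M'\<in>panel G i - {G i}. M \<noteq> M' \<longrightarrow>
      {F \<in> lflags n. word (G(i := M)) F = swap_at i w \<and> Q F} \<inter>
      {F \<in> lflags n. word (G(i := M')) F = swap_at i w \<and> Q F} = {}"
    proof (intro ballI impI, rule ccontr)
      fix M M' assume M: "M \<in> panel G i - {G i}" "M' \<in> panel G i - {G i}" "M \<noteq> M'"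
        and "{F \<in> lflags n. word (G(i := M)) F = swap_at i w \<and> Q F} \<inter>
          {F \<in> lflags n. word (G(i := M')) F = swap_at i w \<and> Q F} \<noteq> {}"
      then obtain F where F: "F \<in> lflags n" "word (G(i := M)) F = swap_at i w"
        "word (G(i := M')) F = swap_at i w" by auto
      \<comment> \<open>At \<open>M\<close> the word has an ascent, so the move to \<open>M'\<close>
        swaps it once more; it can remain \<open>swap_at i w\<close> only if the two letters are
        equal.\<close>
      have "word ((G(i := M))(i := M')) F = swap_at i (word (G(i := M)) F)"
        using word_panel_ascent[OF panel_complete[OF G i] i _ F(1), of M M'] M i F(2) less by simp
      then have "w = swap_at i w" using F by simp
      then have "w i = w (i + 1)" by (metis Suc_eq_plus1 swap_at_simps(1))
      then show False using less by simp
    qed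
  qed (use finite_panel finite_lflags in auto)
  ultimately show ?thesis by (simp add: word_count_def)
qed

lemma card_panel_Diff: "complete G \<Longrightarrow> 1 \<le> i \<Longrightarrow> i < m \<Longrightarrow> card (panel G i - {G i}) = q"
  using card_panel_eq in_panel finite_panel by simp

text \<open>As \<open>G i\<close> runs through the \<open>q\<close> other members of the panel, the
  word of \<open>F''\<close> moves too: with equal letters it never changes, at an ascent it always
  swaps, and at a descent it swaps for one member and stays for the other \<open>q - 1\<close>.
  These multiplicities are the coefficients in the rules of \<open>hecke\<close>. For sorted
  \<open>w\<close> there is one candidate flag, the coarsening of \<open>G\<close>.\<close>

lemma hecke_word_count:
  assumes "hecke m B w x p" "w \<in> words n m" "complete G" "F'' \<in> lflags n" "word G F'' = x"
  shows "int (word_count n G w (\<lambda>F'. pos n F' F'' = B)) = poly p (int q)"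
  using assms
proof (induction arbitrary: G rule: hecke.induct)
  case (sorted w x)
  note F'' = sorted.prems(3)
  let ?F = "coarsen n G w"
  have F: "?F \<in> lflags n" using coarsen_lflags sorted by blast
  have "word G ?F = w" using word_sorted_iff[OF sorted.prems(2) F] sorted by blast
  then have p: "pos n ?F F'' = pair_count m w x"
    using pos_coarsen[OF sorted.prems(2) F F''] sorted by simp
  have "F \<in> lflags n \<and> word G F = w \<longleftrightarrow> F = ?F" for F
    using F word_sorted_iff[OF sorted.prems(2) _ sorted.prems(1) sorted.hyps] by blast
  then have "{F \<in> lflags n. word G F = w \<and> pos n F F'' = B} = {F. F = ?F \<and> pair_count m w x = B}"
    by (intro Collect_cong) (metis p)
  then show ?case by (simp add: word_count_def)
next
  case (equal i w x p)
  note i = equal.hyps(1,2) and G = equal.prems(2) and F'' = equal.prems(3)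
  note sw = swap_at_words[OF equal.prems(1) i]
  have "word (G(i := M)) F'' = x" if "M \<in> panel G i" for M
  proof -
    have "swap_at i x = x" using equal.hyps(4) by (auto simp: swap_at_def)
    then show ?thesis using word_panel[OF G i that F''] equal.prems(4) by auto
  qed
  then have "int (word_count n (G(i := M)) (swap_at i w) (\<lambda>F'. pos n F' F'' = B)) = poly p (int q)"
    if "M \<in> panel G i - {G i}" for M
    using equal.IH[OF sw panel_complete[OF G i, of M] F''] that by blast
  then show ?case
    unfolding word_count_rec[where i = i and w = w, OF G i equal.hyps(3)]
    by (simp add: card_panel_Diff[OF G i])
next
  case (ascent i w x p)
  note i = ascent.hyps(1,2) and G = ascent.prems(2) and F'' = ascent.prems(3)
  note sw = swap_at_words[OF ascent.prems(1) i]
  have "word (G(i := M)) F'' = swap_at i x" if "M \<in> panel G i" "M \<noteq> G i" for M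
    using word_panel_ascent[OF G i that(1) F'' _ that(2)] ascent.hyps(4) ascent.prems(4) by simp
  then have "int (word_count n (G(i := M)) (swap_at i w) (\<lambda>F'. pos n F' F'' = B)) = poly p (int q)"
    if "M \<in> panel G i - {G i}" for M
    using ascent.IH[OF sw panel_complete[OF G i, of M] F''] that by blast
  then show ?case
    unfolding word_count_rec[where i = i and w = w, OF G i ascent.hyps(3)]
    by (simp add: card_panel_Diff[OF G i])
next
  case (descent i w x p p')
  note i = descent.hyps(1,2) and G = descent.prems(2) and F'' = descent.prems(3)
  note sw = swap_at_words[OF descent.prems(1) i]
  let ?c = "\<lambda>M. word_count n (G(i := M)) (swap_at i w) (\<lambda>F'. pos n F' F'' = B)"
  have less: "word G F'' (i + 1) < word G F'' i" using descent.hyps(4) descent.prems(4) by simp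
  obtain M0 where M0: "M0 \<in> panel G i" "M0 \<noteq> G i" "word (G(i := M0)) F'' = swap_at i x"
    and other: "\<And>M. M \<in> panel G i \<Longrightarrow> M \<noteq> M0 \<Longrightarrow> word (G(i := M)) F'' = x"
    using word_panel_descent[OF G i F'' less] unfolding descent.prems(4) by blast
  have "word_count n G w (\<lambda>F'. pos n F' F'' = B) = (\<Sum>M\<in>panel G i - {G i}. ?c M)"
    by (rule word_count_rec[OF G i descent.hyps(3)])
  also have "\<dots> = ?c M0 + (\<Sum>M\<in>panel G i - {G i} - {M0}. ?c M)"
    using M0 finite_panel by (intro sum.remove) auto
  finally have "int (word_count n G w (\<lambda>F'. pos n F' F'' = B)) =
      int (?c M0) + (\<Sum>M\<in>panel G i - {G i} - {M0}. int (?c M))" by simp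
  moreover have "int (?c M0) = poly p (int q)"
    by (rule descent.IH(1)[OF sw panel_complete[OF G i M0(1)] F'' M0(3)])
  moreover have "int (?c M) = poly p' (int q)" if "M \<in> panel G i - {G i} - {M0}" for M
  proof -
    have M: "M \<in> panel G i" "M \<noteq> M0" using that by auto
    show ?thesis by (rule descent.IH(2)[OF sw panel_complete[OF G i M(1)] F'' other[OF M]])
  qed
  moreover have "card (panel G i - {G i} - {M0}) = q - 1"
    using M0 finite_panel by (simp add: card_panel_Diff[OF G i])
  ultimately show ?case using q_pos by (simp add: of_nat_diff algebra_simps)
qed

text \<open>A complete flag is taken whose word of keys has the largest weight. A descent in the
  keys could be removed by a move inside a panel, and the new complete flag would have larger
  weight.\<close>

lemma lex_sorted_complete:
  assumes F: "F \<in> lflags n" and F'': "F'' \<in> lflags n"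
  obtains G where "complete G" "lex_sorted n m (pos n F F'') (word G F, word G F'')"
    "sorted_word m (word G F)"
proof -
  define key where "key G a = word G F a * (n + 1) + word G F'' a" for G a
  define \<mu> where "\<mu> G = (\<Sum>a=1..m. a * key G a)" for G
  have le: "word G F a \<le> n" "word G F'' a \<le> n" if "complete G" "1 \<le> a" "a \<le> m" for G a
    using word_le_iff(2)[OF that(1) F that(2,3)] word_le_iff(2)[OF that(1) F'' that(2,3)] by auto
  have "\<mu> G \<le> m * (m * (n * (n + 1) + n))" if "complete G" for G
    unfolding \<mu>_def key_def using le[OF that] by (intro sum_word_le add_mono mult_right_mono) auto
  then have "\<forall>G. complete G \<longrightarrow> \<mu> G < Suc (m * (m * (n * (n + 1) + n)))"
    by (simp add: less_Suc_eq_le)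
  moreover obtain G0 where "complete G0" using complete_exists by blast
  ultimately have "\<exists>G. complete G \<and> (\<forall>H. complete H \<longrightarrow> \<mu> H \<le> \<mu> G)"
    by (intro ex_has_greatest_nat)
  then obtain G where G: "complete G" and max: "\<And>H. complete H \<Longrightarrow> \<mu> H \<le> \<mu> G" by blast
  have less_key: "\<mu> G < \<mu> H" if "1 \<le> i" "i < m" "key G (i + 1) < key G i" "key H = swap_at i (key G)" for H i
    unfolding \<mu>_def that(4) by (intro sum_swap_at_less that)
  have key: "key G i \<le> key G (i + 1)" if i: "1 \<le> i" "i < m" for i
  proof (rule ccontr)
    assume "\<not> ?thesis"
    then have "word G F i > word G F (i + 1) \<or>
        word G F i = word G F (i + 1) \<and> word G F'' i > word G F'' (i + 1)"
      using lex_key_less[of "word G F'' i" n "word G F'' (i + 1)" "word G F i" "word G F (i + 1)"]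
        le(2)[OF G, of i] le(2)[OF G, of "i + 1"] i by (auto simp: key_def)
    then show False
    proof
      assume less: "word G F i > word G F (i + 1)"
      then obtain M where M: "M \<in> panel G i" "word (G(i := M)) F = swap_at i (word G F)"
        using word_panel_descent[OF G i F] by metis
      let ?H = "G(i := M)"
      have H: "complete ?H" using panel_complete[OF G i M(1)] .
      have mu: "\<mu> H = (\<Sum>a=1..m. a * word H F a) * (n + 1) + (\<Sum>a=1..m. a * word H F'' a)" for H
        unfolding \<mu>_def key_def by (simp only: distrib_left sum.distrib sum_distrib_right mult.assoc)
      have "(\<Sum>a=1..m. a * word G F a) < (\<Sum>a=1..m. a * word ?H F a)"
        unfolding M(2) using i less by (rule sum_swap_at_less)
      then have "((\<Sum>a=1..m. a * word G F a) + 1) * (n + 1) \<le> (\<Sum>a=1..m. a * word ?H F a) * (n + 1)"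
        by (intro mult_right_mono) auto
      \<comment> \<open>The same move may spoil the second word, but this costs at most
        \<open>n\<close>, while the gain in the first word counts with factor
        \<open>n + 1\<close>.\<close>
      moreover have "(\<Sum>a=1..m. a * word G F'' a) \<le> (\<Sum>a=1..m. a * word ?H F'' a) + n"
      proof (cases "word ?H F'' = word G F''")
        case False
        then have "word ?H F'' = swap_at i (word G F'')" using word_panel[OF G i M(1) F''] by blast
        then show ?thesis
          using sum_swap_at[OF i, of "word G F''"] le(2)[OF G, of i] le(2)[OF G, of "i + 1"] i by simp
      qed simp
      ultimately have "\<mu> G < \<mu> ?H" unfolding mu by (simp add: algebra_simps)
      then show False using max[OF H] by simp
    next
      assume eq: "word G F i = word G F (i + 1) \<and> word G F'' i > word G F'' (i + 1)"
      then obtain M where M: "M \<in> panel G i" "word (G(i := M)) F'' = swap_at i (word G F'')"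
        using word_panel_descent[OF G i F''] by metis
      let ?H = "G(i := M)"
      have "swap_at i (word G F) = word G F" using eq by (auto simp: swap_at_def)
      then have "word ?H F = word G F" using word_panel[OF G i M(1) F] by auto
      then have "key ?H = swap_at i (key G)" using M(2) eq by (auto simp: key_def swap_at_def fun_eq_iff)
      then show False using less_key[OF i, of ?H] max[OF panel_complete[OF G i M(1)]] eq
        by (simp add: key_def)
    qed
  qed
  have sorted: "sorted_word m (word G F)"
    unfolding sorted_word_def
  proof
    fix a assume "a \<in> {1..<m}"
    then show "word G F a \<le> word G F (a + 1)"
      using key[of a] lex_key_less[of "word G F'' a" n "word G F'' (a + 1)" "word G F a" "word G F (a + 1)"]
        le[OF G, of a] le[OF G, of "a + 1"] by (auto simp: key_def le_imp_less_Suc)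
  qed
  moreover have "lex_sorted n m (pos n F F'') (word G F, word G F'')"
    using key pos_coarsen[OF G F F'' sorted] word_in_words[OF G] F F''
    by (auto simp: lex_sorted_def sorted_word_def key_def)
  ultimately show ?thesis using that G by blast
qed

lemma pos_Theta: "F \<in> lflags n \<Longrightarrow> F'' \<in> lflags n \<Longrightarrow> pos n F F'' \<in> Theta n m"
  using lex_sorted_complete[of F n F''] pos_coarsen word_in_words pair_count_Theta by metis

text \<open>With \<open>G\<close> adapted to both outer flags, the position of F' to
  \<open>F\<close> depends only on the word of F' with respect to \<open>G\<close>. The count is
  thus a sum over words of counts given by \<open>hecke\<close>, and the words of \<open>F\<close>
  and \<open>F''\<close> are determined by the position of these flags.\<close>

theorem card_pos_pos:
  assumes F: "F \<in> lflags n" and F'': "F'' \<in> lflags n"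
  shows "int (card {F' \<in> lflags n. pos n F F' = A \<and> pos n F' F'' = B}) =
    poly (position_poly n m A B (pos n F F'')) (int q)"
proof -
  obtain G where G: "complete G" and lex: "lex_sorted n m (pos n F F'') (word G F, word G F'')"
    and sorted: "sorted_word m (word G F)"
    using lex_sorted_complete[OF F F''] .
  let ?s = "word G F" and ?x = "word G F''"
  have some: "(SOME sx. lex_sorted n m (pos n F F'') sx) = (?s, ?x)"
  proof (rule some_equality[where P = "lex_sorted n m (pos n F F'')"])
    show "lex_sorted n m (pos n F F'') (?s, ?x)" by (rule lex)
    fix sx assume "lex_sorted n m (pos n F F'') sx"
    then show "sx = (?s, ?x)" using lex_sorted_unique[OF _ lex] by (cases sx) auto
  qed
  let ?W = "{w \<in> words n m. pair_count m ?s w = A}"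
  have "{F' \<in> lflags n. pos n F F' = A \<and> pos n F' F'' = B} =
      (\<Union>w\<in>?W. {F' \<in> lflags n. word G F' = w \<and> pos n F' F'' = B})"
    using pos_coarsen[OF G F _ sorted] word_in_words[OF G] by auto
  then have "card {F' \<in> lflags n. pos n F F' = A \<and> pos n F' F'' = B} =
      (\<Sum>w\<in>?W. word_count n G w (\<lambda>F'. pos n F' F'' = B))"
    unfolding word_count_def by (simp only:, intro card_UN_disjoint) (auto simp: finite_words finite_lflags)
  then have "int (card {F' \<in> lflags n. pos n F F' = A \<and> pos n F' F'' = B}) =
      (\<Sum>w\<in>?W. int (word_count n G w (\<lambda>F'. pos n F' F'' = B)))" by simp
  moreover have "int (word_count n G w (\<lambda>F'. pos n F' F'' = B)) =
      poly (SOME p. hecke m B w ?x p) (int q)" if w: "w \<in> ?W" for w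
  proof -
    from w have "hecke m B w ?x (SOME p. hecke m B w ?x p)"
      using hecke_exists[of w n m B ?x] by (auto intro: someI_ex)
    from hecke_word_count[OF this _ G F'' refl] w show ?thesis by simp
  qed
  ultimately show ?thesis by (simp add: position_poly_def some poly_sum)
qed

text \<open>Sorted words come from coarsening. The induction goes back from an ascent to a descent
  by moving the complete flag to another member of the panel, which exists as
  \<open>q > 0\<close>.\<close>

lemma word_exists:
  assumes "x \<in> words n m"
  shows "\<exists>G F. complete G \<and> F \<in> lflags n \<and> word G F = x"
  using assms
proof (induction x rule: word_sort_induct)
  case (sorted w)
  then show ?case using complete_exists coarsen_lflags word_sorted_iff by blast
next
  case (swap w i)
  then obtain G F where G: "complete G" and F: "F \<in> lflags n" "word G F = swap_at i w" by blast
  have "panel G i - {G i} \<noteq> {}" using card_panel_Diff[OF G, of i] swap q_pos by fastforce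
  then obtain M where M: "M \<in> panel G i" "M \<noteq> G i" by auto
  then have "word (G(i := M)) F = swap_at i (word G F)"
    using word_panel_ascent[OF G _ _ _ F(1), of i M] F swap by simp
  then show ?case using panel_complete[OF G _ _ M(1)] F swap by fastforce
qed

text \<open>The first word of a lexicographically sorted pair is itself sorted, so it is realised by
  coarsening the complete flag for which the second word has been realised.\<close>

theorem pos_exists:
  assumes "C \<in> Theta n m"
  shows "\<exists>F\<in>lflags n. \<exists>F''\<in>lflags n. pos n F F'' = C"
proof -
  obtain s x where sx: "lex_sorted n m C (s, x)" using lex_sorted_exists[OF assms] by blast
  then have w: "s \<in> words n m" "x \<in> words n m" and C: "pair_count m s x = C"
    and key: "sorted_word m (\<lambda>a. s a * (n + 1) + x a)" by (auto simp: lex_sorted_def)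
  have sorted: "sorted_word m s"
    unfolding sorted_word_def
  proof
    fix a assume a: "a \<in> {1..<m}"
    then show "s a \<le> s (a + 1)"
      using lex_key_less[of "x a" n "x (a + 1)" "s a" "s (a + 1)"] key words_in[OF w(2), of a]
        words_in[OF w(2), of "a + 1"] by (auto simp: sorted_word_def le_imp_less_Suc)
  qed
  obtain G F'' where G: "complete G" and F'': "F'' \<in> lflags n" "word G F'' = x"
    using word_exists[OF w(2)] by blast
  let ?F = "coarsen n G s"
  have F: "?F \<in> lflags n" using coarsen_lflags[OF G w(1)] .
  moreover have "word G ?F = s" using word_sorted_iff[OF G F w(1) sorted] by blast
  ultimately have "pos n ?F F'' = C" using pos_coarsen[OF G F F''(1)] sorted F'' C by simp
  then show ?thesis using F F'' by blast
qed

end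

section \<open>Subspaces of a finite vector space\<close>

lemma card_fibres:
  assumes "finite A" and "\<And>y. y \<in> f ` A \<Longrightarrow> card {x\<in>A. f x = y} = k"
  shows "card A = card (f ` A) * k"
proof -
  have "card A = (\<Sum>y\<in>f ` A. card {x\<in>A. f x = y})"
    using sum.image_gen[OF assms(1), of "\<lambda>_. 1::nat" f] by simp
  also have "\<dots> = (\<Sum>y\<in>f ` A. k)" using assms(2) by (intro sum.cong) auto
  finally show ?thesis by simp
qed

locale finite_vectorspace_loc = vectorspace K V for K (structure) and V (structure) +
  assumes finite_K: "finite (carrier K)" and finite_V: "finite (carrier V)"
begin

abbreviation q :: nat where "q \<equiv> card (carrier K)"

lemma fin_dim: "fin_dim"
  unfolding fin_dim_def
proof (intro exI conjI)
  show "span (carrier V) = carrier V"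
    using span_closed[of "carrier V"] in_own_span[of "carrier V"] by blast
qed (use finite_V in auto)

text \<open>Since \<open>q > 1\<close>, a dimension can be read off from a number of vectors. The
  rank identities below are all obtained by counting in this way.\<close>

lemma card_eq: "card (carrier V) = q ^ dim"
proof -
  obtain B where B: "finite B" "basis B" using finite_basis_exists[OF fin_dim] by blast
  then have BV: "B \<subseteq> carrier V" by (simp add: basis_def)
  have uniq: "\<exists>!a. a \<in> B \<rightarrow>\<^sub>E carrier K \<and> lincomb a B = v" if "v \<in> carrier V" for v
    using basis_criterion[OF B(1) BV] B(2) that by blast
  have "bij_betw (\<lambda>a. lincomb a B) (B \<rightarrow>\<^sub>E carrier K) (carrier V)"
    unfolding bij_betw_def
  proof
    have closed: "lincomb a B \<in> carrier V" if "a \<in> B \<rightarrow>\<^sub>E carrier K" for a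
      using that by (intro lincomb_closed[OF BV]) auto
    show "inj_on (\<lambda>a. lincomb a B) (B \<rightarrow>\<^sub>E carrier K)"
      using uniq closed by (intro inj_onI) blast
    show "(\<lambda>a. lincomb a B) ` (B \<rightarrow>\<^sub>E carrier K) = carrier V"
      using uniq closed by blast
  qed
  then have "card (carrier V) = card (B \<rightarrow>\<^sub>E carrier K)" by (simp add: bij_betw_same_card)
  also have "\<dots> = q ^ card B" by (simp add: card_PiE B(1))
  finally show ?thesis using dim_basis[OF B] by simp
qed

lemma q_gt_1: "1 < q"
proof -
  have "card {\<zero>\<^bsub>K\<^esub>, \<one>\<^bsub>K\<^esub>} \<le> q" using finite_K by (intro card_mono) auto
  then show ?thesis by simp
qed

abbreviation subspaces :: "'c set set" where "subspaces \<equiv> {W. subspace K W V}"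

lemma subspaceD:
  assumes "subspace K W V"
  shows "W \<subseteq> carrier V" "\<zero>\<^bsub>V\<^esub> \<in> W" "x \<in> W \<Longrightarrow> y \<in> W \<Longrightarrow> x \<oplus>\<^bsub>V\<^esub> y \<in> W"
    "k \<in> carrier K \<Longrightarrow> x \<in> W \<Longrightarrow> k \<odot>\<^bsub>V\<^esub> x \<in> W" "x \<in> W \<Longrightarrow> \<ominus>\<^bsub>V\<^esub> x \<in> W"
proof -
  interpret submodule K W V using assms by (simp add: subspace_def)
  show W: "W \<subseteq> carrier V" "\<zero>\<^bsub>V\<^esub> \<in> W" "x \<in> W \<Longrightarrow> y \<in> W \<Longrightarrow> x \<oplus>\<^bsub>V\<^esub> y \<in> W"
    "k \<in> carrier K \<Longrightarrow> x \<in> W \<Longrightarrow> k \<odot>\<^bsub>V\<^esub> x \<in> W" for x y k using subset by auto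
  assume x: "x \<in> W"
  have "(\<ominus>\<^bsub>K\<^esub> \<one>\<^bsub>K\<^esub>) \<odot>\<^bsub>V\<^esub> x \<in> W" by (rule W(4)) (use x in auto)
  then show "\<ominus>\<^bsub>V\<^esub> x \<in> W" using x W(1) by (metis subsetD smult_minus_1)
qed

lemma subspaceI:
  assumes "W \<subseteq> carrier V" "\<zero>\<^bsub>V\<^esub> \<in> W" "\<And>x y. x \<in> W \<Longrightarrow> y \<in> W \<Longrightarrow> x \<oplus>\<^bsub>V\<^esub> y \<in> W"
    "\<And>k x. k \<in> carrier K \<Longrightarrow> x \<in> W \<Longrightarrow> k \<odot>\<^bsub>V\<^esub> x \<in> W"
  shows "subspace K W V"
  using assms by (auto simp: subspace_def submodule_def intro: vectorspace_axioms module_axioms)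

lemma subspace_finite: "subspace K W V \<Longrightarrow> finite W"
  using subspaceD(1) finite_V finite_subset by blast

lemma subspace_loc: "subspace K W V \<Longrightarrow> finite_vectorspace_loc K (vs W)"
  using subspace_is_vs subspace_finite finite_K
  by (simp add: finite_vectorspace_loc_def finite_vectorspace_loc_axioms_def)

definition rk :: "'c set \<Rightarrow> nat" where "rk W = vectorspace.dim K (vs W)"

lemma card_subspace: "subspace K W V \<Longrightarrow> card W = q ^ rk W"
  using finite_vectorspace_loc.card_eq[OF subspace_loc] by (simp add: rk_def)

lemma rk_eqI: "subspace K W V \<Longrightarrow> card W = q ^ r \<Longrightarrow> rk W = r"
  using card_subspace q_gt_1 by simp

lemma subspace_Int: "subspace K A V \<Longrightarrow> subspace K B V \<Longrightarrow> subspace K (A \<inter> B) V"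
  by (rule subspaceI) (auto dest: subspaceD)

lemma in_set_add: "z \<in> A <+>\<^bsub>V\<^esub> B \<longleftrightarrow> (\<exists>a\<in>A. \<exists>b\<in>B. z = a \<oplus>\<^bsub>V\<^esub> b)"
  by (auto simp: set_add_def')

lemma subspace_set_add:
  assumes A: "subspace K A V" and B: "subspace K B V"
  shows "subspace K (A <+>\<^bsub>V\<^esub> B) V" "A \<subseteq> A <+>\<^bsub>V\<^esub> B" "B \<subseteq> A <+>\<^bsub>V\<^esub> B"
proof -
  have eq: "A <+>\<^bsub>V\<^esub> B = subspace_sum A B"
    by (simp add: submodule_sum_def set_eq_iff in_set_add image_iff Bex_def)
  show "subspace K (A <+>\<^bsub>V\<^esub> B) V" unfolding eq by (rule sum_is_subspace[OF A B])
  show "A \<subseteq> A <+>\<^bsub>V\<^esub> B" unfolding eq by (rule in_sum_vs[OF A B])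
  show "B \<subseteq> A <+>\<^bsub>V\<^esub> B" unfolding eq vsum_comm[OF A B] by (rule in_sum_vs[OF B A])
qed

lemma set_add_least: "subspace K C V \<Longrightarrow> A \<subseteq> C \<Longrightarrow> B \<subseteq> C \<Longrightarrow> A <+>\<^bsub>V\<^esub> B \<subseteq> C"
  using subspaceD(3)[of C] by (auto simp: in_set_add subset_iff)

text \<open>The fibre of the addition map through \<open>(a, b)\<close> consists of the pairs
  \<open>(a + c, - c + b)\<close> with \<open>c\<close> in \<open>A \<inter> B\<close>.\<close>

lemma card_set_add:
  assumes A: "subspace K A V" and B: "subspace K B V"
  shows "card (A <+>\<^bsub>V\<^esub> B) * card (A \<inter> B) = card A * card B"
proof -
  define f where "f = (\<lambda>(a, b). a \<oplus>\<^bsub>V\<^esub> b)"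
  have img: "f ` (A \<times> B) = A <+>\<^bsub>V\<^esub> B" by (simp add: f_def set_eq_iff in_set_add image_iff Bex_def)
  have "card (A \<times> B) = card (f ` (A \<times> B)) * card (A \<inter> B)"
  proof (rule card_fibres)
    show "finite (A \<times> B)" using A B subspace_finite by blast
    fix y assume "y \<in> f ` (A \<times> B)"
    then obtain a b where ab: "a \<in> A" "b \<in> B" "y = a \<oplus>\<^bsub>V\<^esub> b" by (auto simp: f_def)
    have V: "a \<in> carrier V" "b \<in> carrier V" using ab A B subspaceD(1) by auto
    have "bij_betw (\<lambda>c. (a \<oplus>\<^bsub>V\<^esub> c, \<ominus>\<^bsub>V\<^esub> c \<oplus>\<^bsub>V\<^esub> b)) (A \<inter> B) {x \<in> A \<times> B. f x = y}"
    proof (rule bij_betw_byWitness[where f' = "\<lambda>x. \<ominus>\<^bsub>V\<^esub> a \<oplus>\<^bsub>V\<^esub> fst x"])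
      show "\<forall>c\<in>A \<inter> B. \<ominus>\<^bsub>V\<^esub> a \<oplus>\<^bsub>V\<^esub> fst (a \<oplus>\<^bsub>V\<^esub> c, \<ominus>\<^bsub>V\<^esub> c \<oplus>\<^bsub>V\<^esub> b) = c"
        using V subspaceD(1)[OF A] by (auto simp: M.r_neg1 subset_iff)
      show "(\<lambda>c. (a \<oplus>\<^bsub>V\<^esub> c, \<ominus>\<^bsub>V\<^esub> c \<oplus>\<^bsub>V\<^esub> b)) ` (A \<inter> B) \<subseteq> {x \<in> A \<times> B. f x = y}"
      proof
        fix x assume "x \<in> (\<lambda>c. (a \<oplus>\<^bsub>V\<^esub> c, \<ominus>\<^bsub>V\<^esub> c \<oplus>\<^bsub>V\<^esub> b)) ` (A \<inter> B)"
        then obtain c where c: "c \<in> A" "c \<in> B" "x = (a \<oplus>\<^bsub>V\<^esub> c, \<ominus>\<^bsub>V\<^esub> c \<oplus>\<^bsub>V\<^esub> b)" by auto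
        then have "c \<in> carrier V" using subspaceD(1)[OF A] by auto
        then have "(a \<oplus>\<^bsub>V\<^esub> c) \<oplus>\<^bsub>V\<^esub> (\<ominus>\<^bsub>V\<^esub> c \<oplus>\<^bsub>V\<^esub> b) = a \<oplus>\<^bsub>V\<^esub> b"
          using V by (simp add: M.a_assoc M.r_neg2)
        then show "x \<in> {x \<in> A \<times> B. f x = y}"
          using c ab subspaceD(3,5)[OF A] subspaceD(3,5)[OF B] by (simp add: f_def)
      qed
      have key: "a \<oplus>\<^bsub>V\<^esub> (\<ominus>\<^bsub>V\<^esub> a \<oplus>\<^bsub>V\<^esub> a') = a' \<and> \<ominus>\<^bsub>V\<^esub> (\<ominus>\<^bsub>V\<^esub> a \<oplus>\<^bsub>V\<^esub> a') \<oplus>\<^bsub>V\<^esub> b = b' \<and>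
          \<ominus>\<^bsub>V\<^esub> a \<oplus>\<^bsub>V\<^esub> a' \<in> A \<inter> B"
        if "a' \<in> A" "b' \<in> B" "a' \<oplus>\<^bsub>V\<^esub> b' = y" for a' b'
      proof -
        have V': "a' \<in> carrier V" "b' \<in> carrier V" using that A B subspaceD(1) by auto
        have 1: "a \<oplus>\<^bsub>V\<^esub> (\<ominus>\<^bsub>V\<^esub> a \<oplus>\<^bsub>V\<^esub> a') = a'" using V V' by (simp add: M.r_neg2)
        have "b = \<ominus>\<^bsub>V\<^esub> a \<oplus>\<^bsub>V\<^esub> (a' \<oplus>\<^bsub>V\<^esub> b')" using V that(3) ab by (simp add: M.r_neg1)
        then have b: "b = (\<ominus>\<^bsub>V\<^esub> a \<oplus>\<^bsub>V\<^esub> a') \<oplus>\<^bsub>V\<^esub> b'" using V V' by (simp add: M.a_assoc)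
        then have 2: "\<ominus>\<^bsub>V\<^esub> (\<ominus>\<^bsub>V\<^esub> a \<oplus>\<^bsub>V\<^esub> a') \<oplus>\<^bsub>V\<^esub> b = b'" using V V' by (simp add: M.r_neg1)
        have "b \<oplus>\<^bsub>V\<^esub> \<ominus>\<^bsub>V\<^esub> b' = \<ominus>\<^bsub>V\<^esub> a \<oplus>\<^bsub>V\<^esub> a'"
          using V V' by (simp add: b M.a_assoc M.r_neg)
        moreover have "b \<oplus>\<^bsub>V\<^esub> \<ominus>\<^bsub>V\<^esub> b' \<in> B" using ab that subspaceD(3,5)[OF B] by simp
        ultimately have "\<ominus>\<^bsub>V\<^esub> a \<oplus>\<^bsub>V\<^esub> a' \<in> B" by simp
        moreover have "\<ominus>\<^bsub>V\<^esub> a \<oplus>\<^bsub>V\<^esub> a' \<in> A" using ab that subspaceD(3,5)[OF A] by simp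
        ultimately show ?thesis using 1 2 by simp
      qed
      show "\<forall>x\<in>{x \<in> A \<times> B. f x = y}.
          (a \<oplus>\<^bsub>V\<^esub> (\<ominus>\<^bsub>V\<^esub> a \<oplus>\<^bsub>V\<^esub> fst x), \<ominus>\<^bsub>V\<^esub> (\<ominus>\<^bsub>V\<^esub> a \<oplus>\<^bsub>V\<^esub> fst x) \<oplus>\<^bsub>V\<^esub> b) = x"
        using key by (auto simp: f_def)
      show "(\<lambda>x. \<ominus>\<^bsub>V\<^esub> a \<oplus>\<^bsub>V\<^esub> fst x) ` {x \<in> A \<times> B. f x = y} \<subseteq> A \<inter> B"
        using key by (auto simp: f_def)
    qed
    then show "card {x \<in> A \<times> B. f x = y} = card (A \<inter> B)" by (simp add: bij_betw_same_card)
  qed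
  then show ?thesis by (simp add: img card_cartesian_product)
qed

lemma rk_set_add:
  assumes A: "subspace K A V" and B: "subspace K B V"
  shows "rk (A <+>\<^bsub>V\<^esub> B) + rk (A \<inter> B) = rk A + rk B"
proof -
  have "q ^ (rk (A <+>\<^bsub>V\<^esub> B) + rk (A \<inter> B)) = q ^ (rk A + rk B)"
    using card_set_add[OF A B] card_subspace[OF A] card_subspace[OF B]
      card_subspace[OF subspace_Int[OF A B]] card_subspace[OF subspace_set_add(1)[OF A B]]
    by (simp add: power_add)
  then show ?thesis using q_gt_1 by (simp only: power_inject_exp)
qed

lemma rk_strict: 
  assumes "subspace K A V" "subspace K B V" "A \<subset> B" shows "rk A < rk B"
proof -
  have "card A < card B" using assms subspace_finite psubset_card_mono by blast
  then show ?thesis using assms card_subspace q_gt_1 by simp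
qed

lemma subspace_zero: "subspace K {\<zero>\<^bsub>V\<^esub>} V"
  by (rule subspaceI) auto

lemma subspace_carrier: "subspace K (carrier V) V"
  by (rule subspaceI) auto

definition adjoin :: "'c set \<Rightarrow> 'c \<Rightarrow> 'c set"
  where "adjoin A x = A <+>\<^bsub>V\<^esub> span {x}"

text \<open>A nonzero scalar multiple of \<open>x\<close> in \<open>A\<close> would put
  \<open>x\<close> in \<open>A\<close>. Hence the line through \<open>x\<close> has \<open>q\<close>
  elements and meets \<open>A\<close> in 0, and modularity gives the rank.\<close>

lemma adjoin:
  assumes A: "subspace K A V" and x: "x \<in> carrier V" "x \<notin> A"
  shows "subspace K (adjoin A x) V" "A \<subseteq> adjoin A x" "x \<in> adjoin A x" "rk (adjoin A x) = rk A + 1"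
proof -
  have S: "subspace K (span {x}) V" using x by (intro span_is_subspace) auto
  have x_in: "x \<in> span {x}" using x span_self by blast
  show "subspace K (adjoin A x) V" "A \<subseteq> adjoin A x" "x \<in> adjoin A x"
    using subspace_set_add[OF A S] x_in by (auto simp: adjoin_def)
  have span_eq: "span {x} = (\<lambda>k. k \<odot>\<^bsub>V\<^esub> x) ` carrier K"
  proof -
    have "lincomb a {x} = a x \<odot>\<^bsub>V\<^esub> x" if "a \<in> {x} \<rightarrow> carrier K" for a
      using that x by (simp add: lincomb_def)
    then have "span {x} = {a x \<odot>\<^bsub>V\<^esub> x | a. a \<in> {x} \<rightarrow> carrier K}"
      using finite_span[of "{x}"] x by force
    also have "\<dots> = (\<lambda>k. k \<odot>\<^bsub>V\<^esub> x) ` carrier K"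
    proof
      show "(\<lambda>k. k \<odot>\<^bsub>V\<^esub> x) ` carrier K \<subseteq> {a x \<odot>\<^bsub>V\<^esub> x | a. a \<in> {x} \<rightarrow> carrier K}"
      proof
        fix y assume "y \<in> (\<lambda>k. k \<odot>\<^bsub>V\<^esub> x) ` carrier K"
        then obtain k where "k \<in> carrier K" "y = k \<odot>\<^bsub>V\<^esub> x" by blast
        then show "y \<in> {a x \<odot>\<^bsub>V\<^esub> x | a. a \<in> {x} \<rightarrow> carrier K}"
          by (intro CollectI exI[of _ "\<lambda>_. k"]) auto
      qed
    qed auto
    finally show ?thesis .
  qed
  have unit: "k = \<zero>\<^bsub>K\<^esub>" if "k \<in> carrier K" "k \<odot>\<^bsub>V\<^esub> x \<in> A" for k
  proof (rule ccontr)
    assume k: "k \<noteq> \<zero>\<^bsub>K\<^esub>"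
    then have "inv\<^bsub>K\<^esub> k \<in> carrier K" using that(1) field_Units by (metis Diff_iff Units_inv_closed singletonD)
    moreover have "x = inv\<^bsub>K\<^esub> k \<odot>\<^bsub>V\<^esub> (k \<odot>\<^bsub>V\<^esub> x)" by (rule mult_inverse) (use that k x in auto)
    ultimately have "x \<in> A" using that(2) subspaceD(4)[OF A] by metis
    then show False using x by simp
  qed
  have "inj_on (\<lambda>k. k \<odot>\<^bsub>V\<^esub> x) (carrier K)"
  proof (rule inj_onI)
    fix k k' assume k: "k \<in> carrier K" "k' \<in> carrier K" and eq: "k \<odot>\<^bsub>V\<^esub> x = k' \<odot>\<^bsub>V\<^esub> x"
    have "(k \<oplus>\<^bsub>K\<^esub> \<ominus>\<^bsub>K\<^esub> k') \<odot>\<^bsub>V\<^esub> x = \<zero>\<^bsub>V\<^esub>"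
      using k x eq by (simp add: smult_l_distr smult_l_minus M.r_neg)
    then have "k \<oplus>\<^bsub>K\<^esub> \<ominus>\<^bsub>K\<^esub> k' = \<zero>\<^bsub>K\<^esub>" using unit k subspaceD(2)[OF A] by simp
    then show "k = k'" using k by (metis R.minus_equality R.minus_minus R.a_inv_closed R.add.m_comm)
  qed
  then have "card (span {x}) = q" unfolding span_eq by (rule card_image)
  then have "rk (span {x}) = 1" by (intro rk_eqI[OF S]) simp
  moreover have "A \<inter> span {x} = {\<zero>\<^bsub>V\<^esub>}"
  proof
    show "A \<inter> span {x} \<subseteq> {\<zero>\<^bsub>V\<^esub>}"
    proof
      fix y assume "y \<in> A \<inter> span {x}"
      then obtain k where "k \<in> carrier K" "y = k \<odot>\<^bsub>V\<^esub> x" "y \<in> A" by (auto simp: span_eq)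
      then show "y \<in> {\<zero>\<^bsub>V\<^esub>}" using unit[of k] x by simp
    qed
  qed (use subspaceD(2)[OF A] subspaceD(2)[OF S] in auto)
  moreover have "rk {\<zero>\<^bsub>V\<^esub>} = 0" by (rule rk_eqI[OF subspace_zero]) simp
  ultimately show "rk (adjoin A x) = rk A + 1"
    using rk_set_add[OF A S] by (simp add: adjoin_def)
qed

lemma adjoin_eqI:
  assumes A: "subspace K A V" and M: "subspace K M V" and "A \<subseteq> M" "rk M = rk A + 1" "x \<in> M" "x \<notin> A"
  shows "adjoin A x = M"
proof -
  have x: "x \<in> carrier V" using assms subspaceD(1) by blast
  have "adjoin A x \<subseteq> M"
    unfolding adjoin_def using assms span_is_subset[of "{x}" M] by (intro set_add_least) auto
  then show ?thesis
    using rk_strict[OF adjoin(1)[OF A x assms(6)] M] adjoin(4)[OF A x assms(6)] assms(4) by auto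
qed

text \<open>With \<open>a = rk A\<close>, each vector of \<open>B - A\<close> generates over
  \<open>A\<close> one member of the interval, and each member \<open>M\<close> arises from the
  q^(a+1) - q^a vectors of \<open>M - A\<close>. Dividing q^(a+2) - q^a by this number gives q +
  1.\<close>

lemma card_rank2_interval:
  assumes A: "subspace K A V" and B: "subspace K B V" and AB: "A \<subseteq> B" and rk: "rk B = rk A + 2"
  shows "card {M. subspace K M V \<and> A \<subseteq> M \<and> M \<subseteq> B \<and> rk M = rk A + 1} = q + 1" (is "card ?X = _")
proof -
  have fin: "finite A" "finite B" using A B subspace_finite by auto
  have img: "adjoin A ` (B - A) = ?X"
  proof
    show "adjoin A ` (B - A) \<subseteq> ?X"
    proof
      fix M assume "M \<in> adjoin A ` (B - A)"
      then obtain x where x: "x \<in> B" "x \<notin> A" "M = adjoin A x" by auto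
      have "x \<in> carrier V" using x B subspaceD(1) by blast
      moreover have "M \<subseteq> B"
        unfolding x adjoin_def using x AB B span_is_subset[of "{x}" B] by (intro set_add_least) auto
      ultimately show "M \<in> ?X" using adjoin[OF A _ x(2)] x by auto
    qed
    show "?X \<subseteq> adjoin A ` (B - A)"
    proof
      fix M assume M: "M \<in> ?X"
      then have "A \<noteq> M" by auto
      then obtain x where "x \<in> M" "x \<notin> A" using M by blast
      then show "M \<in> adjoin A ` (B - A)" using adjoin_eqI[OF A, of M x] M by auto
    qed
  qed
  have "card (B - A) = card ?X * (q ^ (rk A + 1) - q ^ rk A)"
    unfolding img[symmetric]
  proof (rule card_fibres)
    fix M assume "M \<in> adjoin A ` (B - A)"
    then have M: "subspace K M V" "A \<subseteq> M" "M \<subseteq> B" "rk M = rk A + 1" unfolding img by auto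
    have "{x \<in> B - A. adjoin A x = M} = M - A"
    proof
      show "{x \<in> B - A. adjoin A x = M} \<subseteq> M - A"
        using adjoin(3)[OF A] subspaceD(1)[OF B] by auto
      show "M - A \<subseteq> {x \<in> B - A. adjoin A x = M}" using adjoin_eqI[OF A M(1,2,4)] M by auto
    qed
    then show "card {x \<in> B - A. adjoin A x = M} = q ^ (rk A + 1) - q ^ rk A"
      using M card_subspace[OF M(1)] card_subspace[OF A] fin by (simp add: card_Diff_subset)
  qed (use fin in simp)
  moreover have "card (B - A) = q ^ (rk A + 2) - q ^ rk A"
    using AB fin card_subspace[OF B] card_subspace[OF A] rk by (simp add: card_Diff_subset)
  ultimately have "card ?X * (q ^ (rk A + 1) - q ^ rk A) = q ^ (rk A + 2) - q ^ rk A" by simp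
  moreover have "q ^ (rk A + 1) - q ^ rk A = (q - 1) * q ^ rk A" by (simp add: diff_mult_distrib)
  moreover have "q ^ (rk A + 2) - q ^ rk A = (q + 1) * ((q - 1) * q ^ rk A)"
  proof -
    obtain p where "q = Suc p" using q_gt_1 by (metis less_nat_zero_code not0_implies_Suc)
    then show ?thesis by (simp add: algebra_simps)
  qed
  ultimately have "card ?X * ((q - 1) * q ^ rk A) = (q + 1) * ((q - 1) * q ^ rk A)" by simp
  moreover have "(q - 1) * q ^ rk A > 0" using q_gt_1 by simp
  ultimately show ?thesis by (simp only: mult_cancel2) simp
qed

lemma subspace_lattice: "ranked_lattice subspaces {\<zero>\<^bsub>V\<^esub>} (carrier V) (\<lambda>A B. A <+>\<^bsub>V\<^esub> B) rk q dim"
proof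
  show "finite subspaces"
  proof (rule finite_subset)
    show "subspaces \<subseteq> Pow (carrier V)" by (auto dest: subspaceD(1))
  qed (use finite_V in simp)
  show "rk {\<zero>\<^bsub>V\<^esub>} = 0" by (rule rk_eqI[OF subspace_zero]) simp
  show "rk (carrier V) = dim" by (rule rk_eqI[OF subspace_carrier card_eq])
  show "{\<zero>\<^bsub>V\<^esub>} \<in> subspaces" "carrier V \<in> subspaces" using subspace_zero subspace_carrier by auto
  show "0 < q" using q_gt_1 by simp
  fix A assume A: "A \<in> subspaces"
  show "{\<zero>\<^bsub>V\<^esub>} \<subseteq> A" "A \<subseteq> carrier V" using A subspaceD(1,2)[of A] by simp_all
  show "\<exists>B\<in>subspaces. A \<subset> B \<and> rk B = rk A + 1" if ne: "A \<noteq> carrier V"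
  proof -
    obtain x where "x \<in> carrier V" "x \<notin> A" using ne A subspaceD(1)[of A] by blast
    then show ?thesis using adjoin[of A x] A by (intro bexI[of _ "adjoin A x"]) auto
  qed
  fix B assume B: "B \<in> subspaces"
  show "A \<inter> B \<in> subspaces" "A <+>\<^bsub>V\<^esub> B \<in> subspaces" "A \<subseteq> A <+>\<^bsub>V\<^esub> B" "B \<subseteq> A <+>\<^bsub>V\<^esub> B"
    using A B subspace_Int[of A B] subspace_set_add[of A B] by simp_all
  show "rk (A <+>\<^bsub>V\<^esub> B) + rk (A \<inter> B) = rk A + rk B" using A B rk_set_add[of A B] by simp
  show "rk A < rk B" if "A \<subset> B" using A B that rk_strict[of A B] by simp
  show "card {M \<in> subspaces. A \<subseteq> M \<and> M \<subseteq> B \<and> rk M = rk A + 1} = q + 1"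
    if "A \<subseteq> B" "rk B = rk A + 2"
    using card_rank2_interval[of A B] A B that by (simp only: mem_Collect_eq)
  show "A <+>\<^bsub>V\<^esub> B \<subseteq> C" if "C \<in> subspaces" "A \<subseteq> C" "B \<subseteq> C" for C
    using set_add_least[of C A B] that by simp
qed

sublocale lat: ranked_lattice subspaces "{\<zero>\<^bsub>V\<^esub>}" "carrier V" "\<lambda>A B. A <+>\<^bsub>V\<^esub> B" rk q dim
  by (rule subspace_lattice)

lemma flags_eq: "flags K V n = lat.lflags n"
  by (auto simp: flags_def lat.lflags_def)

end

lemma quotient_vectorspace:
  fixes K (structure) and V (structure)
  assumes V: "vectorspace K V" and W: "subspace K W V"
  shows "vectorspace K (quotient_module V W)"
    and "carrier (quotient_module V W) = a_rcosets\<^bsub>V\<^esub> W"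
    and "finite (carrier V) \<Longrightarrow> card (a_rcosets\<^bsub>V\<^esub> W) * card W = card (carrier V)"
proof -
  interpret vectorspace K V by (rule V)
  interpret S: submodule K W V using W by (simp add: subspace_def)
  have neg: "\<ominus>\<^bsub>V\<^esub> x \<in> W" if "x \<in> W" for x
  proof -
    have "x \<in> carrier V" using that S.subset by blast
    moreover have "(\<ominus>\<^bsub>K\<^esub> \<one>\<^bsub>K\<^esub>) \<odot>\<^bsub>V\<^esub> x \<in> W" using that by (intro S.smult_closed) auto
    ultimately show ?thesis by (metis smult_minus_1)
  qed
  have add_sub: "additive_subgroup W V"
  proof (rule additive_subgroupI)
    show "subgroup W (add_monoid V)"
      by (rule subgroup.intro) (use S.subset neg in \<open>simp_all add: a_inv_def[symmetric]\<close>)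
  qed
  interpret A: abelian_subgroup W V
    by (rule abelian_subgroupI3[OF add_sub]) unfold_locales
  let ?Q = "quotient_module V W"
  have carr: "C \<in> carrier ?Q \<longleftrightarrow> (\<exists>x\<in>carrier V. C = W +>\<^bsub>V\<^esub> x)" for C
    by (auto simp: quotient_module_def A_RCOSETS_def')
  have carrI: "W +>\<^bsub>V\<^esub> x \<in> carrier ?Q" if "x \<in> carrier V" for x
    unfolding carr by (rule bexI[OF refl that])
  have add: "(W +>\<^bsub>V\<^esub> x) \<oplus>\<^bsub>?Q\<^esub> (W +>\<^bsub>V\<^esub> y) = W +>\<^bsub>V\<^esub> (x \<oplus>\<^bsub>V\<^esub> y)"
    if "x \<in> carrier V" "y \<in> carrier V" for x y
    using A.a_rcos_sum[OF that] by (simp add: quotient_module_def)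
  have zero: "\<zero>\<^bsub>?Q\<^esub> = W +>\<^bsub>V\<^esub> \<zero>\<^bsub>V\<^esub>"
    using S.subset by (simp add: quotient_module_def)
  have smult: "a \<odot>\<^bsub>?Q\<^esub> (W +>\<^bsub>V\<^esub> x) = W +>\<^bsub>V\<^esub> (a \<odot>\<^bsub>V\<^esub> x)"
    if a: "a \<in> carrier K" and x: "x \<in> carrier V" for a x
  proof -
    \<comment> \<open>The scalar multiple of a coset is a union over representatives. All cosets in
      the union are equal, as changing the representative by \<open>w\<close> changes the multiple
      by an element of \<open>W\<close>.\<close>
    have "W +>\<^bsub>V\<^esub> (a \<odot>\<^bsub>V\<^esub> y) = W +>\<^bsub>V\<^esub> (a \<odot>\<^bsub>V\<^esub> x)" if y: "y \<in> W +>\<^bsub>V\<^esub> x" for y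
    proof -
      obtain w where w: "w \<in> W" "y = w \<oplus>\<^bsub>V\<^esub> x" using y by (auto simp: a_r_coset_def')
      then have wV: "w \<in> carrier V" using S.subset by blast
      have "a \<odot>\<^bsub>V\<^esub> y = (a \<odot>\<^bsub>V\<^esub> w) \<oplus>\<^bsub>V\<^esub> (a \<odot>\<^bsub>V\<^esub> x)"
        using w wV a x by (simp add: smult_r_distr)
      then have "a \<odot>\<^bsub>V\<^esub> y \<in> W +>\<^bsub>V\<^esub> (a \<odot>\<^bsub>V\<^esub> x)"
        using a w by (auto simp: a_r_coset_def')
      then show ?thesis
        using A.a_repr_independence'[of "a \<odot>\<^bsub>V\<^esub> y" "a \<odot>\<^bsub>V\<^esub> x"] a x by simp
    qed
    moreover have "x \<in> W +>\<^bsub>V\<^esub> x" using x by (rule A.a_rcos_self)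
    ultimately have "(\<Union>y\<in>W +>\<^bsub>V\<^esub> x. W +>\<^bsub>V\<^esub> (a \<odot>\<^bsub>V\<^esub> y)) = W +>\<^bsub>V\<^esub> (a \<odot>\<^bsub>V\<^esub> x)" by blast
    then show ?thesis by (simp add: quotient_module_def)
  qed
  show "vectorspace K ?Q"
  proof (rule vs_criteria)
    show "field K" by unfold_locales
    show "\<zero>\<^bsub>?Q\<^esub> \<in> carrier ?Q" unfolding zero by (rule carrI) simp
    show "\<forall>v w. v \<in> carrier ?Q \<and> w \<in> carrier ?Q \<longrightarrow> v \<oplus>\<^bsub>?Q\<^esub> w \<in> carrier ?Q"
    proof (intro allI impI)
      fix v w assume "v \<in> carrier ?Q \<and> w \<in> carrier ?Q"
      then obtain x y where "x \<in> carrier V" "y \<in> carrier V" "v = W +>\<^bsub>V\<^esub> x" "w = W +>\<^bsub>V\<^esub> y"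
        unfolding carr by (elim conjE bexE)
      then have "v \<oplus>\<^bsub>?Q\<^esub> w = W +>\<^bsub>V\<^esub> (x \<oplus>\<^bsub>V\<^esub> y)" "x \<oplus>\<^bsub>V\<^esub> y \<in> carrier V" by (simp_all add: add)
      then show "v \<oplus>\<^bsub>?Q\<^esub> w \<in> carrier ?Q" by (simp add: carrI)
    qed
    show "\<forall>v\<in>carrier ?Q. \<exists>w\<in>carrier ?Q. v \<oplus>\<^bsub>?Q\<^esub> w = \<zero>\<^bsub>?Q\<^esub>"
    proof
      fix v assume "v \<in> carrier ?Q"
      then obtain x where x: "x \<in> carrier V" "v = W +>\<^bsub>V\<^esub> x" unfolding carr by (elim bexE)
      then have "v \<oplus>\<^bsub>?Q\<^esub> (W +>\<^bsub>V\<^esub> (\<ominus>\<^bsub>V\<^esub> x)) = \<zero>\<^bsub>?Q\<^esub>" by (simp add: add zero M.r_neg)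
      moreover have "W +>\<^bsub>V\<^esub> (\<ominus>\<^bsub>V\<^esub> x) \<in> carrier ?Q" using x by (intro carrI) simp
      ultimately show "\<exists>w\<in>carrier ?Q. v \<oplus>\<^bsub>?Q\<^esub> w = \<zero>\<^bsub>?Q\<^esub>" by blast
    qed
    show "\<forall>c v. c \<in> carrier K \<and> v \<in> carrier ?Q \<longrightarrow> c \<odot>\<^bsub>?Q\<^esub> v \<in> carrier ?Q"
    proof (intro allI impI)
      fix c v assume *: "c \<in> carrier K \<and> v \<in> carrier ?Q"
      then obtain x where "x \<in> carrier V" "v = W +>\<^bsub>V\<^esub> x" unfolding carr by (elim conjE bexE)
      then have "c \<odot>\<^bsub>?Q\<^esub> v = W +>\<^bsub>V\<^esub> (c \<odot>\<^bsub>V\<^esub> x)" "c \<odot>\<^bsub>V\<^esub> x \<in> carrier V"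
        using * by (simp_all add: smult)
      then show "c \<odot>\<^bsub>?Q\<^esub> v \<in> carrier ?Q" by (simp add: carrI)
    qed
    show "\<forall>v w. v \<in> carrier ?Q \<and> w \<in> carrier ?Q \<longrightarrow> v \<oplus>\<^bsub>?Q\<^esub> w = w \<oplus>\<^bsub>?Q\<^esub> v"
      by (auto simp: carr add M.a_comm)
    show "\<forall>v w x. v \<in> carrier ?Q \<and> w \<in> carrier ?Q \<and> x \<in> carrier ?Q \<longrightarrow>
        (v \<oplus>\<^bsub>?Q\<^esub> w) \<oplus>\<^bsub>?Q\<^esub> x = v \<oplus>\<^bsub>?Q\<^esub> (w \<oplus>\<^bsub>?Q\<^esub> x)"
      by (auto simp: carr add M.a_assoc)
    show "\<forall>v\<in>carrier ?Q. v \<oplus>\<^bsub>?Q\<^esub> \<zero>\<^bsub>?Q\<^esub> = v"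
      by (auto simp: carr add zero)
    show "\<forall>a b v. a \<in> carrier K \<and> b \<in> carrier K \<and> v \<in> carrier ?Q \<longrightarrow>
        (a \<otimes> b) \<odot>\<^bsub>?Q\<^esub> v = a \<odot>\<^bsub>?Q\<^esub> (b \<odot>\<^bsub>?Q\<^esub> v)"
      by (auto simp: carr smult smult_assoc1)
    show "\<forall>v\<in>carrier ?Q. \<one> \<odot>\<^bsub>?Q\<^esub> v = v"
      by (auto simp: carr smult)
    show "\<forall>a b v. a \<in> carrier K \<and> b \<in> carrier K \<and> v \<in> carrier ?Q \<longrightarrow>
        (a \<oplus> b) \<odot>\<^bsub>?Q\<^esub> v = (a \<odot>\<^bsub>?Q\<^esub> v) \<oplus>\<^bsub>?Q\<^esub> (b \<odot>\<^bsub>?Q\<^esub> v)"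
      by (auto simp: carr smult add smult_l_distr)
    show "\<forall>a v w. a \<in> carrier K \<and> v \<in> carrier ?Q \<and> w \<in> carrier ?Q \<longrightarrow>
        a \<odot>\<^bsub>?Q\<^esub> (v \<oplus>\<^bsub>?Q\<^esub> w) = (a \<odot>\<^bsub>?Q\<^esub> v) \<oplus>\<^bsub>?Q\<^esub> (a \<odot>\<^bsub>?Q\<^esub> w)"
      by (auto simp: carr smult add smult_r_distr)
  qed
  show "carrier ?Q = a_rcosets\<^bsub>V\<^esub> W" by (simp add: quotient_module_def)
  show "card (a_rcosets\<^bsub>V\<^esub> W) * card W = card (carrier V)" if "finite (carrier V)"
    using M.a_lagrange[OF that add_sub] by (simp add: Coset.order_def)
qed

context finite_vectorspace_loc
begin

text \<open>Lagrange's theorem for \<open>W\<close> in \<open>U\<close>, written with powers of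
  \<open>q\<close>, turns into additivity of the exponents.\<close>

lemma dim_quotient:
  assumes U: "subspace K U V" and W: "subspace K W V" and sub: "W \<subseteq> U"
  shows "vectorspace.dim K (quotient_module (vs U) W) = rk U - rk W"
proof -
  interpret U: finite_vectorspace_loc K "vs U" by (rule subspace_loc[OF U])
  have WU: "subspace K W (vs U)"
    by (rule U.subspaceI) (use subspaceD[OF W] sub in auto)
  let ?Q = "quotient_module (vs U) W"
  note quot = quotient_vectorspace[OF U.vectorspace_axioms WU]
  have "card (carrier ?Q) * card W = card U"
    using quot(2,3) subspace_finite[OF U] by simp
  moreover have "card U > 0"
    using subspaceD(2)[OF U] subspace_finite[OF U] by (auto simp: card_gt_0_iff)
  ultimately have "card (carrier ?Q) > 0" by (metis gr0I mult_0)
  then have "finite (carrier ?Q)" by (rule card_ge_0_finite)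
  then interpret Q: finite_vectorspace_loc K ?Q
    using quot(1) finite_K by (simp add: finite_vectorspace_loc_def finite_vectorspace_loc_axioms_def)
  have "q ^ Q.dim * q ^ rk W = q ^ rk U"
    using quot(2,3) Q.card_eq card_subspace[OF W] card_subspace[OF U] subspace_finite[OF U] by simp
  then have "q ^ (Q.dim + rk W) = q ^ rk U" by (simp add: power_add)
  then have "Q.dim + rk W = rk U" using q_gt_1 by (simp only: power_inject_exp)
  then show ?thesis by simp
qed

lemma rel_pos_eq:
  assumes F: "F \<in> flags K V n" and F': "F' \<in> flags K V n"
  shows "rel_pos K V n (F, F') = lat.pos n F F'"
proof (intro ext)
  fix i j
  show "rel_pos K V n (F, F') i j = lat.pos n F F' i j"
  proof (cases "i \<in> {1..n} \<and> j \<in> {1..n}")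
    case True
    note FL = F[unfolded flags_eq] and FL' = F'[unfolded flags_eq]
    have sub: "subspace K (F i \<inter> F' j) V" "subspace K (F (i - 1) \<inter> F' j) V"
      "subspace K (F i \<inter> F' (j - 1)) V"
      using lat.lflagsD(1)[OF FL] lat.lflagsD(1)[OF FL'] True by (auto intro: subspace_Int)
    have "F (i - 1) \<subseteq> F i" "F' (j - 1) \<subseteq> F' j"
      using lat.lflagsD(4)[OF FL] lat.lflagsD(4)[OF FL'] True by auto
    then have "(F (i - 1) \<inter> F' j) <+>\<^bsub>V\<^esub> (F i \<inter> F' (j - 1)) \<subseteq> F i \<inter> F' j"
      by (intro set_add_least[OF sub(1)]) auto
    from dim_quotient[OF sub(1) subspace_set_add(1)[OF sub(2,3)] this] True show ?thesis
      by (simp add: rel_pos_def lat.pos_def)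
  qed (auto simp: rel_pos_def lat.pos_def)
qed

end

section \<open>Structure constants of the convolution ring\<close>

lemma finite_Theta: "finite (Theta n m)"
proof (rule finite_subset)
  show "Theta n m \<subseteq> (\<lambda>(s, x). pair_count m s x) ` (words n m \<times> words n m)"
  proof
    fix C assume "C \<in> Theta n m"
    then obtain s x where "lex_sorted n m C (s, x)" using lex_sorted_exists by blast
    then show "C \<in> (\<lambda>(s, x). pair_count m s x) ` (words n m \<times> words n m)"
      by (auto simp: lex_sorted_def)
  qed
qed (simp add: finite_words)

context finite_vectorspace_loc
begin

lemma GL_D:
  assumes "g \<in> GL K V"
  shows "x \<in> carrier V \<Longrightarrow> g x \<in> carrier V"
    "x \<in> carrier V \<Longrightarrow> y \<in> carrier V \<Longrightarrow> g (x \<oplus>\<^bsub>V\<^esub> y) = g x \<oplus>\<^bsub>V\<^esub> g y"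
    "k \<in> carrier K \<Longrightarrow> x \<in> carrier V \<Longrightarrow> g (k \<odot>\<^bsub>V\<^esub> x) = k \<odot>\<^bsub>V\<^esub> g x"
    "inj_on g (carrier V)" "g ` carrier V = carrier V" "g \<zero>\<^bsub>V\<^esub> = \<zero>\<^bsub>V\<^esub>"
proof -
  have g: "g \<in> LinearCombinations.module_hom K V V" "bij_betw g (carrier V) (carrier V)"
    using assms by (auto simp: GL_def)
  then show 1: "x \<in> carrier V \<Longrightarrow> g x \<in> carrier V"
    "x \<in> carrier V \<Longrightarrow> y \<in> carrier V \<Longrightarrow> g (x \<oplus>\<^bsub>V\<^esub> y) = g x \<oplus>\<^bsub>V\<^esub> g y"
    "k \<in> carrier K \<Longrightarrow> x \<in> carrier V \<Longrightarrow> g (k \<odot>\<^bsub>V\<^esub> x) = k \<odot>\<^bsub>V\<^esub> g x" for x y k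
    by (simp_all add: LinearCombinations.module_hom_def Pi_iff)
  show "inj_on g (carrier V)" "g ` carrier V = carrier V" using g(2) by (auto simp: bij_betw_def)
  interpret mod_hom K V V g
    using g(1) by (simp add: mod_hom_def mod_hom_axioms_def module_axioms)
  show "g \<zero>\<^bsub>V\<^esub> = \<zero>\<^bsub>V\<^esub>" by simp
qed

lemma GL_subspace:
  assumes g: "g \<in> GL K V" and W: "subspace K W V"
  shows "subspace K (g ` W) V"
proof (rule subspaceI)
  note W' = subspaceD[OF W] and g' = GL_D[OF g]
  show "g ` W \<subseteq> carrier V" using W'(1) g'(1) by auto
  show "\<zero>\<^bsub>V\<^esub> \<in> g ` W" using W'(2) g'(6) by (metis imageI)
  fix x y assume "x \<in> g ` W" "y \<in> g ` W"
  then obtain x' y' where xy: "x' \<in> W" "y' \<in> W" "x = g x'" "y = g y'" by auto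
  then have "x \<oplus>\<^bsub>V\<^esub> y = g (x' \<oplus>\<^bsub>V\<^esub> y')" using g'(2) W'(1) by (simp add: subset_iff)
  then show "x \<oplus>\<^bsub>V\<^esub> y \<in> g ` W" using W'(3) xy by simp
next
  note W' = subspaceD[OF W] and g' = GL_D[OF g]
  fix k x assume "k \<in> carrier K" "x \<in> g ` W"
  then obtain x' where x: "k \<in> carrier K" "x' \<in> W" "x = g x'" by auto
  then have "k \<odot>\<^bsub>V\<^esub> x = g (k \<odot>\<^bsub>V\<^esub> x')" using g'(3) W'(1) by (simp add: subset_iff)
  then show "k \<odot>\<^bsub>V\<^esub> x \<in> g ` W" using W'(4) x by simp
qed

lemma GL_rk:
  assumes g: "g \<in> GL K V" and W: "subspace K W V"
  shows "rk (g ` W) = rk W"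
proof (rule rk_eqI[OF GL_subspace[OF g W]])
  have "inj_on g W" using GL_D(4)[OF g] subspaceD(1)[OF W] inj_on_subset by blast
  then show "card (g ` W) = q ^ rk W" using card_subspace[OF W] by (simp add: card_image)
qed

lemma act_flag_flags:
  assumes g: "g \<in> GL K V" and F: "F \<in> flags K V n"
  shows "act_flag n g F \<in> flags K V n"
proof -
  have "g ` F i \<subseteq> g ` F (Suc i)" if "i < n" for i
    using F that by (intro image_mono) (auto simp: flags_def)
  then show ?thesis using F GL_subspace[OF g] GL_D(5,6)[OF g] by (simp add: flags_def act_flag_def)
qed

text \<open>A linear bijection commutes with intersections and preserves ranks, and by
  \<open>pos_eq\<close> these ranks determine the position.\<close>

lemma rel_pos_act_flag:
  assumes g: "g \<in> GL K V" and F: "F \<in> flags K V n" and F': "F' \<in> flags K V n"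
  shows "rel_pos K V n (act_flag n g F, act_flag n g F') = rel_pos K V n (F, F')"
proof -
  let ?a = "act_flag n g"
  note aF = act_flag_flags[OF g F] and aF' = act_flag_flags[OF g F']
  have rk: "rk (?a F i \<inter> ?a F' j) = rk (F i \<inter> F' j)" if "i \<le> n" "j \<le> n" for i j
  proof -
    have sub: "subspace K (F i) V" "subspace K (F' j) V"
      using F F' that by (auto simp: flags_def)
    have "g ` F i \<inter> g ` F' j = g ` (F i \<inter> F' j)"
      by (rule inj_on_image_Int[OF GL_D(4)[OF g], symmetric]) (use sub subspaceD(1) in auto)
    then show ?thesis
      using that GL_rk[OF g subspace_Int[OF sub]] by (simp add: act_flag_def)
  qed
  have "lat.pos n (?a F) (?a F') i j = lat.pos n F F' i j" for i j
  proof (cases "i \<in> {1..n} \<and> j \<in> {1..n}")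
    case True
    then have ij: "i \<le> n" "j \<le> n" "i - 1 \<le> n" "j - 1 \<le> n" by auto
    show ?thesis
      using lat.pos_eq[OF F[unfolded flags_eq] F'[unfolded flags_eq] conjunct1[OF True] conjunct2[OF True]]
        lat.pos_eq[OF aF[unfolded flags_eq] aF'[unfolded flags_eq] conjunct1[OF True] conjunct2[OF True]]
      unfolding rk[OF ij(1,2)] rk[OF ij(3,2)] rk[OF ij(1,4)] rk[OF ij(3,4)] by linarith
  qed (auto simp: lat.pos_def)
  then show ?thesis by (simp add: rel_pos_eq F F' aF aF' fun_eq_iff)
qed

text \<open>Positions are constant on orbits, so an orbit containing one pair in position
  \<open>A\<close> consists of such pairs; conversely each pair in position \<open>A\<close> lies in
  its own orbit through the identity map.\<close>

lemma flag_orbit_eq: "flag_orbit K V n A = {p \<in> flag_pairs K V n. rel_pos K V n p = A}"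
proof
  show "flag_orbit K V n A \<subseteq> {p \<in> flag_pairs K V n. rel_pos K V n p = A}"
  proof
    fix p assume "p \<in> flag_orbit K V n A"
    then obtain F F' g g' where F: "F \<in> flags K V n" "F' \<in> flags K V n"
      and g: "g \<in> GL K V" "p = (act_flag n g F, act_flag n g F')"
      and g': "g' \<in> GL K V" "rel_pos K V n (act_flag n g' F, act_flag n g' F') = A"
      unfolding flag_orbit_def flag_orbits_def by fastforce
    then show "p \<in> {p \<in> flag_pairs K V n. rel_pos K V n p = A}"
      using act_flag_flags[OF g(1)] by (simp add: rel_pos_act_flag)
  qed
  show "{p \<in> flag_pairs K V n. rel_pos K V n p = A} \<subseteq> flag_orbit K V n A"
  proof
    fix p assume p: "p \<in> {p \<in> flag_pairs K V n. rel_pos K V n p = A}"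
    obtain F F' where FF: "p = (F, F')" by (cases p)
    have id: "(\<lambda>x. x) \<in> GL K V" by (auto simp: GL_def LinearCombinations.module_hom_def bij_betw_def)
    have act: "act_flag n (\<lambda>x. x) G = G" if "G \<in> flags K V n" for G
      using that by (auto simp: act_flag_def flags_def extensional_def fun_eq_iff)
    define Y where "Y = (\<lambda>g. (act_flag n g F, act_flag n g F')) ` GL K V"
    have "Y \<in> flag_orbits K V n" using p by (auto simp: Y_def flag_orbits_def FF)
    moreover have "p \<in> Y"
      using p id act by (auto simp: Y_def FF image_iff intro!: bexI[of _ "\<lambda>x. x"])
    ultimately show "p \<in> flag_orbit K V n A" using p by (auto simp: flag_orbit_def)
  qed
qed

lemma finite_flags: "finite (flags K V n)"
  unfolding flags_eq by (rule lat.finite_lflags)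

lemma rel_pos_Theta: "p \<in> flag_pairs K V n \<Longrightarrow> rel_pos K V n p \<in> Theta n dim"
  using rel_pos_eq lat.pos_Theta by (auto simp: flags_eq)

lemma rel_pos_exists:
  assumes "C \<in> Theta n dim"
  shows "\<exists>p\<in>flag_pairs K V n. rel_pos K V n p = C"
  using lat.pos_exists[OF assms] by (auto simp: rel_pos_eq flags_eq[symmetric])

lemma card_rel_pos:
  assumes "F \<in> flags K V n" "F'' \<in> flags K V n"
  shows "int (card {F' \<in> flags K V n. rel_pos K V n (F, F') = A \<and> rel_pos K V n (F', F'') = B}) =
    poly (position_poly n dim A B (rel_pos K V n (F, F''))) (int q)"
proof -
  have "{F' \<in> flags K V n. rel_pos K V n (F, F') = A \<and> rel_pos K V n (F', F'') = B} =
      {F' \<in> lat.lflags n. lat.pos n F F' = A \<and> lat.pos n F' F'' = B}"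
    using assms by (auto simp: rel_pos_eq flags_eq[symmetric])
  then show ?thesis
    using lat.card_pos_pos[of F n F'' A B] assms by (simp add: rel_pos_eq flags_eq[symmetric])
qed

lemma orbit_fun_eq:
  "p \<in> flag_pairs K V n \<Longrightarrow> orbit_fun K V n A p = (if rel_pos K V n p = A then 1 else 0)"
  by (simp add: orbit_fun_def flag_orbit_eq)

text \<open>The convolution of two indicator functions at (F, F'') counts intermediate flags, so
  \<open>card_rel_pos\<close> evaluates it.\<close>

lemma orbit_fun_mult:
  "orbit_fun K V n A \<otimes>\<^bsub>schur_ring K V n\<^esub> orbit_fun K V n B =
    (\<lambda>p\<in>flag_pairs K V n. poly (position_poly n dim A B (rel_pos K V n p)) (int q))"
proof
  fix p
  show "(orbit_fun K V n A \<otimes>\<^bsub>schur_ring K V n\<^esub> orbit_fun K V n B) p =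
    (\<lambda>p\<in>flag_pairs K V n. poly (position_poly n dim A B (rel_pos K V n p)) (int q)) p"
  proof (cases "p \<in> flag_pairs K V n")
    case True
    obtain F F'' where p: "p = (F, F'')" by (cases p)
    then have F: "F \<in> flags K V n" "F'' \<in> flags K V n" using True by auto
    have "(orbit_fun K V n A \<otimes>\<^bsub>schur_ring K V n\<^esub> orbit_fun K V n B) p =
        (\<Sum>F'\<in>flags K V n. orbit_fun K V n A (F, F') * orbit_fun K V n B (F', F''))"
      using F by (simp add: schur_ring_def p)
    also have "\<dots> = (\<Sum>F'\<in>flags K V n.
        if rel_pos K V n (F, F') = A \<and> rel_pos K V n (F', F'') = B then 1 else 0)"
      using F by (intro sum.cong) (auto simp: orbit_fun_eq)
    also have "\<dots> = int (card {F' \<in> flags K V n. rel_pos K V n (F, F') = A \<and> rel_pos K V n (F', F'') = B})"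
      using finite_flags by (simp add: sum.If_cases Int_def)
    finally show ?thesis using card_rel_pos[OF F] True p by simp
  qed (simp add: schur_ring_def)
qed

lemma orbit_fun_sum:
  assumes "p \<in> flag_pairs K V n"
  shows "(\<Sum>C\<in>Theta n dim. h C * orbit_fun K V n C p) = h (rel_pos K V n p)"
proof -
  have "(\<Sum>C\<in>Theta n dim. h C * orbit_fun K V n C p) =
      (\<Sum>C\<in>Theta n dim. if C = rel_pos K V n p then h C else 0)"
    using assms by (intro sum.cong) (auto simp: orbit_fun_eq)
  then show ?thesis using rel_pos_Theta[OF assms] finite_Theta by (simp add: sum.delta)
qed

end

lemma finite_vectorspaceD:
  assumes "finite_vectorspace m K V"
  shows "finite_vectorspace_loc K V" "vectorspace.dim K V = m"
proof -
  have V: "vectorspace K V" "finite (carrier K)" "vectorspace.fin_dim K V" "vectorspace.dim K V = m"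
    using assms by (auto simp: finite_vectorspace_def)
  interpret vectorspace K V by (rule V)
  obtain B where B: "finite B" "basis B" using finite_basis_exists[OF V(3)] by blast
  have "carrier V \<subseteq> (\<lambda>a. lincomb a B) ` (B \<rightarrow>\<^sub>E carrier K)"
  proof
    fix v assume "v \<in> carrier V"
    moreover have "B \<subseteq> carrier V" using B(2) by (simp add: basis_def)
    ultimately obtain a where "a \<in> B \<rightarrow>\<^sub>E carrier K" "lincomb a B = v"
      using basis_criterion[OF B(1)] B(2) by metis
    then show "v \<in> (\<lambda>a. lincomb a B) ` (B \<rightarrow>\<^sub>E carrier K)" by blast
  qed
  then have "finite (carrier V)" by (rule finite_subset) (simp add: finite_PiE B(1) V(2))
  then show "finite_vectorspace_loc K V"
    using V by (simp add: finite_vectorspace_loc_def finite_vectorspace_loc_axioms_def)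
  show "vectorspace.dim K V = m" by (rule V(4))
qed

lemma structure_polys_position_poly: "structure_polys n m (position_poly n m)"
  unfolding structure_polys_def
proof (intro allI impI ballI)
  fix K :: "nat ring" and V :: "(nat, nat) module" and A B
  assume KV: "finite_vectorspace m K V"
  interpret finite_vectorspace_loc K V by (rule finite_vectorspaceD(1)[OF KV])
  show "orbit_fun K V n A \<otimes>\<^bsub>schur_ring K V n\<^esub> orbit_fun K V n B =
      (\<lambda>p\<in>flag_pairs K V n. \<Sum>C\<in>Theta n m. poly (position_poly n m A B C) (int q) * orbit_fun K V n C p)"
    unfolding orbit_fun_mult finite_vectorspaceD(2)[OF KV, symmetric]
    by (intro restrict_ext) (rule orbit_fun_sum[symmetric])
qed

text \<open>The family \<open>position_poly\<close> shows that the choice in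
  \<open>schur_poly\<close> satisfies \<open>structure_polys\<close>. Evaluating the product at a
  pair in position \<open>C\<close> isolates the coefficient at \<open>C\<close> in both
  expansions.\<close>

lemma schur_poly_eval:
  assumes KV: "finite_vectorspace m K V" and "A \<in> Theta n m" "B \<in> Theta n m" "C \<in> Theta n m"
  shows "poly (schur_poly n m A B C) (int (card (carrier K))) =
    poly (position_poly n m A B C) (int (card (carrier K)))"
proof -
  interpret finite_vectorspace_loc K V by (rule finite_vectorspaceD(1)[OF KV])
  have dim: "dim = m" by (rule finite_vectorspaceD(2)[OF KV])
  obtain p where p: "p \<in> flag_pairs K V n" "rel_pos K V n p = C"
    using rel_pos_exists assms dim by metis
  have "structure_polys n m (schur_poly n m)"
    unfolding schur_poly_def by (rule someI[of "structure_polys n m", OF structure_polys_position_poly])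
  then have "orbit_fun K V n A \<otimes>\<^bsub>schur_ring K V n\<^esub> orbit_fun K V n B =
      (\<lambda>p\<in>flag_pairs K V n. \<Sum>C\<in>Theta n m. poly (schur_poly n m A B C) (int q) * orbit_fun K V n C p)"
    using assms by (simp add: structure_polys_def)
  from fun_cong[OF this, of p] show ?thesis
    using p dim orbit_fun_sum[OF p(1), of "\<lambda>C. poly (schur_poly n m A B C) (int q)"]
    by (simp add: orbit_fun_mult)
qed

text \<open>\<open>structure_polys\<close> speaks of carriers inside \<open>nat\<close>, whereas the
  fields constructed later live in an algebraic closure. All operations are carried over along
  injections of the finite carriers into \<open>nat\<close>.\<close>

lemma finite_vectorspace_transport:
  assumes "finite_vectorspace_loc K0 V0"
  shows "\<exists>K V. finite_vectorspace (vectorspace.dim K0 V0) K V \<and> card (carrier K) = card (carrier K0)"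
proof -
  interpret V0: finite_vectorspace_loc K0 V0 by (rule assms)
  obtain f :: "_ \<Rightarrow> nat" where f: "inj_on f (carrier K0)"
    using ex_bij_betw_finite_nat[OF V0.finite_K] by (auto simp: bij_betw_def)
  obtain h :: "_ \<Rightarrow> nat" where h: "inj_on h (carrier V0)"
    using ex_bij_betw_finite_nat[OF V0.finite_V] by (auto simp: bij_betw_def)
  define f' where "f' = the_inv_into (carrier K0) f"
  define h' where "h' = the_inv_into (carrier V0) h"
  have f' [simp]: "f' (f x) = x" if "x \<in> carrier K0" for x
    using that f by (simp add: f'_def the_inv_into_f_f)
  have h' [simp]: "h' (h x) = x" if "x \<in> carrier V0" for x
    using that h by (simp add: h'_def the_inv_into_f_f)
  define K :: "nat ring" where "K = \<lparr>carrier = f ` carrier K0, monoid.mult = \<lambda>a b. f (f' a \<otimes>\<^bsub>K0\<^esub> f' b),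
    one = f \<one>\<^bsub>K0\<^esub>, zero = f \<zero>\<^bsub>K0\<^esub>, add = \<lambda>a b. f (f' a \<oplus>\<^bsub>K0\<^esub> f' b)\<rparr>"
  define V :: "(nat, nat) module" where "V = \<lparr>carrier = h ` carrier V0, monoid.mult = undefined, one = undefined,
    zero = h \<zero>\<^bsub>V0\<^esub>, add = \<lambda>a b. h (h' a \<oplus>\<^bsub>V0\<^esub> h' b), module.smult = \<lambda>a b. h (f' a \<odot>\<^bsub>V0\<^esub> h' b)\<rparr>"
  have "f \<in> ring_iso K0 K"
    using f by (auto simp: ring_iso_def Ring.ring_hom_def K_def bij_betw_def)
  from V0.ring_iso_imp_img_field[OF this] have K: "field K" by (simp add: K_def)
  have "vectorspace K V"
  proof (rule vs_criteria[OF K])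
    show "\<forall>v\<in>carrier V. \<exists>w\<in>carrier V. v \<oplus>\<^bsub>V\<^esub> w = \<zero>\<^bsub>V\<^esub>"
    proof
      fix v assume "v \<in> carrier V"
      then obtain x where x: "x \<in> carrier V0" "v = h x" by (auto simp: V_def)
      then have "v \<oplus>\<^bsub>V\<^esub> h (\<ominus>\<^bsub>V0\<^esub> x) = \<zero>\<^bsub>V\<^esub>" by (simp add: V_def V0.M.r_neg)
      moreover have "h (\<ominus>\<^bsub>V0\<^esub> x) \<in> carrier V" using x by (simp add: V_def)
      ultimately show "\<exists>w\<in>carrier V. v \<oplus>\<^bsub>V\<^esub> w = \<zero>\<^bsub>V\<^esub>" by blast
    qed
  qed (auto simp: K_def V_def V0.M.a_ac V0.smult_assoc1 V0.smult_l_distr V0.smult_r_distr)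
  moreover have "finite (carrier K)" "finite (carrier V)"
    using V0.finite_K V0.finite_V by (simp_all add: K_def V_def)
  ultimately have loc: "finite_vectorspace_loc K V"
    by (simp add: finite_vectorspace_loc_def finite_vectorspace_loc_axioms_def)
  interpret V: finite_vectorspace_loc K V by (rule loc)
  have K_card: "card (carrier K) = card (carrier K0)" using f by (simp add: K_def card_image)
  have "card (carrier V) = card (carrier V0)" using h by (simp add: V_def card_image)
  then have "V.dim = V0.dim" using V.card_eq V0.card_eq V0.q_gt_1 K_card by simp
  then have "finite_vectorspace V0.dim K V"
    using V.fin_dim V.vectorspace_axioms V.finite_K by (simp add: finite_vectorspace_def)
  then show ?thesis using K_card by blast
qed

section \<open>Cyclotomic polynomials\<close>

lemma of_int_poly_mult:
  "map_poly of_int (p * q) = (map_poly of_int p * map_poly of_int q :: 'a::comm_ring_1 poly)"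
  by (simp add: poly_eq_iff coeff_map_poly coeff_mult)

lemma of_int_poly_add:
  "map_poly of_int (p + q) = (map_poly of_int p + map_poly of_int q :: 'a::comm_ring_1 poly)"
  by (simp add: poly_eq_iff coeff_map_poly)

lemma of_int_poly_diff:
  "map_poly of_int (p - q) = (map_poly of_int p - map_poly of_int q :: 'a::comm_ring_1 poly)"
  by (simp add: poly_eq_iff coeff_map_poly)

lemma of_int_poly_1: "map_poly of_int 1 = (1 :: 'a::comm_ring_1 poly)"
  by (simp add: poly_eq_iff coeff_map_poly)

lemma of_int_poly_monom: "map_poly of_int (monom a k) = (monom (of_int a) k :: 'a::comm_ring_1 poly)"
  by (simp add: poly_eq_iff coeff_map_poly)

lemma of_int_poly_prod:
  "map_poly of_int (\<Prod>i\<in>A. p i) = (\<Prod>i\<in>A. map_poly of_int (p i) :: 'a::comm_ring_1 poly)"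
  by (induction A rule: infinite_finite_induct) (simp_all add: of_int_poly_mult of_int_poly_1)

lemma poly_of_int_poly: "poly (map_poly of_int p) (of_int x) = (of_int (poly p x) :: 'a::comm_ring_1)"
  by (induction p) (simp_all add: map_poly_pCons)

lemma inj_of_int_poly:
  "map_poly of_int p = (map_poly of_int q :: 'a::ring_char_0 poly) \<Longrightarrow> p = q"
  by (simp add: poly_eq_iff coeff_map_poly)

lemma degree_of_int_poly: "degree (map_poly of_int p :: 'a::ring_char_0 poly) = degree p"
  by (rule degree_map_poly) simp

lemma monic_division:
  fixes D F :: "'a::comm_ring_1 poly"
  assumes "lead_coeff D = 1"
  obtains Q S where "F = D * Q + S" "S = 0 \<or> degree S < degree D"
proof -
  have "D \<noteq> 0" using assms by auto
  moreover obtain Q S where "pseudo_divmod F D = (Q, S)" by (cases "pseudo_divmod F D")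
  ultimately show ?thesis using pseudo_divmod[of D F Q S] assms that by simp
qed

text \<open>Division by a monic polynomial is possible over the integers. Over the complex numbers
  the remainder is a multiple of \<open>D\<close> of smaller degree, hence 0, so the complex
  quotient \<open>G\<close> already has integer coefficients.\<close>

lemma monic_dvd_of_int_poly:
  assumes D: "lead_coeff D = 1"
    and eq: "map_poly of_int F = (map_poly of_int D * G :: complex poly)"
  obtains Q where "F = D * Q" "map_poly of_int Q = G"
proof -
  obtain Q S where QS: "F = D * Q + S" "S = 0 \<or> degree S < degree D"
    using monic_division[OF D] .
  let ?D = "map_poly of_int D :: complex poly"
  have *: "?D * (G - map_poly of_int Q) = map_poly of_int S"
    using eq by (simp add: QS(1) of_int_poly_mult of_int_poly_add algebra_simps)
  have "?D \<noteq> 0" using inj_of_int_poly[of D 0, where 'a = complex] D by auto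
  have GQ: "G - map_poly of_int Q = 0"
  proof (rule ccontr)
    assume ne: "G - map_poly of_int Q \<noteq> 0"
    then have "degree (?D * (G - map_poly of_int Q)) = degree ?D + degree (G - map_poly of_int Q)"
      using \<open>?D \<noteq> 0\<close> by (rule degree_mult_eq[rotated])
    moreover have "S \<noteq> 0" using * ne \<open>?D \<noteq> 0\<close> by auto
    ultimately show False using QS(2) * by (simp add: degree_of_int_poly)
  qed
  then have "map_poly of_int S = (0 :: complex poly)" using * by simp
  then have "S = 0" using inj_of_int_poly[of S 0] by simp
  then show ?thesis using that[of Q] QS GQ by simp
qed

text \<open>Write \<open>F = D * Q + S\<close>. For large x the value of \<open>S\<close> is smaller
  in absolute value than that of \<open>D\<close>, so divisibility forces it to be 0, and a nonzero
  \<open>S\<close> cannot have arbitrarily large roots.\<close>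

lemma monic_dvd_if_infinitely_often:
  fixes D F :: "int poly" and t :: "nat \<Rightarrow> int"
  assumes D: "lead_coeff D = 1" and t: "\<And>N. \<exists>j. t j \<ge> N" and dvd: "\<And>j. poly D (t j) dvd poly F (t j)"
  shows "D dvd F"
proof -
  obtain Q S where QS: "F = D * Q + S" "S = 0 \<or> degree S < degree D"
    using monic_division[OF D] .
  have "S = 0"
  proof (rule ccontr)
    assume S: "S \<noteq> 0"
    then have deg: "degree S < degree D" using QS by blast
    \<comment> \<open>Comparing squares avoids signs: \<open>D * D - S * S\<close> has leading
      coefficient 1 and is therefore eventually at least 1.\<close>
    define P where "P = - (S * S) + D * D"
    have "degree (S * S) < degree (D * D)"
      using deg S D by (subst (1 2) degree_mult_eq) auto
    then have "lead_coeff P = lead_coeff (D * D)"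
      unfolding P_def by (intro lead_coeff_add_le) simp
    then have "lead_coeff P = 1" using D by (simp add: lead_coeff_mult)
    then have lc: "lead_coeff (map_poly of_int P :: real poly) = 1"
      by (simp add: degree_of_int_poly coeff_map_poly)
    have "\<exists>N. \<forall>x\<ge>N. 1 \<le> poly (map_poly of_int P :: real poly) x"
      using poly_pinfty_gt_lc[of "map_poly of_int P :: real poly"] unfolding lc by simp
    then obtain N where N: "\<And>x. x \<ge> N \<Longrightarrow> poly (map_poly of_int P :: real poly) x \<ge> 1"
      by blast
    have large: "poly S x * poly S x < poly D x * poly D x" if "real_of_int x \<ge> N" for x
    proof -
      have "1 \<le> poly P x" using N[OF that] unfolding poly_of_int_poly by simp
      then show ?thesis by (simp add: P_def)
    qed
    have root: "poly S x = 0" if "real_of_int x \<ge> N" "poly D x dvd poly F x" for x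
    proof (rule ccontr)
      assume ne: "poly S x \<noteq> 0"
      have "poly F x = poly D x * poly Q x + poly S x" by (simp add: QS(1))
      then have "poly D x dvd poly S x" using that(2) by (metis dvd_add_right_iff dvd_triv_left)
      then have "\<bar>poly D x\<bar> \<le> \<bar>poly S x\<bar>" by (rule dvd_imp_le_int[OF ne])
      then have "poly D x * poly D x \<le> poly S x * poly S x"
        by (metis abs_le_square_iff power2_eq_square)
      then show False using large[OF that(1)] by simp
    qed
    have "finite {x. poly S x = 0}" using S by (rule poly_roots_finite)
    then have M: "x \<le> Max {x. poly S x = 0}" if "poly S x = 0" for x
      using that by (intro Max_ge) auto
    obtain j where "t j \<ge> max (Max {x. poly S x = 0} + 1) \<lceil>N\<rceil>" using t by blast
    then have "real_of_int (t j) \<ge> N" "t j > Max {x. poly S x = 0}" by linarith+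
    then show False using root[OF _ dvd, of j] M[of "t j"] by simp
  qed
  then show ?thesis using QS by simp
qed

lemma prod_roots_dvd:
  fixes f :: "'a::idom poly"
  assumes "finite S" "\<And>z. z \<in> S \<Longrightarrow> poly f z = 0"
  shows "(\<Prod>z\<in>S. [:- z, 1:]) dvd f"
  using assms
proof (induction S rule: finite_induct)
  case (insert a S)
  then obtain g where g: "f = (\<Prod>z\<in>S. [:- z, 1:]) * g" by auto
  have "poly (\<Prod>z\<in>S. [:- z, 1:]) a \<noteq> 0" using insert.hyps by (auto simp: poly_prod)
  then have "poly g a = 0" using insert.prems[of a] by (simp add: g)
  then have "[:- a, 1:] dvd g" by (simp add: poly_eq_0_iff_dvd)
  then show ?case
    unfolding g prod.insert[OF insert.hyps(1,2)] by (subst mult.commute) (rule mult_dvd_mono[OF dvd_refl])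
qed simp

section \<open>Roots of unity\<close>

definition primitive_roots :: "nat \<Rightarrow> complex set"
  where "primitive_roots k = {z. z ^ k = 1 \<and> (\<forall>j. 0 < j \<and> j < k \<longrightarrow> z ^ j \<noteq> 1)}"

lemma finite_roots_of_unity: "0 < k \<Longrightarrow> finite {z::complex. z ^ k = 1}"
  using card_roots_unity_eq[of k] by (metis card.infinite less_irrefl)

lemma finite_primitive_roots: "0 < k \<Longrightarrow> finite (primitive_roots k)"
  by (rule finite_subset[OF _ finite_roots_of_unity]) (auto simp: primitive_roots_def)

lemma primitive_roots_power_eq_1:
  assumes z: "z \<in> primitive_roots k" and k: "0 < k"
  shows "z ^ e = 1 \<longleftrightarrow> k dvd e"
proof
  assume "z ^ e = 1"
  have "z ^ e = z ^ (k * (e div k)) * z ^ (e mod k)" by (simp flip: power_add)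
  also have "z ^ (k * (e div k)) = 1" using z by (simp add: power_mult primitive_roots_def)
  finally have "z ^ (e mod k) = 1" using \<open>z ^ e = 1\<close> by simp
  then have "e mod k = 0" using z k by (auto simp: primitive_roots_def)
  then show "k dvd e" by auto
qed (use z in \<open>auto simp: primitive_roots_def power_mult elim!: dvdE\<close>)

lemma roots_of_unity_Union:
  assumes "0 < k"
  shows "{z::complex. z ^ k = 1} = (\<Union>d\<in>{d. d dvd k}. primitive_roots d)"
proof
  show "{z::complex. z ^ k = 1} \<subseteq> (\<Union>d\<in>{d. d dvd k}. primitive_roots d)"
  proof
    fix z :: complex assume "z \<in> {z. z ^ k = 1}"
    then have ex: "\<exists>d. 0 < d \<and> z ^ d = 1" using assms by auto
    define d where "d = (LEAST d. 0 < d \<and> z ^ d = 1)"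
    have d: "0 < d" "z ^ d = 1" using LeastI_ex[OF ex] by (auto simp: d_def)
    have "z ^ j \<noteq> 1" if "0 < j" "j < d" for j using not_less_Least[of j] that by (auto simp: d_def)
    then have z: "z \<in> primitive_roots d" using d by (auto simp: primitive_roots_def)
    then show "z \<in> (\<Union>d\<in>{d. d dvd k}. primitive_roots d)"
      using primitive_roots_power_eq_1[OF z d(1), of k] \<open>z \<in> {z. z ^ k = 1}\<close> by auto
  qed
  show "(\<Union>d\<in>{d. d dvd k}. primitive_roots d) \<subseteq> {z::complex. z ^ k = 1}"
    by (auto simp: primitive_roots_def power_mult elim!: dvdE)
qed

lemma primitive_roots_disjoint:
  "0 < d \<Longrightarrow> 0 < e \<Longrightarrow> d \<noteq> e \<Longrightarrow> primitive_roots d \<inter> primitive_roots e = {}"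
  using primitive_roots_power_eq_1 by (metis disjoint_iff dvd_antisym dvd_refl)

lemma lead_coeff_linear_prod: "lead_coeff (\<Prod>z\<in>S. [:- z, 1::'a::idom:]) = 1"
  by (simp add: lead_coeff_prod)

lemma degree_linear_prod: "degree (\<Prod>z\<in>S. [:- z, 1::'a::idom:]) = card S"
  by (subst degree_prod_eq_sum_degree) auto

lemma degree_monom_minus_1: "0 < k \<Longrightarrow> degree (monom 1 k - 1 :: 'a::comm_ring_1 poly) = k"
  using degree_add_eq_left[of "- 1" "monom 1 k :: 'a poly"] by (simp add: degree_monom_eq)

lemma lead_coeff_monom_minus_1: "0 < k \<Longrightarrow> lead_coeff (monom 1 k - 1 :: 'a::comm_ring_1 poly) = 1"
  by (simp add: degree_monom_minus_1)

text \<open>The product of the linear factors divides the left side; it has the same degree because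
  there are \<open>k\<close> roots of unity, and both sides are monic.\<close>

lemma monom_minus_1_eq_prod:
  assumes "0 < k"
  shows "monom 1 k - 1 = (\<Prod>z | z ^ k = 1. [:- z, 1::complex:])"
proof -
  let ?P = "\<Prod>z | z ^ k = 1. [:- z, 1::complex:]"
  have "?P dvd monom 1 k - 1"
    by (rule prod_roots_dvd[OF finite_roots_of_unity[OF assms]]) (simp add: poly_monom)
  then obtain g where g: "monom 1 k - 1 = ?P * g" unfolding dvd_def by blast
  have "monom 1 k - 1 \<noteq> (0 :: complex poly)"
    using degree_monom_minus_1[OF assms, where 'a = complex] assms by (metis degree_0 less_irrefl)
  then have nz: "?P \<noteq> 0" "g \<noteq> 0" unfolding g by simp_all
  have "k = k + degree g"
    using degree_mult_eq[OF nz] degree_monom_minus_1[OF assms, where 'a = complex]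
    unfolding g degree_linear_prod card_roots_unity_eq[OF assms] by simp
  moreover have "lead_coeff g = 1"
    using lead_coeff_monom_minus_1[OF assms, where 'a = complex]
    unfolding g lead_coeff_mult lead_coeff_linear_prod by simp
  ultimately have "degree g = 0" "coeff g 0 = 1" by simp_all
  then have "g = 1" by (metis degree_eq_zeroE coeff_pCons_0 one_pCons)
  then show ?thesis using g by simp
qed

text \<open>The roots of \<open>X^k - 1\<close> are sorted by their exact order. By induction the
  factors of the proper divisors of \<open>k\<close> have an integral monic product, and the
  remaining factor is an exact quotient by it. This is the existence behind the \<open>THE\<close>
  in \<open>cyclotomic\<close>.\<close>

lemma cyclotomic_integral:
  assumes "0 < k"
  shows "\<exists>p. map_poly of_int p = (\<Prod>z\<in>primitive_roots k. [:- z, 1:])"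
  using assms
proof (induction k rule: less_induct)
  case (less k)
  let ?C = "\<lambda>d. \<Prod>z\<in>primitive_roots d. [:- z, 1:]"
  define E where "E = {d. d dvd k \<and> d \<noteq> k}"
  have E: "finite E" "\<And>d. d \<in> E \<Longrightarrow> 0 < d" "\<And>d. d \<in> E \<Longrightarrow> d < k" "{d. d dvd k} = insert k E" "k \<notin> E"
    using less.prems by (auto simp: E_def dvd_pos_nat dest: dvd_imp_le intro: le_neq_implies_less)
  have "\<exists>c. \<forall>d\<in>E. map_poly of_int (c d) = ?C d"
    using less.IH E by (intro bchoice) auto
  then obtain c where c: "\<And>d. d \<in> E \<Longrightarrow> map_poly of_int (c d) = ?C d" by blast
  define D where "D = (\<Prod>d\<in>E. c d)"
  have D: "map_poly of_int D = (\<Prod>d\<in>E. ?C d)" by (simp add: D_def of_int_poly_prod c)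
  then have "lead_coeff (map_poly of_int D :: complex poly) = 1"
    by (simp only: lead_coeff_prod lead_coeff_linear_prod) simp
  then have "of_int (lead_coeff D) = (1 :: complex)"
    by (simp add: degree_of_int_poly coeff_map_poly)
  then have lc: "lead_coeff D = 1" by simp
  have "(\<Prod>z | z ^ k = 1. [:- z, 1::complex:]) = (\<Prod>d\<in>insert k E. ?C d)"
    unfolding roots_of_unity_Union[OF less.prems] E(4)
    using E less.prems finite_primitive_roots primitive_roots_disjoint
    by (intro prod.UNION_disjoint) auto
  then have "map_poly of_int (monom 1 k - 1) = map_poly of_int D * ?C k"
    using monom_minus_1_eq_prod[OF less.prems] E
    by (simp add: of_int_poly_diff of_int_poly_monom of_int_poly_1 D mult.commute)
  then show ?case by (elim monic_dvd_of_int_poly[OF lc]) blast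
qed

lemma cyclotomic_eq:
  assumes "0 < k"
  shows "map_poly of_int (cyclotomic k) = (\<Prod>z\<in>primitive_roots k. [:- z, 1:])"
proof -
  obtain p where p: "map_poly of_int p = (\<Prod>z\<in>primitive_roots k. [:- z, 1:])"
    using cyclotomic_integral[OF assms] by blast
  then have "cyclotomic k = p"
    unfolding cyclotomic_def primitive_roots_def[symmetric]
    by (intro the_equality) (auto intro: inj_of_int_poly[where 'a = complex])
  then show ?thesis using p by simp
qed

lemma lead_coeff_cyclotomic: "0 < k \<Longrightarrow> lead_coeff (cyclotomic k) = 1"
  using lead_coeff_linear_prod[of "primitive_roots k"] degree_of_int_poly[of "cyclotomic k", where 'a = complex]
  by (simp add: cyclotomic_eq[symmetric] coeff_map_poly)

text \<open>The primitive \<open>k\<close>-th roots of unity and the \<open>e\<close>-th roots of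
  unity are disjoint sets of roots of \<open>X^k - 1\<close>, because \<open>e < k\<close>.\<close>

lemma cyclotomic_mult_dvd:
  assumes "0 < e" "e dvd k" "e < k"
  shows "cyclotomic k * (monom 1 e - 1) dvd monom 1 k - 1"
proof -
  have k: "0 < k" using assms by simp
  let ?E = "{z::complex. z ^ e = 1}"
  have disj: "primitive_roots k \<inter> ?E = {}"
    using primitive_roots_power_eq_1[OF _ k] assms by (auto dest: dvd_imp_le)
  have fin: "finite (primitive_roots k)" "finite ?E"
    using finite_primitive_roots[OF k] finite_roots_of_unity assms by auto
  have "(\<Prod>z\<in>primitive_roots k \<union> ?E. [:- z, 1:]) dvd monom 1 k - 1"
    by (rule prod_roots_dvd)
      (use fin assms in \<open>auto simp: poly_monom primitive_roots_def power_mult elim!: dvdE\<close>)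
  then obtain G where "monom 1 k - 1 = (\<Prod>z\<in>primitive_roots k \<union> ?E. [:- z, 1:]) * G" unfolding dvd_def by blast
  then have eq: "map_poly of_int (monom 1 k - 1) =
      map_poly of_int (cyclotomic k * (monom 1 e - 1)) * G"
    using fin disj monom_minus_1_eq_prod[OF assms(1)]
    by (simp add: prod.union_disjoint of_int_poly_mult of_int_poly_diff of_int_poly_monom of_int_poly_1
        cyclotomic_eq[OF k])
  have "lead_coeff (cyclotomic k * (monom 1 e - 1)) = 1"
    by (simp only: lead_coeff_mult lead_coeff_cyclotomic[OF k] lead_coeff_monom_minus_1[OF assms(1)])
  from monic_dvd_of_int_poly[OF this eq] show ?thesis by (metis dvd_triv_left)
qed

section \<open>Finite fields of characteristic two\<close>

text \<open>Subfields are sets in one type, so that a field extension, and the stabiliser field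
  between its two members, are expressed by inclusion. The clause for inverses includes 0, whose
  \<open>inverse\<close> is 0.\<close>

definition is_subfield :: "'a::field set \<Rightarrow> bool"
  where "is_subfield D \<longleftrightarrow> 0 \<in> D \<and> 1 \<in> D \<and>
    (\<forall>x\<in>D. \<forall>y\<in>D. x + y \<in> D \<and> x * y \<in> D \<and> - x \<in> D \<and> inverse x \<in> D)"

lemma is_subfieldD:
  assumes "is_subfield D"
  shows "0 \<in> D" "1 \<in> D" "x \<in> D \<Longrightarrow> y \<in> D \<Longrightarrow> x + y \<in> D" "x \<in> D \<Longrightarrow> y \<in> D \<Longrightarrow> x * y \<in> D"
    "x \<in> D \<Longrightarrow> - x \<in> D" "x \<in> D \<Longrightarrow> inverse x \<in> D"
  using assms by (auto simp: is_subfield_def)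

definition field_of :: "'a::field set \<Rightarrow> 'a ring"
  where "field_of D = \<lparr>carrier = D, monoid.mult = (*), one = 1, zero = 0, add = (+)\<rparr>"

text \<open>The space \<open>E^r\<close>, as functions vanishing from \<open>r\<close> on. The
  record does not fix the scalars, so the same vectors form a space over each subfield of
  \<open>E\<close>, and flags over different fields are compared as sets.\<close>

definition power_space :: "nat \<Rightarrow> 'a::field set \<Rightarrow> ('a, nat \<Rightarrow> 'a) module"
  where "power_space r E = \<lparr>carrier = {f. (\<forall>i. f i \<in> E) \<and> (\<forall>i\<ge>r. f i = 0)}, monoid.mult = undefined,
    one = undefined, zero = \<lambda>_. 0, add = \<lambda>f g i. f i + g i, module.smult = \<lambda>a f i. a * f i\<rparr>"

lemma field_field_of:
  assumes "is_subfield D"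
  shows "field (field_of D)"
proof (rule cring.cring_fieldI)
  note [simp] = is_subfieldD[OF assms]
  show R: "cring (field_of D)"
  proof (rule cringI)
    show "abelian_group (field_of D)"
    proof (rule abelian_groupI)
      fix x assume "x \<in> carrier (field_of D)"
      then show "\<exists>y\<in>carrier (field_of D). y \<oplus>\<^bsub>field_of D\<^esub> x = \<zero>\<^bsub>field_of D\<^esub>"
        by (intro bexI[of _ "- x"]) (simp_all add: field_of_def)
    qed (simp_all add: field_of_def algebra_simps)
    show "Group.comm_monoid (field_of D)"
      by (rule comm_monoidI) (simp_all add: field_of_def)
  qed (simp add: field_of_def algebra_simps)
  interpret cring "field_of D" by (rule R)
  show "Units (field_of D) = carrier (field_of D) - {\<zero>\<^bsub>field_of D\<^esub>}"
  proof
    show "Units (field_of D) \<subseteq> carrier (field_of D) - {\<zero>\<^bsub>field_of D\<^esub>}"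
      by (auto simp: field_of_def Units_def)
    show "carrier (field_of D) - {\<zero>\<^bsub>field_of D\<^esub>} \<subseteq> Units (field_of D)"
    proof
      fix x assume "x \<in> carrier (field_of D) - {\<zero>\<^bsub>field_of D\<^esub>}"
      then show "x \<in> Units (field_of D)"
        by (simp add: field_of_def Units_def) (metis is_subfieldD(6)[OF assms] left_inverse right_inverse)
    qed
  qed
qed

lemma power_space_simps [simp]:
  "f \<in> carrier (power_space r E) \<longleftrightarrow> (\<forall>i. f i \<in> E) \<and> (\<forall>i\<ge>r. f i = 0)"
  "\<zero>\<^bsub>power_space r E\<^esub> = (\<lambda>_. 0)"
  "f \<oplus>\<^bsub>power_space r E\<^esub> g = (\<lambda>i. f i + g i)"
  "a \<odot>\<^bsub>power_space r E\<^esub> f = (\<lambda>i. a * f i)"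
  by (simp_all add: power_space_def)

lemma field_of_simps [simp]:
  "carrier (field_of D) = D" "\<zero>\<^bsub>field_of D\<^esub> = 0" "\<one>\<^bsub>field_of D\<^esub> = 1"
  "x \<oplus>\<^bsub>field_of D\<^esub> y = x + y" "x \<otimes>\<^bsub>field_of D\<^esub> y = x * y"
  by (simp_all add: field_of_def)

lemma vectorspace_power_space:
  assumes D: "is_subfield D" and E: "is_subfield E" and sub: "D \<subseteq> E"
  shows "vectorspace (field_of D) (power_space r E)"
proof (rule vs_criteria[OF field_field_of[OF D]])
  note [simp] = is_subfieldD[OF E] subsetD[OF sub]
  let ?V = "power_space r E"
  show "\<forall>v\<in>carrier ?V. \<exists>w\<in>carrier ?V. v \<oplus>\<^bsub>?V\<^esub> w = \<zero>\<^bsub>?V\<^esub>"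
  proof
    fix v assume "v \<in> carrier ?V"
    then show "\<exists>w\<in>carrier ?V. v \<oplus>\<^bsub>?V\<^esub> w = \<zero>\<^bsub>?V\<^esub>"
      by (intro bexI[of _ "\<lambda>i. - v i"]) simp_all
  qed
qed (simp_all add: is_subfieldD[OF E] subsetD[OF sub] algebra_simps)

lemma power_space_carrier:
  assumes "0 \<in> E"
  shows "bij_betw (\<lambda>f. restrict f {..<r}) (carrier (power_space r E)) ({..<r} \<rightarrow>\<^sub>E E)"
proof (rule bij_betw_byWitness[where f' = "\<lambda>f i. if i < r then f i else 0"])
qed (use assms in \<open>auto simp: power_space_def fun_eq_iff not_less PiE_def extensional_def\<close>)

lemma card_power_space: "0 \<in> E \<Longrightarrow> card (carrier (power_space r E)) = card E ^ r"
  using bij_betw_same_card[OF power_space_carrier, of E r] by (simp add: card_PiE)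

text \<open>For \<open>r = 1\<close> the second claim says that the order of a finite field is a
  power of the order of each of its subfields.\<close>

lemma power_space_loc:
  assumes "is_subfield D" "is_subfield E" "D \<subseteq> E" and fin: "finite E"
  shows "finite_vectorspace_loc (field_of D) (power_space r E)"
    "card D ^ vectorspace.dim (field_of D) (power_space r E) = card E ^ r"
proof -
  have 0: "0 \<in> E" using assms(2) by (simp add: is_subfield_def)
  have "finite (carrier (power_space r E))"
    using bij_betw_finite[OF power_space_carrier[OF 0]] fin by (simp add: finite_PiE)
  then show loc: "finite_vectorspace_loc (field_of D) (power_space r E)"
    using vectorspace_power_space[OF assms(1-3)] finite_subset[OF assms(3) fin]
    by (simp add: finite_vectorspace_loc_def finite_vectorspace_loc_axioms_def field_of_def)
  show "card D ^ vectorspace.dim (field_of D) (power_space r E) = card E ^ r"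
    using finite_vectorspace_loc.card_eq[OF loc] card_power_space[OF 0] by (simp add: field_of_def)
qed

lemma card_subfield_gt_1: "is_subfield D \<Longrightarrow> finite D \<Longrightarrow> 1 < card D"
  using card_mono[of D "{0, 1}"] by (auto simp: is_subfield_def)

lemma power_space_dim:
  assumes "is_subfield E" "finite E"
  shows "vectorspace.dim (field_of E) (power_space r E) = r"
  using power_space_loc(2)[OF assms(1,1) order_refl assms(2), of r] card_subfield_gt_1[OF assms] by simp

section \<open>The field with 2^k elements\<close>

lemma poly_pderiv_double_root:
  fixes x :: "'a::idom"
  shows "poly (pderiv ([:- x, 1:] * ([:- x, 1:] * g))) x = 0"
  by (subst pderiv_mult) simp

lemma char_2_add_self: "x + x = (0 :: bit alg_closure)"
proof -
  have "(1 + 1 :: bit alg_closure) = to_ac (1 + 1)" by (simp only: to_ac_add to_ac_1)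
  then have "(1 + 1 :: bit alg_closure) = 0" by simp
  then have "x * (1 + 1) = 0" by simp
  then show ?thesis by (simp add: algebra_simps)
qed

lemma char_2_uminus: "- x = (x :: bit alg_closure)"
  using char_2_add_self[of x] by (metis add_eq_0_iff)

lemma frobenius_add: "(x + y) ^ (2 ^ k) = x ^ (2 ^ k) + (y ^ (2 ^ k) :: bit alg_closure)"
proof (induction k)
  case (Suc k)
  have sq: "(a + b)\<^sup>2 = a\<^sup>2 + b\<^sup>2" for a b :: "bit alg_closure"
  proof -
    have "(a + b)\<^sup>2 = a\<^sup>2 + b\<^sup>2 + (a * b + a * b)" by (simp add: power2_eq_square algebra_simps)
    then show ?thesis by (simp add: char_2_add_self)
  qed
  have "z ^ (2 ^ Suc k) = (z ^ (2 ^ k))\<^sup>2" for z :: "bit alg_closure"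
    by (simp add: power_mult[symmetric] mult.commute)
  then show ?case using Suc sq by simp
qed simp

text \<open>Identities between integer polynomials can be tested on the powers of any fixed prime; the
  prime 2 is convenient since \<open>bit alg_closure\<close> contains all fields of characteristic 2.\<close>

definition gf2 :: "nat \<Rightarrow> bit alg_closure set"
  where "gf2 k = {x. x ^ (2 ^ k) = x}"

lemma is_subfield_gf2: "is_subfield (gf2 k)"
  by (auto simp: is_subfield_def gf2_def frobenius_add power_mult_distrib char_2_uminus power_inverse)

text \<open>The polynomial \<open>X^(2^k) - X\<close> splits over the algebraic closure, and its
  derivative is the constant -1, so no root is repeated and their number is the degree.\<close>

lemma card_gf2:
  assumes "0 < k"
  shows "card (gf2 k) = 2 ^ k" "finite (gf2 k)"
proof -
  define p where "p = (monom 1 (2 ^ k) - monom 1 1 :: bit alg_closure poly)"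
  have k: "(1::nat) < 2 ^ k" using one_less_power[of "2::nat" k] assms by simp
  then have deg: "degree p = 2 ^ k"
    unfolding p_def using degree_add_eq_left[of "- monom 1 1" "monom (1::bit alg_closure) (2 ^ k)"]
    by (simp add: degree_monom_eq)
  have roots: "poly p x = 0 \<longleftrightarrow> x \<in> gf2 k" for x by (simp add: p_def gf2_def poly_monom)
  have two: "(of_nat 2 :: bit alg_closure) = 0"
    unfolding numeral_2_eq_2 of_nat_Suc of_nat_0 add_0_right by (rule char_2_add_self)
  have zero: "of_nat (2 ^ k) = (0 :: bit alg_closure)"
    unfolding of_nat_power two by (rule zero_power[OF assms])
  have deriv: "poly (pderiv p) x = - 1" for x
    unfolding p_def pderiv_diff pderiv_monom zero by simp
  have "p \<noteq> 0" using deg k by auto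
  then obtain A where A: "size A = degree p" "p = Polynomial.smult (lead_coeff p) (\<Prod>x\<in>#A. [:- x, 1:])"
    using alg_closed_imp_factorization by blast
  have "count A x \<le> 1" for x
  proof (rule ccontr)
    assume "\<not> count A x \<le> 1"
    then have "x \<in># A" "x \<in># A - {#x#}" by (simp_all flip: count_greater_zero_iff)
    then obtain B where "A = add_mset x (add_mset x B)" by (metis insert_DiffM)
    then have "p = [:- x, 1:] * ([:- x, 1:] * Polynomial.smult (lead_coeff p) (\<Prod>x\<in>#B. [:- x, 1:]))"
      using A(2) by (simp only: image_mset_add_mset prod_mset.add_mset mult_smult_right)
    then have "poly (pderiv p) x = 0"
      by (metis (no_types, lifting) poly_pderiv_double_root)
    then show False using deriv[of x] by simp
  qed
  then have "count A x = (if x \<in># A then 1 else 0)" for x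
    by (metis count_eq_zero_iff count_greater_eq_one_iff le_antisym)
  then have "A = mset_set (set_mset A)" by (intro multiset_eqI) simp
  then have "size A = card (set_mset A)" by (metis size_mset_set)
  moreover have "set_mset A = gf2 k"
  proof -
    have "poly p x = lead_coeff p * (\<Prod>y\<in>#A. x - y)" for x
      by (subst A(2)) (simp add: poly_prod_mset image_mset.compositionality o_def)
    then have "poly p x = 0 \<longleftrightarrow> x \<in># A" for x using \<open>p \<noteq> 0\<close> by auto
    then show ?thesis using roots by auto
  qed
  ultimately show "card (gf2 k) = 2 ^ k" "finite (gf2 k)" using A(1) deg by (auto dest: sym)
qed

lemma gf2_mono: "gf2 a \<subseteq> gf2 (a * b)"
proof
  fix x assume x: "x \<in> gf2 a"
  have "x ^ (2 ^ (a * b)) = x"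
  proof (induction b)
    case (Suc b)
    have "x ^ (2 ^ (a * Suc b)) = (x ^ (2 ^ (a * b))) ^ (2 ^ a)"
      by (simp add: power_add power_mult[symmetric] mult.commute)
    then show ?case using Suc x by (simp add: gf2_def)
  qed simp
  then show "x \<in> gf2 (a * b)" by (simp add: gf2_def)
qed

text \<open>Both polynomials agree at the orders of the fields \<open>gf2 (Suc k)\<close>, which are
  infinitely many integers. From here on the chosen constants are counts of flags.\<close>

lemma schur_poly_eq:
  assumes "A \<in> Theta n m" "B \<in> Theta n m" "C \<in> Theta n m"
  shows "schur_poly n m A B C = position_poly n m A B C"
proof (rule ccontr)
  assume "\<not> ?thesis"
  then have ne: "schur_poly n m A B C - position_poly n m A B C \<noteq> 0" by simp
  have root: "poly (schur_poly n m A B C - position_poly n m A B C) (2 ^ Suc k) = 0" for k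
  proof -
    note F = is_subfield_gf2[of "Suc k"] card_gf2[of "Suc k"]
    obtain K V where KV: "finite_vectorspace m K V" "card (carrier K) = card (gf2 (Suc k))"
      using finite_vectorspace_transport[OF power_space_loc(1)[OF F(1,1) order_refl F(3), of m]]
        power_space_dim[OF F(1,3)] by (auto simp: field_of_def)
    then show ?thesis
      using schur_poly_eval[OF KV(1) assms] F(2) by simp
  qed
  have "inj (\<lambda>k. 2 ^ Suc k :: int)" by (auto simp: inj_def)
  then have "infinite (range (\<lambda>k. 2 ^ Suc k :: int))" by (simp add: range_inj_infinite)
  moreover have "range (\<lambda>k. 2 ^ Suc k :: int) \<subseteq> {x. poly (schur_poly n m A B C - position_poly n m A B C) x = 0}"
    using root by blast
  ultimately show False using poly_roots_finite[OF ne] finite_subset by blast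
qed

section \<open>Flags over a field extension\<close>

text \<open>The degree of the extension is expressed by cardinalities,
  \<open>card E = card D ^ l\<close>, in keeping with the computation of dimensions by
  counting.\<close>

locale field_tower =
  fixes D E :: "'a::field set" and l r n :: nat
  assumes D: "is_subfield D" and E: "is_subfield E" and D_le: "D \<subseteq> E" and finite_E: "finite E"
    and card_E: "card E = card D ^ l"
begin

abbreviation V :: "('a, nat \<Rightarrow> 'a) module" where "V \<equiv> power_space r E"

sublocale DV: finite_vectorspace_loc "field_of D" "power_space r E"
  by (rule power_space_loc(1)[OF D E D_le finite_E])

sublocale EV: finite_vectorspace_loc "field_of E" "power_space r E"
  by (rule power_space_loc(1)[OF E E order_refl finite_E])

lemma card_D: "1 < card D"
  by (rule card_subfield_gt_1[OF D finite_subset[OF D_le finite_E]])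

lemma D_dim: "DV.dim = l * r"
proof -
  have "card D ^ DV.dim = card D ^ (l * r)"
    using power_space_loc(2)[OF D E D_le finite_E, of r] by (simp add: card_E power_mult)
  then show ?thesis using card_D by (simp only: power_inject_exp)
qed

lemma E_dim: "EV.dim = r"
  by (rule power_space_dim[OF E finite_E])

lemma subspace_E_D: 
  assumes "subspace (field_of E) W V"
  shows "subspace (field_of D) W V"
proof (rule DV.subspaceI)
  note W = EV.subspaceD[OF assms]
  show "W \<subseteq> carrier V" "\<zero>\<^bsub>V\<^esub> \<in> W" using W(1,2) by simp_all
  show "x \<oplus>\<^bsub>V\<^esub> y \<in> W" if "x \<in> W" "y \<in> W" for x y using W(3) that by simp
  show "k \<odot>\<^bsub>V\<^esub> x \<in> W" if "k \<in> carrier (field_of D)" "x \<in> W" for k x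
    using W(4)[of k x] that D_le by (simp add: subset_iff)
qed

lemma rk_E_D:
  assumes "subspace (field_of E) W V"
  shows "DV.rk W = l * EV.rk W"
  by (rule DV.rk_eqI[OF subspace_E_D[OF assms]])
    (use EV.card_subspace[OF assms] in \<open>simp add: card_E power_mult\<close>)

lemma flags_E_D: "F \<in> flags (field_of E) V n \<Longrightarrow> F \<in> flags (field_of D) V n"
  by (simp add: flags_def subspace_E_D)

text \<open>The rank over \<open>D\<close> of a subspace over \<open>E\<close> is \<open>l\<close>
  times its rank over \<open>E\<close>, and the formula of \<open>pos_eq\<close> is linear in the
  ranks.\<close>

lemma rel_pos_E_D:
  assumes F: "F \<in> flags (field_of E) V n" and F': "F' \<in> flags (field_of E) V n"
  shows "rel_pos (field_of D) V n (F, F') i j = l * rel_pos (field_of E) V n (F, F') i j"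
proof (cases "i \<in> {1..n} \<and> j \<in> {1..n}")
  case True
  then have ij: "i \<le> n" "j \<le> n" "i - 1 \<le> n" "j - 1 \<le> n" by auto
  have rk: "DV.rk (F i \<inter> F' j) = l * EV.rk (F i \<inter> F' j)" if "i \<le> n" "j \<le> n" for i j
    by (rule rk_E_D, rule EV.subspace_Int) (use F F' that in \<open>simp_all add: flags_def\<close>)
  note 1 = DV.lat.pos_eq[OF flags_E_D[OF F, unfolded DV.flags_eq] flags_E_D[OF F', unfolded DV.flags_eq]
    conjunct1[OF True] conjunct2[OF True]]
  note 2 = EV.lat.pos_eq[OF F[unfolded EV.flags_eq] F'[unfolded EV.flags_eq]
    conjunct1[OF True] conjunct2[OF True]]
  have "DV.lat.pos n F F' i j = l * EV.lat.pos n F F' i j"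
    using 1 arg_cong[OF 2, of "\<lambda>x. l * x"]
    unfolding rk[OF ij(1,2)] rk[OF ij(3,2)] rk[OF ij(1,4)] rk[OF ij(3,4)] distrib_left by linarith
  then show ?thesis
    by (simp only: DV.rel_pos_eq[OF flags_E_D[OF F] flags_E_D[OF F']] EV.rel_pos_eq[OF F F'])
qed (auto simp: rel_pos_def)

section \<open>The action of the units of the larger field on flags\<close>

definition scal :: "'a \<Rightarrow> (nat \<Rightarrow> 'a) \<Rightarrow> nat \<Rightarrow> 'a"
  where "scal u f = (\<lambda>i. u * f i)"

lemma scal_scal: "scal u (scal v f) = scal (u * v) f"
  by (simp add: scal_def mult.assoc)

lemma scal_1: "scal 1 f = f"
  by (simp add: scal_def)

lemma scal_inverse: "u \<noteq> 0 \<Longrightarrow> scal (inverse u) (scal u f) = f" "u \<noteq> 0 \<Longrightarrow> scal u (scal (inverse u) f) = f"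
  by (simp_all add: scal_scal scal_1)

lemma inj_scal: "u \<noteq> 0 \<Longrightarrow> inj_on (scal u) A"
  by (rule inj_on_inverseI[of _ "scal (inverse u)"]) (simp add: scal_inverse)

lemma scal_closed: "u \<in> E \<Longrightarrow> f \<in> carrier V \<Longrightarrow> scal u f \<in> carrier V"
  by (simp add: scal_def is_subfieldD[OF E])

lemma scal_GL:
  assumes "u \<in> E" "u \<noteq> 0"
  shows "scal u \<in> GL (field_of D) V"
proof -
  have "scal u ` carrier V \<subseteq> carrier V" using scal_closed[OF assms(1)] by blast
  then have "scal u ` carrier V = carrier V"
    by (rule endo_inj_surj[OF EV.finite_V _ inj_scal[OF assms(2)]])
  moreover have "scal u \<in> LinearCombinations.module_hom (field_of D) V V"
    using scal_closed[OF assms(1)]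
    by (auto simp: LinearCombinations.module_hom_def scal_def algebra_simps simp del: power_space_simps(1))
  ultimately show ?thesis by (simp add: GL_def bij_betw_def inj_scal[OF assms(2)])
qed

definition act :: "'a \<Rightarrow> (nat \<Rightarrow> (nat \<Rightarrow> 'a) set) \<Rightarrow> nat \<Rightarrow> (nat \<Rightarrow> 'a) set"
  where "act u F = act_flag n (scal u) F"

lemma act_act: "act u (act v F) = act (u * v) F"
  by (simp add: act_def act_flag_def image_image scal_scal fun_eq_iff)

lemma act_1: "F \<in> flags (field_of D) V n \<Longrightarrow> act 1 F = F"
  by (auto simp: act_def act_flag_def scal_1 flags_def extensional_def fun_eq_iff)

lemma act_flags: "u \<in> E \<Longrightarrow> u \<noteq> 0 \<Longrightarrow> F \<in> flags (field_of D) V n \<Longrightarrow> act u F \<in> flags (field_of D) V n"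
  unfolding act_def by (rule DV.act_flag_flags[OF scal_GL])

text \<open>Containment, in place of equality of images, lets 0 belong to the set. For nonzero
  \<open>u\<close> the two conditions agree, since the subspaces are finite.\<close>

definition stab :: "(nat \<Rightarrow> (nat \<Rightarrow> 'a) set) \<Rightarrow> 'a set"
  where "stab F = {u\<in>E. \<forall>i\<le>n. \<forall>x\<in>F i. scal u x \<in> F i}"

context
  fixes F assumes F: "F \<in> flags (field_of D) V n"
begin

lemma flag_subspace: "i \<le> n \<Longrightarrow> subspace (field_of D) (F i) V"
  using F by (simp add: flags_def)

lemma scal_stab_image:
  assumes "u \<in> stab F" "u \<noteq> 0" "i \<le> n"
  shows "scal u ` F i = F i"
proof (rule endo_inj_surj)
  show "finite (F i)" by (rule DV.subspace_finite[OF flag_subspace[OF assms(3)]])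
  show "scal u ` F i \<subseteq> F i" using assms by (auto simp: stab_def)
qed (rule inj_scal[OF assms(2)])

lemma D_le_stab: "D \<subseteq> stab F"
proof
  fix u assume u: "u \<in> D"
  have "scal u x \<in> F i" if "i \<le> n" "x \<in> F i" for i x
    using DV.subspaceD(4)[OF flag_subspace[OF that(1)], of u x] u that by (simp add: scal_def)
  then show "u \<in> stab F" using u D_le by (auto simp: stab_def)
qed

lemma stab_mult: "u \<in> stab F \<Longrightarrow> v \<in> stab F \<Longrightarrow> u * v \<in> stab F"
  by (simp add: stab_def is_subfieldD[OF E] flip: scal_scal)

lemma is_subfield_stab: "is_subfield (stab F)"
  unfolding is_subfield_def
proof (intro conjI ballI)
  show "0 \<in> stab F" "1 \<in> stab F" using D_le_stab is_subfieldD(1,2)[OF D] by auto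
  fix u v assume u: "u \<in> stab F" and v: "v \<in> stab F"
  show "u * v \<in> stab F" by (rule stab_mult[OF u v])
  have "- 1 \<in> stab F" using D_le_stab is_subfieldD(5)[OF D is_subfieldD(2)[OF D]] by blast
  from stab_mult[OF this u] show "- u \<in> stab F" by simp
  have "scal (u + v) x \<in> F i" if "i \<le> n" "x \<in> F i" for i x
  proof -
    have "scal u x \<in> F i" "scal v x \<in> F i" using u v that by (simp_all add: stab_def)
    then have "scal u x \<oplus>\<^bsub>V\<^esub> scal v x \<in> F i"
      by (rule DV.subspaceD(3)[OF flag_subspace[OF that(1)]])
    then show ?thesis by (simp add: scal_def distrib_right)
  qed
  then show "u + v \<in> stab F" using u v by (simp add: stab_def is_subfieldD[OF E])
  show "inverse u \<in> stab F"
  proof (cases "u = 0")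
    case False
    \<comment> \<open>By finiteness \<open>scal u\<close> maps \<open>F i\<close> onto itself, and
      the preimage of \<open>x\<close> is its multiple by \<open>inverse u\<close>.\<close>
    have "scal (inverse u) x \<in> F i" if i: "i \<le> n" and x: "x \<in> F i" for i x
    proof -
      obtain y where "y \<in> F i" "x = scal u y" using scal_stab_image[OF u False i] x by blast
      then show ?thesis by (simp add: scal_inverse(1)[OF False])
    qed
    then show ?thesis using u by (simp add: stab_def is_subfieldD[OF E])
  qed (use u in simp)
qed

lemma act_eq_iff:
  assumes "u \<in> E" "u \<noteq> 0"
  shows "act u F = F \<longleftrightarrow> u \<in> stab F"
proof
  assume eq: "act u F = F"
  have "scal u ` F i = F i" if "i \<le> n" for i
  proof -
    have "act u F i = scal u ` F i" using that by (simp add: act_def act_flag_def)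
    then show ?thesis unfolding eq ..
  qed
  then show "u \<in> stab F" using assms(1) by (auto simp: stab_def)
next
  assume u: "u \<in> stab F"
  show "act u F = F"
  proof
    fix i
    show "act u F i = F i"
      using scal_stab_image[OF u assms(2), of i] F
      by (cases "i \<le> n") (auto simp: act_def act_flag_def flags_def extensional_def)
  qed
qed

lemma stab_eq_E: 
  assumes "stab F = E"
  shows "F \<in> flags (field_of E) V n"
proof -
  have "subspace (field_of E) (F i) V" if "i \<le> n" for i
  proof (rule EV.subspaceI)
    note W = DV.subspaceD[OF flag_subspace[OF that]]
    show "F i \<subseteq> carrier V" "\<zero>\<^bsub>V\<^esub> \<in> F i" using W(1,2) by simp_all
    show "x \<oplus>\<^bsub>V\<^esub> y \<in> F i" if "x \<in> F i" "y \<in> F i" for x y using W(3) that by simp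
    show "k \<odot>\<^bsub>V\<^esub> x \<in> F i" if "k \<in> carrier (field_of E)" "x \<in> F i" for k x
    proof -
      have "k \<in> stab F" using that(1) assms by simp
      then show ?thesis using that(2) \<open>i \<le> n\<close> by (simp add: stab_def scal_def)
    qed
  qed
  then show ?thesis using F by (simp add: flags_def)
qed

definition orbit :: "(nat \<Rightarrow> (nat \<Rightarrow> 'a) set) set"
  where "orbit = (\<lambda>u. act u F) ` (E - {0})"

text \<open>Orbit and stabiliser: the units carrying \<open>F\<close> to \<open>act u0 F\<close>
  form the coset of \<open>u0\<close> modulo the nonzero elements of \<open>stab F\<close>. The
  product form avoids a division.\<close>

lemma card_orbit: "card orbit * (card (stab F) - 1) = card E - 1"
proof -
  have fin: "finite (stab F)" using finite_E by (simp add: stab_def)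
  have E0: "card (E - {0}) = card E - 1" using is_subfieldD(1)[OF E] finite_E by simp
  have S0: "card (stab F - {0}) = card (stab F) - 1"
    using is_subfieldD(1)[OF is_subfield_stab] fin by simp
  have "card (E - {0}) = card ((\<lambda>u. act u F) ` (E - {0})) * (card (stab F) - 1)"
  proof (rule card_fibres)
    fix G assume "G \<in> (\<lambda>u. act u F) ` (E - {0})"
    then obtain u0 where u0: "u0 \<in> E" "u0 \<noteq> 0" "G = act u0 F" by blast
    have "{u \<in> E - {0}. act u F = G} = (\<lambda>s. u0 * s) ` (stab F - {0})"
    proof
      show "(\<lambda>s. u0 * s) ` (stab F - {0}) \<subseteq> {u \<in> E - {0}. act u F = G}"
      proof
        fix u assume "u \<in> (\<lambda>s. u0 * s) ` (stab F - {0})"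
        then obtain s where s: "s \<in> stab F" "s \<noteq> 0" "u = u0 * s" by blast
        then have sE: "s \<in> E" by (simp add: stab_def)
        have "act s F = F" using act_eq_iff[OF sE s(2)] s(1) by simp
        then have "act u F = G" using act_act[of u0 s F] by (simp add: s(3) u0(3))
        then show "u \<in> {u \<in> E - {0}. act u F = G}"
          using s u0 sE by (simp add: is_subfieldD(4)[OF E])
      qed
      show "{u \<in> E - {0}. act u F = G} \<subseteq> (\<lambda>s. u0 * s) ` (stab F - {0})"
      proof
        fix u assume u: "u \<in> {u \<in> E - {0}. act u F = G}"
        let ?s = "inverse u0 * u"
        have sE: "?s \<in> E" "?s \<noteq> 0" using u u0 by (simp_all add: is_subfieldD(4,6)[OF E])
        have "act ?s F = act (inverse u0) (act u0 F)"
          using u u0(3) act_act[of "inverse u0" u F] by (simp only: mem_Collect_eq)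
        then have "act ?s F = F" using u0(2) act_act[of "inverse u0" u0 F] act_1[OF F] by simp
        then have "?s \<in> stab F" using act_eq_iff[OF sE] by simp
        moreover have "u = u0 * ?s" using u0(2) by (simp add: mult.assoc[symmetric])
        ultimately show "u \<in> (\<lambda>s. u0 * s) ` (stab F - {0})" using sE(2) by blast
      qed
    qed
    moreover have "inj_on (\<lambda>s. u0 * s) (stab F - {0})" using u0(2) by (intro inj_onI) simp
    ultimately show "card {u \<in> E - {0}. act u F = G} = card (stab F) - 1"
      by (simp add: card_image S0)
  qed (use finite_E in simp)
  then show ?thesis by (simp add: orbit_def E0)
qed

lemma dvd_card_orbit:
  assumes N: "\<And>d. 0 < d \<Longrightarrow> d dvd l \<Longrightarrow> d < l \<Longrightarrow> N * (int (card D) ^ d - 1) dvd int (card D) ^ l - 1"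
    and not_E: "F \<notin> flags (field_of E) V n"
  shows "N dvd int (card orbit)"
proof -
  note S = is_subfield_stab
  have S_le: "stab F \<subseteq> E" by (auto simp: stab_def)
  have fin: "finite (stab F)" by (rule finite_subset[OF S_le finite_E])
  \<comment> \<open>Both obtained exponents come from the cardinality formula with
    \<open>r = 1\<close>: \<open>stab F\<close> is a space over \<open>D\<close>, and
    \<open>E\<close> is one over \<open>stab F\<close>. Together they give
    \<open>l = d * e\<close>.\<close>
  obtain d where d: "card (stab F) = card D ^ d"
    using power_space_loc(2)[OF D S D_le_stab fin, of 1, symmetric] unfolding power_one_right ..
  obtain e where e: "card E = card (stab F) ^ e"
    using power_space_loc(2)[OF S E S_le finite_E, of 1, symmetric] unfolding power_one_right ..
  have "card D ^ l = card D ^ (d * e)" using d e card_E by (simp add: power_mult)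
  then have l: "l = d * e" using card_D by (simp only: power_inject_exp)
  have "1 < card (stab F)" by (rule card_subfield_gt_1[OF S fin])
  then have d0: "0 < d" using d by (cases d) simp_all
  have "stab F \<subset> E" using S_le stab_eq_E not_E by blast
  then have "card (stab F) < card E" using finite_E by (rule psubset_card_mono[rotated])
  then have "card D ^ d < card D ^ l" by (simp only: d card_E)
  then have "d < l" by (rule power_less_imp_less_exp[OF card_D])
  moreover have "d dvd l" unfolding l by simp
  ultimately have dvd: "N * (int (card D) ^ d - 1) dvd int (card D) ^ l - 1"
    using N[OF d0] by blast
  have gt: "1 < card D ^ d" "1 < card D ^ l"
    using \<open>1 < card (stab F)\<close> card_subfield_gt_1[OF E finite_E] by (simp_all only: d card_E)
  have "int (card orbit * (card D ^ d - 1)) = int (card D ^ l - 1)"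
    using card_orbit by (simp only: d card_E)
  then have "int (card orbit) * (int (card D) ^ d - 1) = int (card D) ^ l - 1"
    using gt by (simp add: of_nat_diff)
  then have "N * (int (card D) ^ d - 1) dvd int (card orbit) * (int (card D) ^ d - 1)"
    using dvd by simp
  moreover have "int (card D) ^ d - 1 \<noteq> 0" 
  proof -
    have "int 1 < int (card D ^ d)" using gt(1) by (simp only: of_nat_less_iff)
    then show ?thesis by simp
  qed
  ultimately show ?thesis by (simp only: dvd_mult_cancel_right) simp
qed

end

lemma act_E_flag:
  assumes F: "F \<in> flags (field_of E) V n" and u: "u \<in> E" "u \<noteq> 0"
  shows "act u F = F"
proof -
  have "u \<in> stab F"
  proof -
    have "scal u x \<in> F i" if "i \<le> n" "x \<in> F i" for i x
    proof -
      have "subspace (field_of E) (F i) V" using F that(1) by (simp add: flags_def)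
      from EV.subspaceD(4)[OF this, of u x] show ?thesis using u that(2) by (simp add: scal_def)
    qed
    then show ?thesis using u by (simp add: stab_def)
  qed
  then show ?thesis using act_eq_iff[OF flags_E_D[OF F] u] by simp
qed

text \<open>A unit of \<open>E\<close> fixes the two outer flags, so it preserves both position
  conditions; it also keeps flags outside the set of E-flags. The set is therefore a disjoint union
  of orbits to which \<open>dvd_card_orbit\<close> applies.\<close>

lemma dvd_card_non_fixed:
  assumes N: "\<And>d. 0 < d \<Longrightarrow> d dvd l \<Longrightarrow> d < l \<Longrightarrow> N * (int (card D) ^ d - 1) dvd int (card D) ^ l - 1"
    and F: "F \<in> flags (field_of E) V n" and F'': "F'' \<in> flags (field_of E) V n"
  shows "N dvd int (card ({F' \<in> flags (field_of D) V n. rel_pos (field_of D) V n (F, F') = A \<and>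
    rel_pos (field_of D) V n (F', F'') = B} - flags (field_of E) V n))" (is "N dvd int (card ?Y)")
proof -
  define Y where "Y = ?Y"
  have flag: "G \<in> flags (field_of D) V n" if "G \<in> Y" for G using that by (simp add: Y_def)
  have not_E: "G \<notin> flags (field_of E) V n" if "G \<in> Y" for G using that by (simp add: Y_def)
  have stable: "act u G \<in> Y" if G: "G \<in> Y" and u: "u \<in> E" "u \<noteq> 0" for G u
  proof -
    note g = scal_GL[OF u]
    have "rel_pos (field_of D) V n (act u F, act u G) = rel_pos (field_of D) V n (F, G)"
      "rel_pos (field_of D) V n (act u G, act u F'') = rel_pos (field_of D) V n (G, F'')"
      unfolding act_def
      using DV.rel_pos_act_flag[OF g flags_E_D[OF F] flag[OF G]]
        DV.rel_pos_act_flag[OF g flag[OF G] flags_E_D[OF F'']] by simp_all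
    then have "rel_pos (field_of D) V n (F, act u G) = A" "rel_pos (field_of D) V n (act u G, F'') = B"
      using G by (simp_all add: Y_def act_E_flag[OF F u] act_E_flag[OF F'' u])
    moreover have "act u G \<in> flags (field_of D) V n" by (rule act_flags[OF u flag[OF G]])
    moreover have "act u G \<notin> flags (field_of E) V n"
    proof
      assume "act u G \<in> flags (field_of E) V n"
      then have "act (inverse u) (act u G) = act u G"
        using u by (intro act_E_flag) (simp_all add: is_subfieldD(6)[OF E])
      then have "G = act u G" using u(2) act_act[of "inverse u" u G] act_1[OF flag[OF G]] by simp
      then show False using \<open>act u G \<in> flags (field_of E) V n\<close> not_E[OF G] by simp
    qed
    ultimately show ?thesis by (simp add: Y_def)
  qed
  have orbit_le: "orbit G \<subseteq> Y" if "G \<in> Y" for G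
    unfolding orbit_def[OF flag[OF that]] using stable[OF that] by blast
  have mem_orbit: "G \<in> orbit G" if "G \<in> Y" for G
    unfolding orbit_def[OF flag[OF that]]
    using act_1[OF flag[OF that]] is_subfieldD(2)[OF E] by (intro image_eqI[of _ _ 1]) simp_all
  have act_orbit_le: "orbit (act u G) \<subseteq> orbit G" if G: "G \<in> Y" and u: "u \<in> E" "u \<noteq> 0" for G u
  proof
    fix H assume "H \<in> orbit (act u G)"
    then obtain v where v: "v \<in> E" "v \<noteq> 0" "H = act v (act u G)"
      unfolding orbit_def[OF flag[OF stable[OF G u]]] by blast
    then have "H = act (v * u) G" "v * u \<in> E - {0}" using u by (simp_all add: act_act is_subfieldD(4)[OF E])
    then show "H \<in> orbit G" unfolding orbit_def[OF flag[OF G]] by blast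
  qed
  have act_orbit: "orbit (act u G) = orbit G" if G: "G \<in> Y" and u: "u \<in> E" "u \<noteq> 0" for G u
  proof
    have eq: "act (inverse u) (act u G) = G"
      using u(2) act_act[of "inverse u" u G] act_1[OF flag[OF G]] by simp
    have iu: "inverse u \<in> E" "inverse u \<noteq> 0" using u by (simp_all add: is_subfieldD(6)[OF E])
    show "orbit G \<subseteq> orbit (act u G)"
      using act_orbit_le[OF stable[OF G u] iu] unfolding eq .
  qed (rule act_orbit_le[OF G u])
  have orbit_eq: "orbit H = orbit G" if G: "G \<in> Y" and H: "H \<in> orbit G" for G H
  proof -
    obtain u where "u \<in> E" "u \<noteq> 0" "H = act u G"
      using H unfolding orbit_def[OF flag[OF G]] by blast
    then show ?thesis using act_orbit[OF G] by simp
  qed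
  have Y: "\<Union> (orbit ` Y) = Y"
  proof
    show "\<Union> (orbit ` Y) \<subseteq> Y" using orbit_le by (rule UN_least)
    show "Y \<subseteq> \<Union> (orbit ` Y)" 
    proof
      fix G assume "G \<in> Y"
      then show "G \<in> \<Union> (orbit ` Y)" by (intro UN_I[of G] mem_orbit)
    qed
  qed
  have "N dvd int (card (\<Union> (orbit ` Y)))"
  proof -
    have fin: "finite Y" using DV.finite_flags[of n] by (simp add: Y_def)
    have "card (\<Union> (orbit ` Y)) = sum card (orbit ` Y)"
    proof (rule card_Union_disjoint)
      show "pairwise disjnt (orbit ` Y)"
      proof (rule pairwiseI)
        fix P1 P2 assume P: "P1 \<in> orbit ` Y" "P2 \<in> orbit ` Y" "P1 \<noteq> P2"
        obtain G1 where G1: "G1 \<in> Y" "P1 = orbit G1" using P(1) by (rule imageE)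
        obtain G2 where G2: "G2 \<in> Y" "P2 = orbit G2" using P(2) by (rule imageE)
        show "disjnt P1 P2"
          unfolding disjnt_iff
        proof (intro allI notI, elim conjE)
          fix H assume "H \<in> P1" "H \<in> P2"
          then have "orbit H = P1" "orbit H = P2"
            using orbit_eq[OF G1(1), of H] orbit_eq[OF G2(1), of H] by (simp_all only: G1(2) G2(2))
          then show False using P(3) by simp
        qed
      qed
      show "finite A" if A: "A \<in> orbit ` Y" for A
      proof -
        obtain G where "G \<in> Y" "A = orbit G" using A by (rule imageE)
        then show ?thesis using finite_subset[OF orbit_le fin] by simp
      qed
    qed
    moreover have "N dvd (\<Sum>A\<in>orbit ` Y. int (card A))"
    proof (rule dvd_sum)
      fix A assume "A \<in> orbit ` Y"
      then obtain G where G: "G \<in> Y" "A = orbit G" by (rule imageE)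
      show "N dvd int (card A)" unfolding G(2) by (rule dvd_card_orbit[OF flag[OF G(1)] N not_E[OF G(1)]])
    qed
    ultimately show ?thesis by simp
  qed
  then have "N dvd int (card Y)" unfolding Y .
  then show ?thesis unfolding Y_def .
qed

end

section \<open>The congruence of structure constants\<close>

definition scale :: "nat \<Rightarrow> nmat \<Rightarrow> nmat"
  where "scale l C = (\<lambda>i j. l * C i j)"

lemma scale_inject: "0 < l \<Longrightarrow> scale l A = scale l B \<longleftrightarrow> A = B"
  by (simp add: scale_def fun_eq_iff)

lemma scale_Theta_iff: "0 < l \<Longrightarrow> scale l C \<in> Theta n (l * r) \<longleftrightarrow> C \<in> Theta n r"
  by (simp add: scale_def Theta_def sum_distrib_left[symmetric])

text \<open>The structure constants of \<open>S(n, r)\<close> transported along the division of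
  \<open>A\<close> and \<open>B\<close> by \<open>l\<close> and extended by zero. The change of
  parameter from q to q^l is made separately, by substitution into this polynomial.\<close>

definition frob_poly :: "nat \<Rightarrow> nat \<Rightarrow> nat \<Rightarrow> nmat \<Rightarrow> nmat \<Rightarrow> nmat \<Rightarrow> int poly"
  where "frob_poly l n r A B C = (if A \<in> range (scale l) \<and> B \<in> range (scale l)
    then schur_poly n r (inv_into UNIV (scale l) A) (inv_into UNIV (scale l) B) C else 0)"

lemma inj_scale: "0 < l \<Longrightarrow> inj (scale l)"
  by (rule injI) (simp add: scale_inject)

lemma frob_poly_scale: "0 < l \<Longrightarrow> frob_poly l n r (scale l A) (scale l B) C = schur_poly n r A B C"
  by (simp add: frob_poly_def inv_f_f[OF inj_scale])

text \<open>The polynomial divisibility for orders \<open>2 * l\<close> and \<open>2 * d\<close>,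
  evaluated at \<open>t\<close>. It is the hypothesis of the orbit count with \<open>N\<close> the
  cyclotomic value and \<open>t ^ 2\<close> the order of the smaller field.\<close>

lemma poly_cyclotomic_dvd:
  assumes "0 < d" "d dvd l" "d < l"
  shows "poly (cyclotomic (2 * l)) t * ((t ^ 2) ^ d - 1) dvd (t ^ 2) ^ l - 1"
proof -
  have "cyclotomic (2 * l) * (monom 1 (2 * d) - 1) dvd monom 1 (2 * l) - 1"
    by (rule cyclotomic_mult_dvd) (use assms in simp_all)
  then obtain G where G: "monom 1 (2 * l) - 1 = cyclotomic (2 * l) * (monom 1 (2 * d) - 1) * G"
    unfolding dvd_def by blast
  have "t ^ (2 * l) - 1 = poly (cyclotomic (2 * l)) t * (t ^ (2 * d) - 1) * poly G t"
    using arg_cong[OF G, of "\<lambda>p. poly p t"] by (simp add: poly_monom)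
  then show ?thesis by (simp add: power_mult)
qed

text \<open>The integer \<open>t\<close> is a value of \<open>v\<close>, so that \<open>D\<close> has \<open>q = t\<^sup>2\<close> elements.\<close>

lemma structure_constant_congruence:
  assumes D: "is_subfield D" and E: "is_subfield E" and D_le: "D \<subseteq> E" and finite_E: "finite E"
    and card_E: "card E = card D ^ l" and card_D_sq: "int (card D) = t ^ 2" and l: "0 < l"
    and A: "A \<in> Theta n (l * r)" and B: "B \<in> Theta n (l * r)" and C: "C \<in> Theta n r"
  shows "poly (cyclotomic (2 * l)) t dvd
    poly (schur_poly n (l * r) A B (scale l C)) (t ^ 2) - poly (frob_poly l n r A B C) (t ^ (2 * l))"
proof -
  interpret field_tower D E l r n
    by (rule field_tower.intro[OF D E D_le finite_E card_E])
  obtain F F'' where F: "F \<in> flags (field_of E) V n" and F'': "F'' \<in> flags (field_of E) V n"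
    and pos: "rel_pos (field_of E) V n (F, F'') = C"
    using EV.rel_pos_exists[of C n] C by (auto simp: E_dim)
  have scale: "rel_pos (field_of D) V n (G, G') = scale l (rel_pos (field_of E) V n (G, G'))"
    if "G \<in> flags (field_of E) V n" "G' \<in> flags (field_of E) V n" for G G'
    using rel_pos_E_D[OF that] by (simp add: scale_def fun_eq_iff)
  define Y where "Y = {F' \<in> flags (field_of D) V n. rel_pos (field_of D) V n (F, F') = A \<and>
    rel_pos (field_of D) V n (F', F'') = B}"
  have finY: "finite Y" using DV.finite_flags[of n] by (simp add: Y_def)
  have "int (card Y) = poly (position_poly n (l * r) A B (scale l C)) (int (card D))"
    using DV.card_rel_pos[OF flags_E_D[OF F] flags_E_D[OF F''], of A B]
    by (simp add: Y_def D_dim scale[OF F F''] pos)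
  then have cardY: "int (card Y) = poly (schur_poly n (l * r) A B (scale l C)) (t ^ 2)"
    using schur_poly_eq[OF A B, of "scale l C"] C l by (simp add: scale_Theta_iff card_D_sq)
  \<comment> \<open>Positions between E-flags are over \<open>D\<close> the \<open>l\<close>-fold of
    those over \<open>E\<close>. So \<open>Y\<close> contains E-flags only if \<open>l\<close>
    divides \<open>A\<close> and \<open>B\<close>, and these are then counted by the structure
    constant over \<open>E\<close>.\<close>
  have "int (card (Y \<inter> flags (field_of E) V n)) = poly (frob_poly l n r A B C) (t ^ (2 * l))"
  proof (cases "A \<in> range (scale l) \<and> B \<in> range (scale l)")
    case True
    then obtain A' B' where A': "A = scale l A'" and B': "B = scale l B'" by blast
    have "Y \<inter> flags (field_of E) V n = {F' \<in> flags (field_of E) V n.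
        rel_pos (field_of E) V n (F, F') = A' \<and> rel_pos (field_of E) V n (F', F'') = B'}"
      using F F'' flags_E_D by (auto simp: Y_def scale A' B' scale_inject[OF l])
    then have "int (card (Y \<inter> flags (field_of E) V n)) = poly (position_poly n r A' B' C) (int (card E))"
      using EV.card_rel_pos[OF F F'', of A' B'] by (simp add: E_dim pos)
    moreover have "int (card E) = t ^ (2 * l)" by (simp add: card_E card_D_sq power_mult)
    moreover have "position_poly n r A' B' C = schur_poly n r A' B' C"
      using A B C l by (intro schur_poly_eq[symmetric]) (simp_all add: A' B' scale_Theta_iff)
    ultimately show ?thesis by (simp add: A' B' frob_poly_scale[OF l])
  next
    case False
    have "Y \<inter> flags (field_of E) V n = {}"
    proof (rule ccontr)
      assume "\<not> ?thesis"
      then obtain G where "G \<in> Y" "G \<in> flags (field_of E) V n" by blast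
      then have "A = scale l (rel_pos (field_of E) V n (F, G))" "B = scale l (rel_pos (field_of E) V n (G, F''))"
        using F F'' by (auto simp: Y_def scale)
      then show False using False by blast
    qed
    then have "card (Y \<inter> flags (field_of E) V n) = 0" by simp
    moreover have "frob_poly l n r A B C = 0" using False by (simp only: frob_poly_def if_False)
    ultimately show ?thesis by simp
  qed
  moreover have "card Y = card (Y \<inter> flags (field_of E) V n) + card (Y - flags (field_of E) V n)"
    using card_Int_Diff[OF finY] .
  moreover have "poly (cyclotomic (2 * l)) t dvd int (card (Y - flags (field_of E) V n))"
    unfolding Y_def by (rule dvd_card_non_fixed[OF _ F F'']) (simp only: card_D_sq poly_cyclotomic_dvd)
  ultimately show ?thesis unfolding cardY[symmetric] by simp
qed

text \<open>The two compositions substitute v^2 for q and v^(2l) for q^l, so that both sides are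
  polynomials in v. The congruence of values is available at v = 2^(j+1) for every j.\<close>

lemma cyclotomic_dvd_schur_poly:
  assumes l: "0 < l" and A: "A \<in> Theta n (l * r)" and B: "B \<in> Theta n (l * r)" and C: "C \<in> Theta n r"
  shows "cyclotomic (2 * l) dvd
    pcompose (schur_poly n (l * r) A B (scale l C)) (monom 1 2) - pcompose (frob_poly l n r A B C) (monom 1 (2 * l))"
proof (rule monic_dvd_if_infinitely_often[where t = "\<lambda>j. 2 ^ Suc j"])
  show "lead_coeff (cyclotomic (2 * l)) = 1" using l by (intro lead_coeff_cyclotomic) simp
  show "\<exists>j. N \<le> (2::int) ^ Suc j" for N
  proof
    have "N \<le> int (nat N)" by simp
    also have "int (nat N) < int (2 ^ nat N)" by (simp only: of_nat_less_iff less_exp)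
    also have "\<dots> \<le> 2 ^ Suc (nat N)" by simp
    finally show "N \<le> 2 ^ Suc (nat N)" by simp
  qed
  fix j
  \<comment> \<open>The even exponent makes the order of the smaller field the square of the integer
    \<open>2 ^ Suc j\<close>.\<close>
  let ?a = "2 * Suc j"
  have pos: "0 < ?a" "0 < ?a * l" using l by simp_all
  have card_E: "card (gf2 (?a * l)) = card (gf2 ?a) ^ l"
    unfolding card_gf2(1)[OF pos(1)] card_gf2(1)[OF pos(2)] by (rule power_mult)
  have card_D: "int (card (gf2 ?a)) = (2 ^ Suc j) ^ 2"
    unfolding card_gf2(1)[OF pos(1)] by (simp add: power_mult[symmetric] mult.commute)
  show "poly (cyclotomic (2 * l)) (2 ^ Suc j) dvd
      poly (pcompose (schur_poly n (l * r) A B (scale l C)) (monom 1 2) -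
        pcompose (frob_poly l n r A B C) (monom 1 (2 * l))) (2 ^ Suc j)"
    using structure_constant_congruence[OF is_subfield_gf2 is_subfield_gf2 gf2_mono card_gf2(2)[OF pos(2)]
      card_E card_D l A B C]
    by (simp only: poly_diff poly_pcompose poly_monom mult_1)
qed

section \<open>The homomorphism\<close>

lemma eval_laurent_simps:
  "eval_laurent x 0 = 0" "eval_laurent x 1 = 1" "eval_laurent x (pCons a p) = of_int a + x * eval_laurent x p"
  "eval_laurent x (p * p') = eval_laurent x p * eval_laurent x p'"
  "eval_laurent x (p + p') = eval_laurent x p + eval_laurent x p'"
  "eval_laurent x (p - p') = eval_laurent x p - eval_laurent x p'"
  "eval_laurent x (monom 1 k) = x ^ k"
  by (simp_all add: eval_laurent_def of_int_poly_1 map_poly_pCons of_int_poly_mult of_int_poly_add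
      of_int_poly_diff of_int_poly_monom poly_monom)

lemma eval_laurent_pcompose: "eval_laurent x (pcompose p p') = eval_laurent (eval_laurent x p') p"
  by (induction p) (simp_all add: pcompose_pCons eval_laurent_simps)

section \<open>The substitution of v^l for v in Laurent polynomials\<close>

lemma laurent_power_superset:
  assumes "finite S" "Poly_Mapping.keys f \<subseteq> S"
  shows "laurent_power l f = (\<Sum>i\<in>S. Poly_Mapping.single (int l * i) (Poly_Mapping.lookup f i))"
  unfolding laurent_power_def using assms
  by (intro sum.mono_neutral_left) (auto simp: in_keys_iff)

lemma laurent_power_add: "laurent_power l (f + g) = laurent_power l f + laurent_power l g"
proof -
  let ?S = "Poly_Mapping.keys f \<union> Poly_Mapping.keys g"
  have S: "finite ?S" "Poly_Mapping.keys f \<subseteq> ?S" "Poly_Mapping.keys g \<subseteq> ?S"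
    "Poly_Mapping.keys (f + g) \<subseteq> ?S"
    using keys_add[of f g] by auto
  show ?thesis
    unfolding laurent_power_superset[OF S(1,2)] laurent_power_superset[OF S(1,3)]
      laurent_power_superset[OF S(1,4)]
    by (simp add: lookup_add single_add sum.distrib)
qed

lemma laurent_power_sum: "laurent_power l (\<Sum>i\<in>A. f i) = (\<Sum>i\<in>A. laurent_power l (f i))"
  by (induction A rule: infinite_finite_induct)
    (simp_all add: laurent_power_add, simp_all add: laurent_power_def)

lemma laurent_power_single: "laurent_power l (Poly_Mapping.single i a) = Poly_Mapping.single (int l * i) a"
  by (simp add: laurent_power_superset[of "{i}"])

lemma sum_single_lookup:
  "f = (\<Sum>i\<in>Poly_Mapping.keys f. Poly_Mapping.single i (Poly_Mapping.lookup f i))" for f :: laurent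
  by (rule poly_mapping_eqI) (simp add: lookup_sum lookup_single when_def in_keys_iff)

lemma laurent_power_single_mult:
  "laurent_power l (Poly_Mapping.single k 1 * f) = Poly_Mapping.single (int l * k) 1 * laurent_power l f"
proof -
  have "Poly_Mapping.single k 1 * f =
      (\<Sum>i\<in>Poly_Mapping.keys f. Poly_Mapping.single (k + i) (Poly_Mapping.lookup f i))"
    by (subst sum_single_lookup[of f]) (simp add: sum_distrib_left mult_single)
  then have "laurent_power l (Poly_Mapping.single k 1 * f) =
      (\<Sum>i\<in>Poly_Mapping.keys f. Poly_Mapping.single (int l * (k + i)) (Poly_Mapping.lookup f i))"
    by (simp only: laurent_power_sum laurent_power_single)
  then show ?thesis
    by (simp add: laurent_power_def sum_distrib_left mult_single distrib_left)
qed

lemma lv_power: "lv ^ k = Poly_Mapping.single (int k) 1"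
  by (induction k) (simp_all add: lv_def mult_single add.commute flip: single_one)

lemma of_int_laurent: "of_int a = (Poly_Mapping.single 0 a :: laurent)"
  by (rule poly_mapping_eqI) (simp add: lookup_single when_def lookup_of_int)

text \<open>In Horner form \<open>p\<close> is built from constants by addition and multiplication
  with the monomial \<open>lv ^ k\<close>, so additivity and compatibility with monomials suffice.
  For \<open>k = 2\<close> this is the passage from parameter q to q^l.\<close>

lemma laurent_power_eval: "laurent_power l (eval_laurent (lv ^ k) p) = eval_laurent (lv ^ (l * k)) p"
proof (induction p)
  case 0
  show ?case by (simp add: eval_laurent_simps laurent_power_def)
next
  case (pCons a p)
  then show ?case
    unfolding eval_laurent_simps laurent_power_add of_int_laurent laurent_power_single lv_power
      laurent_power_single_mult by simp
qed

section \<open>The cyclotomic quotient of the Laurent polynomials\<close>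

lemma cring_class_ring: "cring (class_ring :: laurent ring)"
  by unfold_locales (auto simp: algebra_simps ac_simps)

lemma ideal_cyc_ideal: "ideal (cyc_ideal l) class_ring"
  unfolding cyc_ideal_def by (rule cring.cgenideal_ideal[OF cring_class_ring]) simp

lemma cring_cyc_ring: "cring (cyc_ring l)"
  unfolding cyc_ring_def by (rule ideal.quotient_is_cring[OF ideal_cyc_ideal cring_class_ring])

lemma cyc_proj_hom: "cyc_proj l \<in> Ring.ring_hom class_ring (cyc_ring l)"
  using ideal.rcos_ring_hom[OF ideal_cyc_ideal[of l]] by (simp add: cyc_proj_def[abs_def] cyc_ring_def)

lemma cyc_proj_simps:
  "cyc_proj l a \<in> carrier (cyc_ring l)"
  "cyc_proj l (a + b) = cyc_proj l a \<oplus>\<^bsub>cyc_ring l\<^esub> cyc_proj l b"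
  "cyc_proj l 0 = \<zero>\<^bsub>cyc_ring l\<^esub>"
proof -
  show "cyc_proj l a \<in> carrier (cyc_ring l)" 
    "cyc_proj l (a + b) = cyc_proj l a \<oplus>\<^bsub>cyc_ring l\<^esub> cyc_proj l b"
    using ring_hom_closed[OF cyc_proj_hom, of a l] ring_hom_add[OF cyc_proj_hom, of a b l] by simp_all
  interpret ideal "cyc_ideal l" class_ring by (rule ideal_cyc_ideal)
  show "cyc_proj l 0 = \<zero>\<^bsub>cyc_ring l\<^esub>"
    unfolding cyc_proj_def cyc_ring_def FactRing_def using a_rcos_const[of 0] zero_closed by simp
qed

lemma cyc_proj_eqI:
  assumes "a - b = eval_laurent lv (cyclotomic (2 * l)) * c"
  shows "cyc_proj l a = cyc_proj l b"
proof -
  interpret ideal "cyc_ideal l" class_ring by (rule ideal_cyc_ideal)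
  interpret Q: cring "cyc_ring l" by (rule cring_cyc_ring)
  have "a - b \<in> cyc_ideal l" unfolding assms cyc_ideal_def cgenideal_def by (auto simp: mult.commute)
  from a_rcos_const[OF this] have "cyc_proj l (a - b) = \<zero>\<^bsub>cyc_ring l\<^esub>"
    by (simp add: cyc_proj_def cyc_ring_def FactRing_def)
  then show ?thesis
    using cyc_proj_simps(2)[of l "a - b" b] cyc_proj_simps(1)[of l b] by simp
qed

lemma cyc_proj_schur_poly:
  assumes l: "0 < l" and A: "A \<in> Theta n (l * r)" and B: "B \<in> Theta n (l * r)" and C: "C \<in> Theta n r"
  shows "cyc_proj l (eval_laurent (lv ^ 2) (schur_poly n (l * r) A B (scale l C))) =
    cyc_proj l (laurent_power l (eval_laurent (lv ^ 2) (frob_poly l n r A B C)))"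
proof -
  obtain G where G: "pcompose (schur_poly n (l * r) A B (scale l C)) (monom 1 2) -
      pcompose (frob_poly l n r A B C) (monom 1 (2 * l)) = cyclotomic (2 * l) * G"
    using cyclotomic_dvd_schur_poly[OF assms] unfolding dvd_def by blast
  show ?thesis
    unfolding laurent_power_eval
    using arg_cong[OF G, of "eval_laurent lv"]
    by (intro cyc_proj_eqI[where c = "eval_laurent lv G"])
      (simp only: eval_laurent_simps eval_laurent_pcompose mult.commute[of l 2])
qed

section \<open>Unit and structure constants after extension of scalars\<close>

lemma based_algebra_basis_mult:
  fixes \<gamma> :: "'i \<Rightarrow> 'i \<Rightarrow> 'i \<Rightarrow> 'r::comm_ring_1"
  assumes "finite I" "A \<in> I" "B \<in> I" "C \<in> I"
  shows "(basis_elt class_ring I A \<otimes>\<^bsub>based_algebra class_ring I u \<gamma>\<^esub> basis_elt class_ring I B) C = \<gamma> A B C"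
proof -
  have "(\<Sum>p\<in>I \<times> I. basis_elt class_ring I A (fst p) * basis_elt class_ring I B (snd p) * \<gamma> (fst p) (snd p) C) =
      (\<Sum>p\<in>I \<times> I. if p = (A, B) then \<gamma> A B C else 0)"
    by (intro sum.cong) (auto simp: basis_elt_def)
  also have "\<dots> = \<gamma> A B C" using assms by simp
  finally show ?thesis
    using assms(4) by (simp add: based_algebra_def class_ring_simps)
qed

definition diag_unit :: "nmat \<Rightarrow> int poly"
  where "diag_unit A = (if \<forall>i j. i \<noteq> j \<longrightarrow> A i j = 0 then 1 else 0)"

lemma S_q_eq: "S_q n m = based_algebra class_ring (Theta n m) diag_unit (schur_poly n m)"
  by (simp add: S_q_def diag_unit_def[abs_def])

text \<open>The functions that \<open>extend_scalars\<close> passes on are defined on all matrices,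
  but coordinates outside \<open>Theta n m\<close> are \<open>undefined\<close> there. The values
  are therefore stated only for indices in \<open>Theta n m\<close>, with the functions themselves
  left abstract.\<close>

lemma S_v_eq:
  obtains u \<gamma> where "S_v n m = based_algebra class_ring (Theta n m) u \<gamma>"
    "\<And>A. A \<in> Theta n m \<Longrightarrow> u A = eval_laurent (lv ^ 2) (diag_unit A)"
    "\<And>A B C. A \<in> Theta n m \<Longrightarrow> B \<in> Theta n m \<Longrightarrow> C \<in> Theta n m \<Longrightarrow>
      \<gamma> A B C = eval_laurent (lv ^ 2) (schur_poly n m A B C)"
proof (rule that)
  show "S_v n m = based_algebra class_ring (Theta n m)
      (\<lambda>A. eval_laurent (lv ^ 2) (\<one>\<^bsub>S_q n m\<^esub> A))
      (\<lambda>A B C. eval_laurent (lv ^ 2)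
        ((basis_elt class_ring (Theta n m) A \<otimes>\<^bsub>S_q n m\<^esub> basis_elt class_ring (Theta n m) B) C))"
    by (simp add: S_v_def extend_scalars_def)
qed (simp_all add: S_q_eq based_algebra_basis_mult finite_Theta, simp add: based_algebra_def)

lemma S_at_eq:
  obtains u \<gamma> where "S_at R \<phi> n m = based_algebra R (Theta n m) u \<gamma>"
    "\<And>A. A \<in> Theta n m \<Longrightarrow> u A = \<phi> (eval_laurent (lv ^ 2) (diag_unit A))"
    "\<And>A B C. A \<in> Theta n m \<Longrightarrow> B \<in> Theta n m \<Longrightarrow> C \<in> Theta n m \<Longrightarrow>
      \<gamma> A B C = \<phi> (eval_laurent (lv ^ 2) (schur_poly n m A B C))"
proof -
  obtain u \<gamma> where S_v: "S_v n m = based_algebra class_ring (Theta n m) u \<gamma>"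
    and u: "\<And>A. A \<in> Theta n m \<Longrightarrow> u A = eval_laurent (lv ^ 2) (diag_unit A)"
    and \<gamma>: "\<And>A B C. A \<in> Theta n m \<Longrightarrow> B \<in> Theta n m \<Longrightarrow> C \<in> Theta n m \<Longrightarrow>
      \<gamma> A B C = eval_laurent (lv ^ 2) (schur_poly n m A B C)"
    by (rule S_v_eq[of n m]) (rule that; assumption)
  show ?thesis
  proof (rule that)
    show "S_at R \<phi> n m = based_algebra R (Theta n m)
        (\<lambda>A. \<phi> (\<one>\<^bsub>S_v n m\<^esub> A))
        (\<lambda>A B C. \<phi> ((basis_elt class_ring (Theta n m) A \<otimes>\<^bsub>S_v n m\<^esub> basis_elt class_ring (Theta n m) B) C))"
      by (simp add: S_at_def extend_scalars_def)
  qed (simp_all add: S_v based_algebra_basis_mult finite_Theta \<gamma>, simp add: based_algebra_def u)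
qed

text \<open>\<open>Q\<close> restricts coordinates along \<sigma>: the basis element at
  \<open>\<sigma> C\<close> goes to the one at \<open>C\<close>, all others go to 0. Comparing the
  coordinates of a product at \<open>\<sigma> C\<close> shows what multiplicativity asks for, namely
  that the constants match for pairs from the image of \<sigma> and vanish for all other
  pairs.\<close>

lemma algebra_hom_restrict:
  fixes R (structure) and \<sigma> :: "'j \<Rightarrow> 'i"
  assumes R: "cring R" and fin: "finite I" "finite J" and \<sigma>: "inj_on \<sigma> J" "\<sigma> ` J \<subseteq> I"
    and u: "\<And>C. C \<in> J \<Longrightarrow> u (\<sigma> C) = v C"
    and \<gamma>_closed: "\<And>A B C. A \<in> I \<Longrightarrow> B \<in> I \<Longrightarrow> C \<in> J \<Longrightarrow> \<gamma> A B (\<sigma> C) \<in> carrier R"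
    and \<gamma>: "\<And>A B C. A \<in> J \<Longrightarrow> B \<in> J \<Longrightarrow> C \<in> J \<Longrightarrow> \<gamma> (\<sigma> A) (\<sigma> B) (\<sigma> C) = \<delta> A B C"
    and \<gamma>_zero: "\<And>A B C. A \<in> I \<Longrightarrow> B \<in> I \<Longrightarrow> C \<in> J \<Longrightarrow> \<not> (A \<in> \<sigma> ` J \<and> B \<in> \<sigma> ` J) \<Longrightarrow> \<gamma> A B (\<sigma> C) = \<zero>"
  defines "Q \<equiv> \<lambda>x. \<lambda>C\<in>J. x (\<sigma> C)"
  shows "Q \<in> algebra_hom R (based_algebra R I u \<gamma>) (based_algebra R J v \<delta>)"
    and "Q ` carrier (based_algebra R I u \<gamma>) = carrier (based_algebra R J v \<delta>)"
proof -
  interpret cring R by (rule R)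
  let ?M = "based_algebra R I u \<gamma>" and ?N = "based_algebra R J v \<delta>"
  have \<sigma>I: "\<sigma> C \<in> I" if "C \<in> J" for C using \<sigma>(2) that by auto
  have closed: "Q x \<in> carrier ?N" if "x \<in> carrier ?M" for x
    using that \<sigma>I by (auto simp: Q_def based_algebra_def)
  have mult: "Q (x \<otimes>\<^bsub>?M\<^esub> y) = Q x \<otimes>\<^bsub>?N\<^esub> Q y" if x: "x \<in> carrier ?M" and y: "y \<in> carrier ?M" for x y
  proof
    fix C
    show "Q (x \<otimes>\<^bsub>?M\<^esub> y) C = (Q x \<otimes>\<^bsub>?N\<^esub> Q y) C"
    proof (cases "C \<in> J")
      case True
      let ?t = "\<lambda>p. (x (fst p) \<otimes> y (snd p)) \<otimes> \<gamma> (fst p) (snd p) (\<sigma> C)"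
      let ?\<tau> = "map_prod \<sigma> \<sigma>"
      have xy: "x A \<in> carrier R" "y A \<in> carrier R" if "A \<in> I" for A
        using x y that by (auto simp: based_algebra_def)
      have t_closed: "?t p \<in> carrier R" if "p \<in> I \<times> I" for p
        using that xy \<gamma>_closed[OF _ _ True] by auto
      have sub: "?\<tau> ` (J \<times> J) \<subseteq> I \<times> I" using \<sigma>I by auto
      have inj: "inj_on ?\<tau> (J \<times> J)" using \<sigma>(1) by (rule map_prod_inj_on) (rule \<sigma>(1))
      have zero: "?t p = \<zero>" if "p \<in> I \<times> I - ?\<tau> ` (J \<times> J)" for p
      proof -
        have "fst p \<in> I" "snd p \<in> I" using that by auto
        moreover have "\<not> (fst p \<in> \<sigma> ` J \<and> snd p \<in> \<sigma> ` J)"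
        proof
          assume "fst p \<in> \<sigma> ` J \<and> snd p \<in> \<sigma> ` J"
          then obtain A B where "A \<in> J" "B \<in> J" "p = ?\<tau> (A, B)" by (cases p) auto
          then have "p \<in> ?\<tau> ` (J \<times> J)" by (intro image_eqI[of _ _ "(A, B)"]) simp_all
          then show False using that by blast
        qed
        ultimately show ?thesis using \<gamma>_zero[OF _ _ True] xy by simp
      qed
      have "Q (x \<otimes>\<^bsub>?M\<^esub> y) C = finsum R ?t (I \<times> I)"
        using True \<sigma>I by (simp add: Q_def based_algebra_def)
      \<comment> \<open>The constants vanish as soon as one index lies outside the image of
        \<sigma>, so only pairs of indices coming from \<open>J\<close> contribute.\<close>
      also have "finsum R ?t (I \<times> I) = finsum R ?t (?\<tau> ` (J \<times> J))"
        by (rule add.finprod_mono_neutral_cong_right) (use fin sub zero t_closed in auto)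
      also have "finsum R ?t (?\<tau> ` (J \<times> J)) = finsum R (\<lambda>p. ?t (?\<tau> p)) (J \<times> J)"
        by (rule finsum_reindex[OF _ inj]) (use t_closed sub in auto)
      also have "finsum R (\<lambda>p. ?t (?\<tau> p)) (J \<times> J) = (Q x \<otimes>\<^bsub>?N\<^esub> Q y) C"
      proof -
        have eq: "?t (?\<tau> p) = (Q x (fst p) \<otimes> Q y (snd p)) \<otimes> \<delta> (fst p) (snd p) C" if "p \<in> J \<times> J" for p
          using that \<gamma>[OF _ _ True] by (auto simp: Q_def)
        have "finsum R (\<lambda>p. ?t (?\<tau> p)) (J \<times> J) =
            finsum R (\<lambda>p. (Q x (fst p) \<otimes> Q y (snd p)) \<otimes> \<delta> (fst p) (snd p) C) (J \<times> J)"
        proof (rule finsum_cong')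
          have "?t (?\<tau> p) \<in> carrier R" if "p \<in> J \<times> J" for p
            using t_closed[of "?\<tau> p"] sub that by blast
          then show "(\<lambda>p. (Q x (fst p) \<otimes> Q y (snd p)) \<otimes> \<delta> (fst p) (snd p) C) \<in> J \<times> J \<rightarrow> carrier R"
            by (intro Pi_I) (simp only: eq[symmetric])
        qed (use eq in simp_all)
        then show ?thesis using True by (simp add: based_algebra_def)
      qed
      finally show ?thesis .
    qed (simp add: Q_def based_algebra_def)
  qed
  show "Q \<in> algebra_hom R ?M ?N"
    unfolding algebra_hom_def
  proof
    show "Q \<in> Ring.ring_hom ?M ?N"
    proof (rule ring_hom_memI)
      show "Q (x \<oplus>\<^bsub>?M\<^esub> y) = Q x \<oplus>\<^bsub>?N\<^esub> Q y" if "x \<in> carrier ?M" "y \<in> carrier ?M" for x y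
        using \<sigma>I by (auto simp: Q_def based_algebra_def)
      show "Q \<one>\<^bsub>?M\<^esub> = \<one>\<^bsub>?N\<^esub>"
        using \<sigma>I u by (auto simp: Q_def based_algebra_def)
    qed (rule closed mult; assumption)+
    show "Q \<in> LinearCombinations.module_hom R ?M ?N"
      using closed \<sigma>I by (auto simp: LinearCombinations.module_hom_def Q_def based_algebra_def)
  qed
  show "Q ` carrier ?M = carrier ?N"
  proof
    show "Q ` carrier ?M \<subseteq> carrier ?N" using closed by blast
    show "carrier ?N \<subseteq> Q ` carrier ?M"
    proof
      fix y assume y: "y \<in> carrier ?N"
      \<comment> \<open>The preimage carries the coordinates of \<open>y\<close> along \<sigma> and
        is zero elsewhere.\<close>
      define x where "x = (\<lambda>A\<in>I. if A \<in> \<sigma> ` J then y (the_inv_into J \<sigma> A) else \<zero>)"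
      have "y (the_inv_into J \<sigma> A) \<in> carrier R" if "A \<in> \<sigma> ` J" for A
        using the_inv_into_into[OF \<sigma>(1) that order_refl] y by (auto simp: based_algebra_def)
      then have "x \<in> carrier ?M" by (auto simp: x_def based_algebra_def)
      moreover have "Q x = y"
      proof
        fix C
        show "Q x C = y C"
          using y \<sigma>I the_inv_into_f_f[OF \<sigma>(1), of C]
          by (cases "C \<in> J") (auto simp: Q_def x_def based_algebra_def PiE_def extensional_def)
      qed
      ultimately show "y \<in> Q ` carrier ?M" by blast
    qed
  qed
qed

theorem corollary3p4:
  fixes l n r :: nat
  assumes "l > 0" and "n > 0" and "r > 0"
  shows "\<exists>Q. Q \<in> algebra_hom (cyc_ring l)
                   (S_at (cyc_ring l) (cyc_proj l) n (l * r))
                   (S_star l (cyc_ring l) (cyc_proj l) n r) \<and>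
             Q ` carrier (S_at (cyc_ring l) (cyc_proj l) n (l * r)) =
             carrier (S_star l (cyc_ring l) (cyc_proj l) n r)"
proof -
  note l = assms(1)
  obtain u \<gamma> where M: "S_at (cyc_ring l) (cyc_proj l) n (l * r) = based_algebra (cyc_ring l) (Theta n (l * r)) u \<gamma>"
    and u: "\<And>A. A \<in> Theta n (l * r) \<Longrightarrow> u A = cyc_proj l (eval_laurent (lv ^ 2) (diag_unit A))"
    and \<gamma>: "\<And>A B C. A \<in> Theta n (l * r) \<Longrightarrow> B \<in> Theta n (l * r) \<Longrightarrow> C \<in> Theta n (l * r) \<Longrightarrow>
      \<gamma> A B C = cyc_proj l (eval_laurent (lv ^ 2) (schur_poly n (l * r) A B C))"
    by (rule S_at_eq[of "cyc_ring l" "cyc_proj l" n "l * r"]) (rule that; assumption)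
  let ?\<phi> = "cyc_proj l \<circ> laurent_power l"
  obtain v \<delta> where N: "S_at (cyc_ring l) ?\<phi> n r = based_algebra (cyc_ring l) (Theta n r) v \<delta>"
    and v: "\<And>A. A \<in> Theta n r \<Longrightarrow> v A = ?\<phi> (eval_laurent (lv ^ 2) (diag_unit A))"
    and \<delta>: "\<And>A B C. A \<in> Theta n r \<Longrightarrow> B \<in> Theta n r \<Longrightarrow> C \<in> Theta n r \<Longrightarrow>
      \<delta> A B C = ?\<phi> (eval_laurent (lv ^ 2) (schur_poly n r A B C))"
    by (rule S_at_eq[of "cyc_ring l" ?\<phi> n r]) (rule that; assumption)
  \<comment> \<open>One formula covers all \<open>A\<close> and \<open>B\<close>, because
    \<open>frob_poly\<close> is zero unless \<open>l\<close> divides both; \<open>h5\<close> and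
    \<open>h6\<close> are its two cases.\<close>
  have \<gamma>': "\<gamma> A B (scale l C) = cyc_proj l (laurent_power l (eval_laurent (lv ^ 2) (frob_poly l n r A B C)))"
    if "A \<in> Theta n (l * r)" "B \<in> Theta n (l * r)" "C \<in> Theta n r" for A B C
    using \<gamma>[OF that(1,2), of "scale l C"] cyc_proj_schur_poly[OF l that] that(3)
    by (simp add: scale_Theta_iff[OF l])
  \<comment> \<open>\<open>frob_poly\<close> tests divisibility by \<open>l\<close> among all
    matrices, the restriction lemma among those indexed by \<open>Theta n r\<close>. For
    \<open>A\<close> with entry sum \<open>l * r\<close> the tests agree, since the quotient has
    entry sum \<open>r\<close>.\<close>
  have range: "A \<in> scale l ` Theta n r \<longleftrightarrow> A \<in> range (scale l)" if "A \<in> Theta n (l * r)" for A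
    using that by (auto simp: scale_Theta_iff[OF l])
  have h1: "inj_on (scale l) (Theta n r)" using inj_scale[OF l] by (rule inj_on_subset) simp
  have h2: "scale l ` Theta n r \<subseteq> Theta n (l * r)" by (auto simp: scale_Theta_iff[OF l])
  have h3: "u (scale l C) = v C" if "C \<in> Theta n r" for C
  proof -
    have "diag_unit (scale l C) = diag_unit C" using l by (simp add: diag_unit_def scale_def)
    \<comment> \<open>The coordinates of the unit are the constants 0 and 1, which the substitution
      of v^l for v fixes.\<close>
    moreover have "laurent_power l (eval_laurent (lv ^ 2) (diag_unit C)) = eval_laurent (lv ^ 2) (diag_unit C)"
      unfolding laurent_power_eval by (simp add: diag_unit_def eval_laurent_simps)
    ultimately show ?thesis using u[of "scale l C"] v[OF that] that by (simp add: scale_Theta_iff[OF l])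
  qed
  have h4: "\<gamma> A B (scale l C) \<in> carrier (cyc_ring l)"
    if "A \<in> Theta n (l * r)" "B \<in> Theta n (l * r)" "C \<in> Theta n r" for A B C
    unfolding \<gamma>'[OF that] by (rule cyc_proj_simps)
  have h5: "\<gamma> (scale l A) (scale l B) (scale l C) = \<delta> A B C"
    if "A \<in> Theta n r" "B \<in> Theta n r" "C \<in> Theta n r" for A B C
    using \<gamma>'[of "scale l A" "scale l B" C] \<delta>[OF that] that
    by (simp add: scale_Theta_iff[OF l] frob_poly_scale[OF l])
  have h6: "\<gamma> A B (scale l C) = \<zero>\<^bsub>cyc_ring l\<^esub>"
    if "A \<in> Theta n (l * r)" "B \<in> Theta n (l * r)" "C \<in> Theta n r"
      "\<not> (A \<in> scale l ` Theta n r \<and> B \<in> scale l ` Theta n r)" for A B C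
  proof -
    have "frob_poly l n r A B C = 0"
      using that(4) unfolding range[OF that(1)] range[OF that(2)] frob_poly_def by (simp only: if_False)
    then show ?thesis
      unfolding \<gamma>'[OF that(1-3)] by (simp add: eval_laurent_simps laurent_power_def cyc_proj_simps(3))
  qed
  note hom = algebra_hom_restrict[where R = "cyc_ring l" and \<sigma> = "scale l" and u = u and v = v and \<gamma> = \<gamma>
    and \<delta> = \<delta>, OF cring_cyc_ring finite_Theta finite_Theta h1 h2 h3 h4 h5 h6]
  show ?thesis
    unfolding M S_star_def N using hom by blast
qed

end
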